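(* Let $M$ be a smooth manifold, $I\subset\mathbb R$ an open interval, $h:I\times M\to(0,\infty)$ continuous, and $\{g_s\}_{s\in I}$ a collection of continuous Riemannian metrics on $M$ such that the local coordinate representations $(s,p)\mapsto(g_s)_{ij}(p)$ are continuous in $(s,p)$. Let $g=-h^2\,\mathrm ds^2+g_s$ on $I\times M$. If $\gamma=(\alpha,\beta)$ is an absolutely continuous curve in $I\times M$, then $$g(\gamma_t',\gamma_t')=-|\tau_\gamma'|^2(t)=-h(\gamma_t)^2\alpha'(t)^2+v_\beta(\alpha_t,t)^2\quad\text{for a.e. }t.$$
   Context: Let $d_{g_s}$ be the length metric on $M$ associated to $g_s$. For an absolutely continuous curve $\beta:[a,b]\to M$ (absolute continuity does not depend on the metric $d_{g_s}$) let $|\beta_t'|_{d_{g_s}}$ be its metric speed with respect to $d_{g_s}$. The generalized metric speed of $\beta$ is $v_\beta(s,t)=\limsup_{\delta\to0}\frac1\delta\int_t^{t+\delta}|\beta_u'|_{d_{g_s}}\,\mathrm du$ for $(s,t)\in I\times[a,b]$. The generalized length element of $\gamma=(\alpha,\beta)$ is $|\tau_\gamma'|^2(t)=h(\gamma_t)^2\alpha'(t)^2-v_\beta(\alpha_t,t)^2$. *)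

theory Defs
  imports "HOL-Analysis.Analysis"
begin

section \<open>Smooth manifolds\<close>

text \<open>The model space \<open>\<real>\<^sup>n\<close> is a real inner product space with an orthonormal basis \<open>E\<close> with
  \<open>n\<close> elements. These are the axioms of class \<open>euclidean_space\<close> except for \<open>Basis \<noteq> {}\<close>, so that
  \<open>n = 0\<close> is not excluded.\<close>

definition orthonormal_basis :: "'e::real_inner set \<Rightarrow> bool" where
  "orthonormal_basis E \<longleftrightarrow> finite E \<and>
     (\<forall>u\<in>E. \<forall>v\<in>E. inner u v = (if u = v then 1 else 0)) \<and>
     (\<forall>x. (\<forall>u\<in>E. inner x u = 0) \<longleftrightarrow> x = 0)"

text \<open>For open \<open>S\<close> in a finite-dimensional space, \<open>Ck_on k S f\<close> says that \<open>f\<close> is \<open>k\<close> times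
  continuously differentiable on \<open>S\<close> (via iterated directional derivatives).\<close>

primrec Ck_on ::
  "nat \<Rightarrow> 'e::real_normed_vector set \<Rightarrow> ('e \<Rightarrow> 'f::real_normed_vector) \<Rightarrow> bool" where
  "Ck_on 0 S f \<longleftrightarrow> continuous_on S f"
| "Ck_on (Suc k) S f \<longleftrightarrow> (\<forall>x\<in>S. f differentiable (at x)) \<and>
     (\<forall>v. Ck_on k S (\<lambda>x. frechet_derivative f (at x) v))"

definition smooth_on :: "'e::real_normed_vector set \<Rightarrow> ('e \<Rightarrow> 'f::real_normed_vector) \<Rightarrow> bool" where
  "smooth_on S f \<longleftrightarrow> (\<forall>k. Ck_on k S f)"

text \<open>A chart \<open>(U, \<phi>)\<close> consists of an open set \<open>U\<close> and a map which is only meaningful on \<open>U\<close>.\<close>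

type_synonym ('a, 'e) chart = "'a set \<times> ('a \<Rightarrow> 'e)"

definition chart_inv :: "('a, 'e) chart \<Rightarrow> 'e \<Rightarrow> 'a" where
  "chart_inv c = inv_into (fst c) (snd c)"

text \<open>The manifold is the whole type \<open>'a\<close>, which is Hausdorff and second countable by its sort.\<close>

definition smooth_atlas ::
  "('a::{t2_space,second_countable_topology}, 'e::real_inner) chart set \<Rightarrow> bool" where
  "smooth_atlas A \<longleftrightarrow>
     (\<forall>(U, \<phi>)\<in>A. open U \<and> open (\<phi> ` U) \<and> homeomorphism U (\<phi> ` U) \<phi> (chart_inv (U, \<phi>))) \<and>
     (\<Union>(U, \<phi>)\<in>A. U) = UNIV \<and>
     (\<forall>(U, \<phi>)\<in>A. \<forall>(V, \<psi>)\<in>A. smooth_on (\<phi> ` (U \<inter> V)) (\<psi> \<circ> chart_inv (U, \<phi>)))"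

definition smooth_near ::
  "('a::topological_space, 'e::real_inner) chart set \<Rightarrow> 'a \<Rightarrow> ('a \<Rightarrow> real) \<Rightarrow> bool" where
  "smooth_near A p f \<longleftrightarrow> (\<forall>(U, \<phi>)\<in>A. p \<in> U \<longrightarrow>
     (\<exists>W. open W \<and> p \<in> W \<and> W \<subseteq> U \<and> smooth_on (\<phi> ` W) (f \<circ> chart_inv (U, \<phi>))))"

text \<open>Tangent vectors at \<open>p\<close> are the derivations at \<open>p\<close> on functions smooth near \<open>p\<close>; for
  extensionality they vanish on all other functions. (Linearity and the Leibniz rule imply that
  \<open>X f\<close> only depends on the germ of \<open>f\<close> at \<open>p\<close>.)\<close>

type_synonym 'a tangent = "('a \<Rightarrow> real) \<Rightarrow> real"

definition tangent_space ::
  "('a::topological_space, 'e::real_inner) chart set \<Rightarrow> 'a \<Rightarrow> 'a tangent set" where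
  "tangent_space A p = {X.
     (\<forall>f. \<not> smooth_near A p f \<longrightarrow> X f = 0) \<and>
     (\<forall>f g. smooth_near A p f \<longrightarrow> smooth_near A p g \<longrightarrow> X (\<lambda>q. f q + g q) = X f + X g) \<and>
     (\<forall>c f. smooth_near A p f \<longrightarrow> X (\<lambda>q. c * f q) = c * X f) \<and>
     (\<forall>f g. smooth_near A p f \<longrightarrow> smooth_near A p g \<longrightarrow>
        X (\<lambda>q. f q * g q) = f p * X g + g p * X f)}"

definition coord_vector ::
  "('a::topological_space, 'e::real_inner) chart set \<Rightarrow> ('a, 'e) chart \<Rightarrow> 'a \<Rightarrow> 'e \<Rightarrow> 'a tangent" where
  "coord_vector A c p e = (\<lambda>f. if smooth_near A p f
     then frechet_derivative (f \<circ> chart_inv c) (at (snd c p)) e else 0)"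


section \<open>Continuous Riemannian metrics\<close>

definition inner_product_on_tangent ::
  "('a::topological_space, 'e::real_inner) chart set \<Rightarrow> 'a
     \<Rightarrow> ('a tangent \<Rightarrow> 'a tangent \<Rightarrow> real) \<Rightarrow> bool" where
  "inner_product_on_tangent A p G \<longleftrightarrow>
     (\<forall>X\<in>tangent_space A p. \<forall>Y\<in>tangent_space A p. G X Y = G Y X) \<and>
     (\<forall>X\<in>tangent_space A p. \<forall>Y\<in>tangent_space A p. \<forall>Z\<in>tangent_space A p.
        G (\<lambda>f. X f + Y f) Z = G X Z + G Y Z) \<and>
     (\<forall>c. \<forall>X\<in>tangent_space A p. \<forall>Z\<in>tangent_space A p. G (\<lambda>f. c * X f) Z = c * G X Z) \<and>
     (\<forall>X\<in>tangent_space A p. X \<noteq> (\<lambda>f. 0) \<longrightarrow> G X X > 0)"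

definition metric_coeff ::
  "('a::topological_space, 'e::real_inner) chart set \<Rightarrow> ('a \<Rightarrow> 'a tangent \<Rightarrow> 'a tangent \<Rightarrow> real)
     \<Rightarrow> ('a, 'e) chart \<Rightarrow> 'e \<Rightarrow> 'e \<Rightarrow> 'a \<Rightarrow> real" where
  "metric_coeff A G c i j p = G p (coord_vector A c p i) (coord_vector A c p j)"

definition continuous_riemannian_metric ::
  "'e set \<Rightarrow> ('a::topological_space, 'e::real_inner) chart set
     \<Rightarrow> ('a \<Rightarrow> 'a tangent \<Rightarrow> 'a tangent \<Rightarrow> real) \<Rightarrow> bool" where
  "continuous_riemannian_metric E A G \<longleftrightarrow>
     (\<forall>p. inner_product_on_tangent A p (G p)) \<and>
     (\<forall>c\<in>A. \<forall>i\<in>E. \<forall>j\<in>E. continuous_on (fst c) (metric_coeff A G c i j))"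


section \<open>Curves and the length metric\<close>

definition curve_differentiable ::
  "('a::topological_space, 'e::real_inner) chart set \<Rightarrow> (real \<Rightarrow> 'a) \<Rightarrow> real \<Rightarrow> bool" where
  "curve_differentiable A \<beta> t \<longleftrightarrow> isCont \<beta> t \<and>
     (\<forall>(U, \<phi>)\<in>A. \<beta> t \<in> U \<longrightarrow> (\<phi> \<circ> \<beta>) differentiable (at t))"

definition velocity ::
  "('a::topological_space, 'e::real_inner) chart set \<Rightarrow> (real \<Rightarrow> 'a) \<Rightarrow> real \<Rightarrow> 'a tangent" where
  "velocity A \<beta> t = (\<lambda>f. if smooth_near A (\<beta> t) f then deriv (f \<circ> \<beta>) t else 0)"

definition C1_curve_on ::
  "('a::topological_space, 'e::real_inner) chart set \<Rightarrow> real set \<Rightarrow> (real \<Rightarrow> 'a) \<Rightarrow> bool" where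
  "C1_curve_on A J \<sigma> \<longleftrightarrow> (\<forall>t\<in>J. \<exists>(U, \<phi>)\<in>A. \<exists>D. \<exists>e>0.
     (\<forall>u\<in>J \<inter> ball t e. \<sigma> u \<in> U \<and> ((\<phi> \<circ> \<sigma>) has_vector_derivative D u) (at u within J)) \<and>
     continuous_on (J \<inter> ball t e) D)"

definition piecewise_C1_path ::
  "('a::topological_space, 'e::real_inner) chart set \<Rightarrow> (real \<Rightarrow> 'a) \<Rightarrow> bool" where
  "piecewise_C1_path A \<sigma> \<longleftrightarrow> continuous_on {0..1} \<sigma> \<and>
     (\<exists>(n::nat) (\<tau>::nat \<Rightarrow> real). \<tau> 0 = 0 \<and> \<tau> n = 1 \<and>
        (\<forall>k<n. \<tau> k < \<tau> (Suc k) \<and> C1_curve_on A {\<tau> k..\<tau> (Suc k)} \<sigma>))"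

definition curve_length ::
  "('a::topological_space, 'e::real_inner) chart set \<Rightarrow> ('a \<Rightarrow> 'a tangent \<Rightarrow> 'a tangent \<Rightarrow> real)
     \<Rightarrow> (real \<Rightarrow> 'a) \<Rightarrow> ennreal" where
  "curve_length A G \<sigma> =
     (\<integral>\<^sup>+u\<in>{0..1}. ennreal (sqrt (G (\<sigma> u) (velocity A \<sigma> u) (velocity A \<sigma> u))) \<partial>lebesgue)"

text \<open>Points in different connected components have distance \<open>\<infinity>\<close>.\<close>

definition length_metric ::
  "('a::topological_space, 'e::real_inner) chart set \<Rightarrow> ('a \<Rightarrow> 'a tangent \<Rightarrow> 'a tangent \<Rightarrow> real)
     \<Rightarrow> 'a \<Rightarrow> 'a \<Rightarrow> ennreal" where
  "length_metric A G p q =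
     (INF \<sigma> \<in> {\<sigma>. piecewise_C1_path A \<sigma> \<and> \<sigma> 0 = p \<and> \<sigma> 1 = q}. curve_length A G \<sigma>)"


section \<open>Absolutely continuous curves and metric speed\<close>

definition abs_continuous_on ::
  "('m \<Rightarrow> 'm \<Rightarrow> ennreal) \<Rightarrow> real \<Rightarrow> real \<Rightarrow> (real \<Rightarrow> 'm) \<Rightarrow> bool" where
  "abs_continuous_on d a b \<beta> \<longleftrightarrow> (\<forall>\<epsilon>>0. \<exists>\<delta>>0. \<forall>(n::nat) (l::nat \<Rightarrow> real) r.
     (\<forall>k<n. a \<le> l k \<and> l k \<le> r k \<and> r k \<le> b) \<and>
     (\<forall>j<n. \<forall>k<n. j \<noteq> k \<longrightarrow> {l j<..<r j} \<inter> {l k<..<r k} = {}) \<and>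
     (\<Sum>k<n. r k - l k) < \<delta>
       \<longrightarrow> (\<Sum>k<n. d (\<beta> (l k)) (\<beta> (r k))) < ennreal \<epsilon>)"

text \<open>Absolute continuity of \<open>\<gamma> = (\<alpha>, \<beta>) : [a,b] \<rightarrow> I \<times> M\<close>. Absolute continuity of \<open>\<beta>\<close> does not
  depend on the choice of \<open>s\<close>, so it is only required for one \<open>s\<close>.\<close>

definition abs_continuous_curve ::
  "('a::topological_space, 'e::real_inner) chart set \<Rightarrow> real set
     \<Rightarrow> (real \<Rightarrow> 'a \<Rightarrow> 'a tangent \<Rightarrow> 'a tangent \<Rightarrow> real)
     \<Rightarrow> real \<Rightarrow> real \<Rightarrow> (real \<Rightarrow> real) \<Rightarrow> (real \<Rightarrow> 'a) \<Rightarrow> bool" where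
  "abs_continuous_curve A I g a b \<alpha> \<beta> \<longleftrightarrow> \<alpha> ` {a..b} \<subseteq> I \<and>
     abs_continuous_on (\<lambda>x y. ennreal (dist x y)) a b \<alpha> \<and>
     (\<exists>s\<in>I. abs_continuous_on (length_metric A (g s)) a b \<beta>)"

text \<open>The limit exists for almost every \<open>t\<close> if \<open>\<beta>\<close> is absolutely continuous.\<close>

definition metric_speed ::
  "('m \<Rightarrow> 'm \<Rightarrow> ennreal) \<Rightarrow> real \<Rightarrow> real \<Rightarrow> (real \<Rightarrow> 'm) \<Rightarrow> real \<Rightarrow> ennreal" where
  "metric_speed d a b \<beta> t =
     Lim (at t within {a..b}) (\<lambda>u. d (\<beta> u) (\<beta> t) / ennreal \<bar>u - t\<bar>)"

text \<open>Both signs of \<open>\<delta>\<close> are allowed, subject to \<open>t + \<delta> \<in> [a,b]\<close>. For \<open>\<delta> < 0\<close> the oriented mean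
  \<open>1/\<delta> \<integral>\<^sub>t\<close> up to \<open>t + \<delta>\<close> is the integral over \<open>[t + \<delta>, t]\<close> divided by \<open>\<bar>\<delta>\<bar>\<close>.\<close>

definition gen_metric_speed ::
  "('a::topological_space, 'e::real_inner) chart set
     \<Rightarrow> (real \<Rightarrow> 'a \<Rightarrow> 'a tangent \<Rightarrow> 'a tangent \<Rightarrow> real)
     \<Rightarrow> real \<Rightarrow> real \<Rightarrow> (real \<Rightarrow> 'a) \<Rightarrow> real \<Rightarrow> real \<Rightarrow> ennreal" where
  "gen_metric_speed A g a b \<beta> s t =
     Limsup (at 0 within {\<delta>. t + \<delta> \<in> {a..b}})
       (\<lambda>\<delta>. (\<integral>\<^sup>+u\<in>closed_segment t (t + \<delta>). metric_speed (length_metric A (g s)) a b \<beta> u \<partial>lebesgue)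
             / ennreal \<bar>\<delta>\<bar>)"

text \<open>\<open>|\<tau>\<^sub>\<gamma>'|\<^sup>2(t)\<close>, extended real-valued because the generalized metric speed may be infinite at
  exceptional \<open>t\<close>.\<close>

definition gen_length_element_sq ::
  "('a::topological_space, 'e::real_inner) chart set
     \<Rightarrow> (real \<times> 'a \<Rightarrow> real) \<Rightarrow> (real \<Rightarrow> 'a \<Rightarrow> 'a tangent \<Rightarrow> 'a tangent \<Rightarrow> real)
     \<Rightarrow> real \<Rightarrow> real \<Rightarrow> (real \<Rightarrow> real) \<Rightarrow> (real \<Rightarrow> 'a) \<Rightarrow> real \<Rightarrow> ereal" where
  "gen_length_element_sq A h g a b \<alpha> \<beta> t =
     ereal ((h (\<alpha> t, \<beta> t))\<^sup>2 * (deriv \<alpha> t)\<^sup>2)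
       - (enn2ereal (gen_metric_speed A g a b \<beta> (\<alpha> t) t))\<^sup>2"

text \<open>The metric \<open>g = -h\<^sup>2 ds\<^sup>2 + g\<^sub>s\<close>, with tangent vectors of \<open>I \<times> M\<close> at \<open>(s, p)\<close> written as pairs
  in \<open>\<real> \<times> T\<^sub>pM\<close>.\<close>

definition spacetime_metric ::
  "(real \<times> 'a \<Rightarrow> real) \<Rightarrow> (real \<Rightarrow> 'a \<Rightarrow> 'a tangent \<Rightarrow> 'a tangent \<Rightarrow> real)
     \<Rightarrow> real \<times> 'a \<Rightarrow> real \<times> 'a tangent \<Rightarrow> real \<times> 'a tangent \<Rightarrow> real" where
  "spacetime_metric h g z X Y =
     - (h z)\<^sup>2 * fst X * fst Y + g (fst z) (snd z) (snd X) (snd Y)"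

end

theory Submission
  imports Defs
begin

text \<open>Both equalities reduce to one claim: at almost every \<open>t\<close>, the generalized metric speed
  \<open>v\<^sub>\<beta>(\<alpha> t, t)\<close> is the \<open>g\<^bsub>\<alpha> t\<^esub>\<close>-norm of the velocity of \<open>\<beta>\<close> at \<open>t\<close>. For each fixed \<open>s\<close> the metric speed
  with respect to \<open>g\<^sub>s\<close> is that norm almost everywhere, and Lebesgue's differentiation theorem would
  give the claim for \<open>v\<^sub>\<beta>(s, t)\<close> outside a null set of \<open>t\<close>. But this null set depends on \<open>s\<close>, whereas
  \<open>v\<^sub>\<beta>\<close> has to be evaluated at \<open>s = \<alpha> t\<close>. The proof therefore chooses the exceptional set from the
  coordinates of \<open>\<beta>\<close> alone, so that it serves every metric at once.

  In a chart, the length metric of a continuous Riemannian metric is comparable, near a point \<open>p\<close> and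
  up to factors \<open>1 \<plusminus> \<epsilon>\<close>, to the distance given by the constant norm \<open>N\<close> which the metric defines at
  \<open>p\<close> (\<open>length_metric_lower_bound\<close>, \<open>length_metric_upper_bound\<close>). Two things follow. The chart
  coordinates of \<open>\<beta>\<close> are absolutely continuous real functions (\<open>abs_continuous_coordinates\<close>). And
  wherever \<open>\<beta>\<close> is differentiable, its metric speed is exactly the norm of its velocity, for every
  metric (\<open>metric_speed_eq_form_norm\<close>).

  An absolutely continuous real function is an indefinite integral of an integrable density \<open>\<rho>\<close>
  (\<open>abs_cont_indefinite_integral\<close>, from the theorem of Radon and Nikodym), almost every point is a
  Lebesgue point of \<open>\<rho>\<close> (\<open>AE_lebesgue_point\<close>, from Vitali's covering theorem), and there the
  function has derivative \<open>\<rho> t\<close>. Let \<open>t\<close> be a Lebesgue point of the densities of all coordinates. For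
  an arbitrary metric, the mean of the metric speed over a short interval at \<open>t\<close> differs by a factor
  \<open>1 \<plusminus> \<epsilon>\<close> from the mean of \<open>N(\<rho> u)\<close>, where \<open>N\<close> is the norm at \<open>\<beta> t\<close>; and \<open>N(\<rho> u)\<close> has a Lebesgue
  point at \<open>t\<close> because \<open>N\<close> is Lipschitz. Hence the means tend to \<open>N(\<rho> t)\<close>, the norm of the velocity
  (\<open>gen_metric_speed_eq_form_norm\<close>).\<close>


section \<open>Lebesgue points\<close>

text \<open>The hypothesis provides a Vitali cover of \<open>S\<close> by balls on which the mean of \<open>g\<close> exceeds \<open>c\<close>. A
  disjoint countable subfamily exhausts \<open>S\<close> up to a null set, and on each of its balls \<open>c\<close> times the
  length is at most the integral of \<open>g\<close>. The set \<open>S\<close> will consist of bad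
  points and is not known to be measurable, whence the hull \<open>T\<close>.\<close>

lemma weak_type_inequality:
  fixes g :: "real \<Rightarrow> ennreal"
  assumes g: "g \<in> borel_measurable lborel" and c: "0 < c"
    and S: "\<And>x d. x \<in> S \<Longrightarrow> 0 < d \<Longrightarrow>
      \<exists>r. 0 < r \<and> r < d \<and> ennreal (c * (2 * r)) < (\<integral>\<^sup>+u\<in>ball x r. g u \<partial>lborel)"
  obtains T where "T \<in> sets lebesgue" "S \<subseteq> T"
    "ennreal c * emeasure lebesgue T \<le> (\<integral>\<^sup>+u. g u \<partial>lborel)"
proof -
  let ?K = "{(x, r). 0 < r \<and> ennreal (c * (2 * r)) < (\<integral>\<^sup>+u\<in>ball x r. g u \<partial>lborel)}"
  obtain C where C: "countable C" "C \<subseteq> ?K"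
     and dis: "pairwise (\<lambda>i j. disjnt (ball (fst i) (snd i)) (ball (fst j) (snd j))) C"
     and neg: "negligible (S - (\<Union>i \<in> C. ball (fst i) (snd i)))"
  proof (rule Vitali_covering_theorem_balls [of S ?K fst snd])
    fix x d :: real assume "x \<in> S" "0 < d"
    with S obtain r where "0 < r" "r < d" "ennreal (c * (2 * r)) < (\<integral>\<^sup>+u\<in>ball x r. g u \<partial>lborel)"
      by blast
    then show "\<exists>i. i \<in> ?K \<and> x \<in> ball (fst i) (snd i) \<and> snd i < d"
      by (intro exI[of _ "(x, r)"]) auto
  qed
  let ?B = "\<lambda>i. ball (fst i) (snd i) :: real set"
  let ?U = "\<Union>i\<in>C. ?B i"
  let ?\<nu> = "density lborel g"
  have df: "disjoint_family_on ?B C"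
    using dis by (auto simp: disjoint_family_on_def pairwise_def disjnt_def)
  have op: "open ?U" by auto
  have "ennreal c * emeasure lborel ?U = ennreal c * (\<integral>\<^sup>+i. emeasure lborel (?B i) \<partial>count_space C)"
    by (subst emeasure_UN_countable) (use C df in auto)
  also have "\<dots> = (\<integral>\<^sup>+i. ennreal c * emeasure lborel (?B i) \<partial>count_space C)"
    by (subst nn_integral_cmult) auto
  also have "\<dots> \<le> (\<integral>\<^sup>+i. emeasure ?\<nu> (?B i) \<partial>count_space C)"
  proof (rule nn_integral_mono)
    fix i assume "i \<in> space (count_space C)"
    then have i: "0 < snd i" "ennreal (c * (2 * snd i)) < (\<integral>\<^sup>+u\<in>?B i. g u \<partial>lborel)"
      using C by auto
    have "emeasure lborel (?B i) = ennreal (2 * snd i)"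
      using i by (simp add: ball_eq_greaterThanLessThan)
    then have "ennreal c * emeasure lborel (?B i) = ennreal (c * (2 * snd i))"
      using c i by (simp add: ennreal_mult)
    also have "\<dots> \<le> (\<integral>\<^sup>+u\<in>?B i. g u \<partial>lborel)" using i by simp
    also have "\<dots> = emeasure ?\<nu> (?B i)"
      by (subst emeasure_density) (use g in auto)
    finally show "ennreal c * emeasure lborel (?B i) \<le> emeasure ?\<nu> (?B i)" .
  qed
  also have "\<dots> = emeasure ?\<nu> ?U"
    by (subst emeasure_UN_countable) (use C df in auto)
  also have "\<dots> \<le> emeasure ?\<nu> UNIV" by (rule emeasure_mono) auto
  also have "\<dots> = (\<integral>\<^sup>+u. g u \<partial>lborel)"
    by (subst emeasure_density) (use g in auto)
  finally have main: "ennreal c * emeasure lborel ?U \<le> (\<integral>\<^sup>+u. g u \<partial>lborel)" .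
  let ?N = "S - ?U"
  have N: "?N \<in> null_sets lebesgue" using neg by (simp add: negligible_iff_null_sets)
  show thesis
  proof (rule that)
    show "?U \<union> ?N \<in> sets lebesgue" using N op by (intro sets.Un) (auto simp: null_sets_def)
    show "S \<subseteq> ?U \<union> ?N" by blast
    have "emeasure lebesgue (?U \<union> ?N) = emeasure lebesgue ?U"
      using N op by (intro emeasure_Un_null_set) auto
    also have "\<dots> = emeasure lborel ?U" using op by simp
    finally show "ennreal c * emeasure lebesgue (?U \<union> ?N) \<le> (\<integral>\<^sup>+u. g u \<partial>lborel)"
      using main by simp
  qed
qed

text \<open>By linearity and dominated convergence it suffices to approximate indicators. A measurable set lies
  between a closed and an open set of nearly the same measure, and Urysohn's lemma interpolates.\<close>

lemma continuous_functions_dense_in_L1: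
  fixes f :: "real \<Rightarrow> real"
  assumes "integrable lborel f" "0 < \<epsilon>"
  shows "\<exists>h. continuous_on UNIV h \<and> (\<integral>\<^sup>+u. ennreal \<bar>f u - h u\<bar> \<partial>lborel) < ennreal \<epsilon>"
  using assms
proof (induction f arbitrary: \<epsilon> rule: integrable_induct)
  case (base A c)
  define \<delta> where "\<delta> = \<epsilon> / (2 * (\<bar>c\<bar> + 1))"
  have d: "0 < \<delta>" using base by (simp add: \<delta>_def)
  have A: "A \<in> lmeasurable" using base by (auto simp: fmeasurable_def)
  obtain U where U: "open U" "A \<subseteq> U" "emeasure lebesgue (U - A) < ennreal \<delta>"
    using sets_lebesgue_outer_open[OF fmeasurableD[OF A] d] by metis
  obtain K where K: "closed K" "K \<subseteq> A" "emeasure lebesgue (A - K) < ennreal \<delta>"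
    using sets_lebesgue_inner_closed[OF fmeasurableD[OF A] d] by metis
  obtain h :: "real \<Rightarrow> real" where h: "continuous_on UNIV h" "\<And>x. h x \<in> closed_segment 1 0"
      "\<And>x. x \<in> K \<Longrightarrow> h x = 1" "\<And>x. x \<in> -U \<Longrightarrow> h x = 0"
  proof (rule Urysohn[of K "-U" "1::real" 0])
    show "K \<inter> - U = {}" using K U by blast
  qed (use K U in \<open>auto simp: closed_Compl\<close>)
  have h01: "0 \<le> h x \<and> h x \<le> 1" for x using h(2)[of x] by (auto simp: closed_segment_eq_real_ivl)
  have "(\<integral>\<^sup>+u. ennreal \<bar>indicator A u *\<^sub>R c - c * h u\<bar> \<partial>lborel)
      \<le> (\<integral>\<^sup>+u. ennreal \<bar>c\<bar> * indicator ((U - A) \<union> (A - K)) u \<partial>lborel)"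
  proof (rule nn_integral_mono)
    fix u
    have "\<bar>indicator A u *\<^sub>R c - c * h u\<bar> = \<bar>c\<bar> * \<bar>indicator A u - h u\<bar>"
      by (simp add: abs_mult[symmetric] algebra_simps)
    also have "\<dots> \<le> \<bar>c\<bar> * indicator ((U - A) \<union> (A - K)) u"
      using h(3,4)[of u] h01[of u] U(2) K(2)
      by (intro mult_left_mono) (auto simp: indicator_def)
    finally show "ennreal \<bar>indicator A u *\<^sub>R c - c * h u\<bar> \<le> ennreal \<bar>c\<bar> * indicator ((U - A) \<union> (A - K)) u"
      by (auto simp: indicator_def ennreal_leI split: if_splits)
  qed
  also have "\<dots> = ennreal \<bar>c\<bar> * emeasure lborel ((U - A) \<union> (A - K))"
    using U K base by (intro nn_integral_cmult_indicator) auto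
  also have "\<dots> \<le> ennreal \<bar>c\<bar> * (emeasure lborel (U - A) + emeasure lborel (A - K))"
    using U K base by (intro mult_left_mono emeasure_subadditive) auto
  also have "\<dots> \<le> ennreal \<bar>c\<bar> * (ennreal \<delta> + ennreal \<delta>)"
    using U K base by (intro mult_left_mono add_mono) (auto simp: less_imp_le emeasure_completion)
  also have "\<dots> = ennreal (\<bar>c\<bar> * (2 * \<delta>))"
    using d by (simp add: ennreal_mult[symmetric] flip: ennreal_plus)
  also have "\<dots> < ennreal \<epsilon>"
    using \<open>0 < \<epsilon>\<close> by (intro ennreal_lessI) (auto simp: \<delta>_def field_simps)
  finally show ?case
    using h by (intro exI[of _ "\<lambda>u. c * h u"]) (auto intro: continuous_intros)
next
  case (add f g)
  have "0 < \<epsilon> / 2" using add by simp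
  obtain h k where h: "continuous_on UNIV h" "(\<integral>\<^sup>+u. ennreal \<bar>f u - h u\<bar> \<partial>lborel) < ennreal (\<epsilon>/2)"
    and k: "continuous_on UNIV k" "(\<integral>\<^sup>+u. ennreal \<bar>g u - k u\<bar> \<partial>lborel) < ennreal (\<epsilon>/2)"
    using add.IH[OF \<open>0 < \<epsilon> / 2\<close>] by blast
  have [measurable]: "f \<in> borel_measurable borel" "g \<in> borel_measurable borel"
    "h \<in> borel_measurable borel" "k \<in> borel_measurable borel"
    using add h k by (auto intro: borel_measurable_continuous_onI dest: borel_measurable_integrable)
  have "(\<integral>\<^sup>+u. ennreal \<bar>(f u + g u) - (h u + k u)\<bar> \<partial>lborel)
    \<le> (\<integral>\<^sup>+u. ennreal \<bar>f u - h u\<bar> + ennreal \<bar>g u - k u\<bar> \<partial>lborel)"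
    by (rule nn_integral_mono) (auto simp flip: ennreal_plus intro!: ennreal_leI)
  also have "\<dots> = (\<integral>\<^sup>+u. ennreal \<bar>f u - h u\<bar> \<partial>lborel) + (\<integral>\<^sup>+u. ennreal \<bar>g u - k u\<bar> \<partial>lborel)"
    by (rule nn_integral_add) auto
  also have "\<dots> < ennreal (\<epsilon>/2) + ennreal (\<epsilon>/2)"
    using h k by (intro add_strict_mono) auto
  also have "\<dots> = ennreal \<epsilon>" using add by (simp flip: ennreal_plus)
  finally show ?case using h k by (intro exI[of _ "\<lambda>u. h u + k u"]) (auto intro: continuous_intros)
next
  case (lim f s)
  have [measurable]: "f \<in> borel_measurable borel" "\<And>i. s i \<in> borel_measurable borel"
    using lim by (auto dest: borel_measurable_integrable)
  have "(\<lambda>i. \<integral>\<^sup>+u. ennreal (norm (f u - s i u)) \<partial>lborel) \<longlonglongrightarrow> 0"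
  proof (rule nn_integral_dominated_convergence_norm[where w="\<lambda>u. 2 * norm (f u)"])
    show "(\<integral>\<^sup>+u. ennreal (2 * norm (f u)) \<partial>lborel) < \<infinity>"
      using lim(4) by (simp add: integrable_iff_bounded nn_integral_cmult ennreal_mult ennreal_mult_less_top)
  qed (use lim in auto)
  moreover have "0 < ennreal (\<epsilon> / 2)" using lim by simp
  ultimately have "\<forall>\<^sub>F i in sequentially. (\<integral>\<^sup>+u. ennreal (norm (f u - s i u)) \<partial>lborel) < ennreal (\<epsilon> / 2)"
    by (rule order_tendstoD)
  then obtain i where i: "(\<integral>\<^sup>+u. ennreal \<bar>f u - s i u\<bar> \<partial>lborel) < ennreal (\<epsilon> / 2)"
    by (auto dest: eventually_happens)
  obtain h where h: "continuous_on UNIV h" "(\<integral>\<^sup>+u. ennreal \<bar>s i u - h u\<bar> \<partial>lborel) < ennreal (\<epsilon>/2)"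
    using lim.IH[of "\<epsilon> / 2" i] lim.prems by auto
  have [measurable]: "h \<in> borel_measurable borel"
    using h by (auto intro: borel_measurable_continuous_onI)
  have "(\<integral>\<^sup>+u. ennreal \<bar>f u - h u\<bar> \<partial>lborel)
    \<le> (\<integral>\<^sup>+u. ennreal \<bar>f u - s i u\<bar> + ennreal \<bar>s i u - h u\<bar> \<partial>lborel)"
    by (rule nn_integral_mono) (auto simp flip: ennreal_plus intro!: ennreal_leI)
  also have "\<dots> = (\<integral>\<^sup>+u. ennreal \<bar>f u - s i u\<bar> \<partial>lborel) + (\<integral>\<^sup>+u. ennreal \<bar>s i u - h u\<bar> \<partial>lborel)"
    by (rule nn_integral_add) auto
  also have "\<dots> < ennreal (\<epsilon>/2) + ennreal (\<epsilon>/2)"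
    using h i by (intro add_strict_mono) auto
  also have "\<dots> = ennreal \<epsilon>" using lim.prems by (simp flip: ennreal_plus)
  finally show ?case using h by blast
qed

text \<open>Both signs of \<open>\<delta>\<close> are allowed, as in the definition of the generalized metric speed.\<close>

abbreviation segment_mean :: "(real \<Rightarrow> ennreal) \<Rightarrow> real \<Rightarrow> real \<Rightarrow> ennreal" where
  "segment_mean f t \<delta> \<equiv> (\<integral>\<^sup>+u\<in>closed_segment t (t + \<delta>). f u \<partial>lborel) / ennreal \<bar>\<delta>\<bar>"

definition lebesgue_point :: "(real \<Rightarrow> real) \<Rightarrow> real \<Rightarrow> bool" where
  "lebesgue_point f t \<longleftrightarrow>
     ((\<lambda>\<delta>. segment_mean (\<lambda>u. ennreal \<bar>f u - f t\<bar>) t \<delta>) \<longlongrightarrow> 0) (at 0)"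

text \<open>Approximate \<open>f\<close> in \<open>L\<^sup>1\<close> by a continuous \<open>h\<close>. The means of \<open>\<bar>f - f t\<bar>\<close> on small balls are at most those of
  \<open>\<bar>f - h\<bar>\<close>, plus the oscillation of \<open>h\<close>, which tends to 0, plus \<open>\<bar>f t - h t\<bar>\<close>. The first term is controlled
  by the weak type inequality and the last by Markov's inequality, both in terms of the \<open>L\<^sup>1\<close> distance
  of \<open>f\<close> and \<open>h\<close>, which is arbitrarily small.\<close>

lemma AE_mean_oscillation_small:
  fixes f :: "real \<Rightarrow> real"
  assumes f: "integrable lborel f" and \<epsilon>: "0 < \<epsilon>"
  shows "AE t in lebesgue. \<exists>d>0. \<forall>r. 0 < r \<and> r < d \<longrightarrow>
    (\<integral>\<^sup>+u\<in>ball t r. ennreal \<bar>f u - f t\<bar> \<partial>lborel) \<le> ennreal (\<epsilon> * (2 * r))"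
proof -
  define bad where "bad = {t. \<forall>d>0. \<exists>r. 0 < r \<and> r < d \<and>
    ennreal (\<epsilon> * (2 * r)) < (\<integral>\<^sup>+u\<in>ball t r. ennreal \<bar>f u - f t\<bar> \<partial>lborel)}"
  have [measurable]: "f \<in> borel_measurable borel" using f by auto
  have cover: "\<exists>T. T \<in> sets lebesgue \<and> bad \<subseteq> T \<and> emeasure lebesgue T \<le> ennreal e" if "0 < e" for e :: real
  proof -
    \<comment> \<open>Each of three error terms gets \<open>\<epsilon> / 3\<close>; the two exceptional sets then have measure at most
    \<open>\<eta> / c = e / 2\<close> each.\<close>
    define \<eta> where "\<eta> = e * \<epsilon> / 6"
    define c where "c = \<epsilon> / 3"
    have c: "0 < c" and \<eta>: "0 < \<eta>" using that \<epsilon> by (auto simp: \<eta>_def c_def)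
    obtain h where h: "continuous_on UNIV h" "(\<integral>\<^sup>+u. ennreal \<bar>f u - h u\<bar> \<partial>lborel) < ennreal \<eta>"
      using continuous_functions_dense_in_L1[OF f \<eta>] by blast
    have hm[measurable]: "h \<in> borel_measurable borel"
      using h by (auto intro: borel_measurable_continuous_onI)
    define D where "D = {t. c \<le> \<bar>f t - h t\<bar>}"
    have D: "D \<in> sets borel" unfolding D_def by measurable
    define g where "g = (\<lambda>u. ennreal \<bar>f u - h u\<bar>)"
    have g[measurable]: "g \<in> borel_measurable lborel" unfolding g_def by measurable
    have weak: "\<exists>r. 0 < r \<and> r < d \<and> ennreal (c * (2 * r)) < (\<integral>\<^sup>+u\<in>ball t r. g u \<partial>lborel)"
      if t: "t \<in> bad - D" and d: "0 < d" for t d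
    proof -
      have "isCont h t" using h by (simp add: continuous_on_eq_continuous_at)
      then obtain d' where d': "0 < d'" "\<And>u. \<bar>u - t\<bar> < d' \<Longrightarrow> \<bar>h u - h t\<bar> < c"
        using c unfolding continuous_at_eps_delta dist_real_def by blast
      obtain r where r: "0 < r" "r < min d d'"
        "ennreal (\<epsilon> * (2 * r)) < (\<integral>\<^sup>+u\<in>ball t r. ennreal \<bar>f u - f t\<bar> \<partial>lborel)"
      proof -
        have "0 < min d d'" using d d'(1) by simp
        then show ?thesis using t that unfolding bad_def by blast
      qed
      have "(\<integral>\<^sup>+u\<in>ball t r. ennreal \<bar>f u - f t\<bar> \<partial>lborel)
         \<le> (\<integral>\<^sup>+u. g u * indicator (ball t r) u + ennreal (2 * c) * indicator (ball t r) u \<partial>lborel)"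
      proof (rule nn_integral_mono)
        fix u
        show "ennreal \<bar>f u - f t\<bar> * indicator (ball t r) u
          \<le> g u * indicator (ball t r) u + ennreal (2 * c) * indicator (ball t r) u"
        proof (cases "u \<in> ball t r")
          case True
          then have "\<bar>u - t\<bar> < d'" using r by (auto simp: dist_real_def abs_minus_commute)
          then have "\<bar>h u - h t\<bar> < c" by (rule d')
          moreover have "\<bar>f t - h t\<bar> < c" using t by (auto simp: D_def)
          ultimately have "\<bar>f u - f t\<bar> \<le> \<bar>f u - h u\<bar> + 2 * c" by linarith
          then show ?thesis using True c by (auto simp: g_def simp flip: ennreal_plus intro!: ennreal_leI)
        qed auto
      qed
      also have "\<dots> = (\<integral>\<^sup>+u\<in>ball t r. g u \<partial>lborel) + (\<integral>\<^sup>+u. ennreal (2 * c) * indicator (ball t r) u \<partial>lborel)"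
        by (rule nn_integral_add) (use g in \<open>auto intro!: borel_measurable_times_ennreal borel_measurable_indicator\<close>)
      also have "(\<integral>\<^sup>+u. ennreal (2 * c) * indicator (ball t r) u \<partial>lborel) = ennreal (2 * c) * emeasure lborel (ball t r)"
        by (rule nn_integral_cmult_indicator) simp
      also have "emeasure lborel (ball t r) = ennreal (2 * r)"
        using r by (simp add: ball_eq_greaterThanLessThan)
      finally have "ennreal (\<epsilon> * (2 * r)) < (\<integral>\<^sup>+u\<in>ball t r. g u \<partial>lborel) + ennreal (2 * c * (2 * r))"
        using r(3) ennreal_mult[of "2 * c" "2 * r"] r(1) c by (simp only: order.strict_trans2 mult_nonneg_nonneg less_imp_le zero_less_numeral mult_pos_pos)
      moreover have "ennreal (\<epsilon> * (2 * r)) = ennreal (c * (2 * r)) + ennreal (2 * c * (2 * r))"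
        using r c by (simp add: c_def flip: ennreal_plus)
      ultimately have "ennreal (c * (2 * r)) < (\<integral>\<^sup>+u\<in>ball t r. g u \<partial>lborel)"
        using add_right_mono[of "\<integral>\<^sup>+u\<in>ball t r. g u \<partial>lborel" "ennreal (c * (2 * r))" "ennreal (2 * c * (2 * r))"]
        by (simp only: not_le[symmetric]) blast
      with r show ?thesis by auto
    qed
    obtain T1 where T1: "T1 \<in> sets lebesgue" "bad - D \<subseteq> T1"
      "ennreal c * emeasure lebesgue T1 \<le> (\<integral>\<^sup>+u. g u \<partial>lborel)"
      using weak_type_inequality[OF g c weak] by blast
    have "ennreal c * emeasure lebesgue D = ennreal c * emeasure lborel D"
      using D by simp
    also have "\<dots> = (\<integral>\<^sup>+u. ennreal c * indicator D u \<partial>lborel)"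
      using D by (simp add: nn_integral_cmult_indicator)
    also have "\<dots> \<le> (\<integral>\<^sup>+u. g u \<partial>lborel)"
      by (rule nn_integral_mono) (auto simp: g_def D_def indicator_def intro!: ennreal_leI)
    finally have "ennreal c * emeasure lebesgue D \<le> (\<integral>\<^sup>+u. g u \<partial>lborel)" .
    moreover have "(\<integral>\<^sup>+u. g u \<partial>lborel) \<le> ennreal \<eta>" using h by (simp add: g_def)
    moreover have le: "x \<le> ennreal (e / 2)" if "ennreal c * x \<le> ennreal \<eta>" for x
    proof -
      have "x = ennreal (1 / c) * (ennreal c * x)" 
        using c by (simp add: mult.assoc[symmetric] ennreal_mult[symmetric])
      also have "\<dots> \<le> ennreal (1 / c) * ennreal \<eta>" using that by (rule mult_left_mono) auto
      also have "\<dots> = ennreal (e / 2)"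
        using c \<epsilon> \<eta> by (simp add: ennreal_mult[symmetric] \<eta>_def c_def)
      finally show ?thesis .
    qed
    ultimately have "emeasure lebesgue D \<le> ennreal (e/2)" "emeasure lebesgue T1 \<le> ennreal (e/2)"
      using order_trans[OF T1(3)] order_trans[of "ennreal c * emeasure lebesgue D"] by (simp_all add: le)
    then have "emeasure lebesgue (T1 \<union> D) \<le> ennreal (e/2) + ennreal (e/2)"
      using T1 D by (intro order_trans[OF emeasure_subadditive] add_mono) auto
    also have "\<dots> = ennreal e" using that by (simp flip: ennreal_plus)
    finally show ?thesis using T1 D by (intro exI[of _ "T1 \<union> D"]) auto
  qed
  have "negligible bad"
    unfolding negligible_outer_le
  proof (intro allI impI)
    fix e :: real assume "0 < e"
    then obtain T where "T \<in> sets lebesgue" "bad \<subseteq> T" "emeasure lebesgue T \<le> ennreal e"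
      using cover by blast
    moreover from this have "emeasure lebesgue T < \<infinity>"
      using ennreal_less_top[of e] by (simp add: order.strict_trans1)
    ultimately show "\<exists>T. bad \<subseteq> T \<and> T \<in> lmeasurable \<and> measure lebesgue T \<le> e"
      using \<open>0 < e\<close> by (intro exI[of _ T]) (simp add: fmeasurable_def measure_def enn2real_leI)
  qed
  then have "bad \<in> null_sets lebesgue" by (simp add: negligible_iff_null_sets)
  then show ?thesis
    by (rule AE_I') (force simp: bad_def not_less)
qed

text \<open>Centred balls dominate one-sided segments, since the segment from \<open>t\<close> to \<open>t + \<delta>\<close> lies in the ball of
  radius \<open>2 \<bar>\<delta>\<bar>\<close>, whose length is \<open>4 \<bar>\<delta>\<bar>\<close>.\<close>

theorem AE_lebesgue_point:
  fixes f :: "real \<Rightarrow> real"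
  assumes f: "integrable lborel f"
  shows "AE t in lebesgue. lebesgue_point f t"
proof -
  have "AE t in lebesgue. \<forall>k::nat. \<exists>d>0. \<forall>r. 0 < r \<and> r < d \<longrightarrow>
    (\<integral>\<^sup>+u\<in>ball t r. ennreal \<bar>f u - f t\<bar> \<partial>lborel) \<le> ennreal (1 / Suc k * (2 * r))"
    unfolding AE_all_countable by (intro allI AE_mean_oscillation_small[OF f]) auto
  then show ?thesis
  proof (rule AE_mp, intro AE_I2 impI)
    fix t assume *: "\<forall>k::nat. \<exists>d>0. \<forall>r. 0 < r \<and> r < d \<longrightarrow>
      (\<integral>\<^sup>+u\<in>ball t r. ennreal \<bar>f u - f t\<bar> \<partial>lborel) \<le> ennreal (1 / Suc k * (2 * r))"
    show "lebesgue_point f t"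
      unfolding lebesgue_point_def
    proof (rule order_tendstoI)
      fix e :: ennreal assume "0 < e"
      then obtain e' where e': "0 < e'" "ennreal e' \<le> e"
      proof (cases e)
        case (real r)
        then show ?thesis using \<open>0 < e\<close> by (intro that[of r]) auto
      next
        case top
        then show ?thesis by (intro that[of 1]) auto
      qed
      obtain k where k: "4 / real (Suc k) < e'"
        using reals_Archimedean[of "e' / 4"] e' by (auto simp: inverse_eq_divide)
      obtain d where d: "0 < d" "\<And>r. 0 < r \<Longrightarrow> r < d \<Longrightarrow>
        (\<integral>\<^sup>+u\<in>ball t r. ennreal \<bar>f u - f t\<bar> \<partial>lborel) \<le> ennreal (1 / Suc k * (2 * r))"
        using * by blast
      have "segment_mean (\<lambda>u. ennreal \<bar>f u - f t\<bar>) t \<delta> < e"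
        if \<delta>: "\<delta> \<noteq> 0" "\<bar>\<delta>\<bar> < d / 2" for \<delta>
      proof -
        have "closed_segment t (t + \<delta>) \<subseteq> ball t (2 * \<bar>\<delta>\<bar>)"
          using \<delta> by (auto simp: closed_segment_eq_real_ivl dist_real_def split: if_splits)
        then have "(\<integral>\<^sup>+u\<in>closed_segment t (t + \<delta>). ennreal \<bar>f u - f t\<bar> \<partial>lborel)
            \<le> (\<integral>\<^sup>+u\<in>ball t (2 * \<bar>\<delta>\<bar>). ennreal \<bar>f u - f t\<bar> \<partial>lborel)"
          by (intro nn_integral_mono mult_left_mono) (auto simp: indicator_def)
        also have "\<dots> \<le> ennreal (1 / Suc k * (2 * (2 * \<bar>\<delta>\<bar>)))"
          using \<delta> by (intro d) auto
        finally have "segment_mean (\<lambda>u. ennreal \<bar>f u - f t\<bar>) t \<delta>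
            \<le> ennreal (1 / Suc k * (2 * (2 * \<bar>\<delta>\<bar>))) / ennreal \<bar>\<delta>\<bar>"
          by (rule divide_right_mono_ennreal)
        also have "\<dots> = ennreal (4 / Suc k)"
          using \<delta> by (subst divide_ennreal) auto
        also have "\<dots> < ennreal e'" using k e' by (intro ennreal_lessI) auto
        finally show ?thesis using e' by simp
      qed
      then show "\<forall>\<^sub>F \<delta> in at 0. segment_mean (\<lambda>u. ennreal \<bar>f u - f t\<bar>) t \<delta> < e"
        unfolding eventually_at using d(1) by (intro exI[of _ "d / 2"]) (auto simp: dist_real_def)
    qed auto
  qed
qed

section \<open>Absolutely continuous real functions\<close>

text \<open>Families of intervals are indexed by arbitrary finite sets, not by initial segments of the natural
  numbers: below, families get refined (index pairs), cut, extended by one interval, or are indexed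
  by the intervals themselves.\<close>

definition nonoverlapping :: "'i set \<Rightarrow> ('i \<Rightarrow> real) \<Rightarrow> ('i \<Rightarrow> real) \<Rightarrow> real \<Rightarrow> real \<Rightarrow> bool" where
  "nonoverlapping J l r c d \<longleftrightarrow> finite J \<and> (\<forall>k\<in>J. c \<le> l k \<and> l k \<le> r k \<and> r k \<le> d) \<and>
     (\<forall>j\<in>J. \<forall>k\<in>J. j \<noteq> k \<longrightarrow> {l j<..<r j} \<inter> {l k<..<r k} = {})"

abbreviation total_length :: "'i set \<Rightarrow> ('i \<Rightarrow> real) \<Rightarrow> ('i \<Rightarrow> real) \<Rightarrow> real" where
  "total_length J l r \<equiv> \<Sum>k\<in>J. r k - l k"

abbreviation increments :: "(real \<Rightarrow> real) \<Rightarrow> 'i set \<Rightarrow> ('i \<Rightarrow> real) \<Rightarrow> ('i \<Rightarrow> real) \<Rightarrow> real" where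
  "increments f J l r \<equiv> \<Sum>k\<in>J. \<bar>f (r k) - f (l k)\<bar>"

definition abs_cont :: "real \<Rightarrow> real \<Rightarrow> (real \<Rightarrow> real) \<Rightarrow> bool" where
  "abs_cont c d f \<longleftrightarrow> (\<forall>\<epsilon>>0. \<exists>\<delta>>0. \<forall>(J::nat set) l r.
     nonoverlapping J l r c d \<and> total_length J l r < \<delta> \<longrightarrow> increments f J l r < \<epsilon>)"

lemma nonoverlapping_reindex:
  assumes "nonoverlapping J l r c d" "bij_betw h H J"
  shows "nonoverlapping H (l \<circ> h) (r \<circ> h) c d"
proof -
  have "inj_on h H" "h ` H = J" using assms(2) by (auto simp: bij_betw_def)
  moreover have "finite H" using assms by (simp add: nonoverlapping_def bij_betw_finite)
  ultimately show ?thesis using assms(1)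
    unfolding nonoverlapping_def by (force simp: inj_on_def)
qed

lemma nonoverlappingD:
  assumes "nonoverlapping J l r c d"
  shows "finite J" "\<And>k. k \<in> J \<Longrightarrow> c \<le> l k" "\<And>k. k \<in> J \<Longrightarrow> l k \<le> r k" "\<And>k. k \<in> J \<Longrightarrow> r k \<le> d"
    "\<And>j k. j \<in> J \<Longrightarrow> k \<in> J \<Longrightarrow> j \<noteq> k \<Longrightarrow> {l j<..<r j} \<inter> {l k<..<r k} = {}"
  using assms unfolding nonoverlapping_def by blast+

lemma nonoverlapping_shrink:
  assumes J: "nonoverlapping J l r c d"
    and "\<And>k. k \<in> J \<Longrightarrow> c' \<le> l' k" "\<And>k. k \<in> J \<Longrightarrow> l' k \<le> r' k" "\<And>k. k \<in> J \<Longrightarrow> r' k \<le> d'"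
    and sub: "\<And>k. k \<in> J \<Longrightarrow> {l' k<..<r' k} \<subseteq> {l k<..<r k}"
  shows "nonoverlapping J l' r' c' d'"
  unfolding nonoverlapping_def
proof (intro conjI ballI impI)
  fix j k assume "j \<in> J" "k \<in> J" "j \<noteq> k"
  then show "{l' j<..<r' j} \<inter> {l' k<..<r' k} = {}"
    using nonoverlappingD(5)[OF J] sub by blast
qed (use assms nonoverlappingD[OF J] in auto)

text \<open>The definition of absolute continuity quantifies over index sets of natural numbers; a bijection
  transfers it to any index type.\<close>

lemma abs_cont_obtain:
  assumes "abs_cont c d f" "0 < \<epsilon>"
  obtains \<delta> where "0 < \<delta>" "\<And>(J::'i set) l r. nonoverlapping J l r c d \<Longrightarrow> total_length J l r < \<delta> \<Longrightarrow>
      increments f J l r < \<epsilon>"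
proof -
  obtain \<delta> where \<delta>: "0 < \<delta>" "\<And>(J::nat set) l r. nonoverlapping J l r c d \<Longrightarrow> total_length J l r < \<delta> \<Longrightarrow>
      increments f J l r < \<epsilon>"
    using assms unfolding abs_cont_def by metis
  show thesis
  proof (rule that[OF \<delta>(1)])
    fix J :: "'i set" and l r
    assume J: "nonoverlapping J l r c d" "total_length J l r < \<delta>"
    then have "finite J" by (simp add: nonoverlapping_def)
    then obtain h where h: "bij_betw h {0..<card J} J" using ex_bij_betw_nat_finite by blast
    have s: "(\<Sum>k\<in>{0..<card J}. F (h k)) = (\<Sum>k\<in>J. F k)" for F :: "'i \<Rightarrow> real"
      using sum.reindex_bij_betw[OF h] .
    show "increments f J l r < \<epsilon>"
      using \<delta>(2)[OF nonoverlapping_reindex[OF J(1) h]] J(2) s[of "\<lambda>k. r k - l k"] s[of "\<lambda>k. \<bar>f (r k) - f (l k)\<bar>"]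
      by simp
  qed
qed

text \<open>The bridge from curves in \<open>M\<close> to real functions: the distance is allowed to take values in
  \<open>ennreal\<close>, and \<open>f\<close> will be a chart coordinate of the curve on a subinterval.\<close>

lemma abs_cont_dominated:
  assumes \<beta>: "abs_continuous_on D a b \<beta>" and sub: "a \<le> c" "d \<le> b" and C: "0 < C"
    and dom: "\<And>s t. c \<le> s \<Longrightarrow> s \<le> t \<Longrightarrow> t \<le> d \<Longrightarrow> ennreal \<bar>f t - f s\<bar> \<le> ennreal C * D (\<beta> s) (\<beta> t)"
  shows "abs_cont c d f"
  unfolding abs_cont_def
proof (intro allI impI)
  fix \<epsilon> :: real
  assume "0 < \<epsilon>"
  define \<epsilon>' where "\<epsilon>' = \<epsilon> / (2 * C)"
  have "0 < \<epsilon>'" using \<open>0 < \<epsilon>\<close> C by (simp add: \<epsilon>'_def)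
  with \<beta> obtain \<delta> where \<delta>: "0 < \<delta>" "\<forall>(n::nat) (l::nat \<Rightarrow> real) r.
     (\<forall>k<n. a \<le> l k \<and> l k \<le> r k \<and> r k \<le> b) \<and>
     (\<forall>j<n. \<forall>k<n. j \<noteq> k \<longrightarrow> {l j<..<r j} \<inter> {l k<..<r k} = {}) \<and>
     (\<Sum>k<n. r k - l k) < \<delta> \<longrightarrow> (\<Sum>k<n. D (\<beta> (l k)) (\<beta> (r k))) < ennreal \<epsilon>'"
    unfolding abs_continuous_on_def by blast
  show "\<exists>\<delta>>0. \<forall>(J::nat set) l r.
     nonoverlapping J l r c d \<and> total_length J l r < \<delta> \<longrightarrow> increments f J l r < \<epsilon>"
  proof (intro exI[of _ \<delta>] conjI allI impI \<delta>(1))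
    fix J :: "nat set" and l r
    assume J: "nonoverlapping J l r c d \<and> total_length J l r < \<delta>"
    then have "finite J" by (simp add: nonoverlapping_def)
    then obtain h where h: "bij_betw h {0..<card J} J" using ex_bij_betw_nat_finite by blast
    have s: "(\<Sum>k<card J. F (h k)) = (\<Sum>k\<in>J. F k)" for F :: "nat \<Rightarrow> real"
      using sum.reindex_bij_betw[OF h] by (simp add: lessThan_atLeast0)
    have N: "nonoverlapping {0..<card J} (l \<circ> h) (r \<circ> h) c d"
      using nonoverlapping_reindex[OF _ h] J by blast
    have N': "c \<le> l (h k)" "l (h k) \<le> r (h k)" "r (h k) \<le> d" if "k < card J" for k
      using nonoverlappingD(2-4)[OF N, of k] that by simp_all
    have "(\<Sum>k<card J. D (\<beta> ((l \<circ> h) k)) (\<beta> ((r \<circ> h) k))) < ennreal \<epsilon>'"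
    proof (rule \<delta>(2)[rule_format], intro conjI allI impI)
      show "(\<Sum>k<card J. (r \<circ> h) k - (l \<circ> h) k) < \<delta>"
        using J s[of "\<lambda>k. r k - l k"] by simp
      fix k assume "k < card J"
      from N'[OF this] sub show "a \<le> (l \<circ> h) k" "(l \<circ> h) k \<le> (r \<circ> h) k" "(r \<circ> h) k \<le> b" by simp_all
    next
      fix j k assume "j < card J" "k < card J" "j \<noteq> k"
      then show "{(l \<circ> h) j<..<(r \<circ> h) j} \<inter> {(l \<circ> h) k<..<(r \<circ> h) k} = {}"
        by (intro nonoverlappingD(5)[OF N]) auto
    qed
    then have "ennreal C * (\<Sum>k<card J. D (\<beta> (l (h k))) (\<beta> (r (h k)))) \<le> ennreal C * ennreal \<epsilon>'"
      by (intro mult_left_mono) (auto intro: less_imp_le)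
    also have "\<dots> = ennreal (\<epsilon> / 2)" using C \<open>0 < \<epsilon>\<close> by (simp add: \<epsilon>'_def flip: ennreal_mult)
    finally have "(\<Sum>k<card J. ennreal C * D (\<beta> (l (h k))) (\<beta> (r (h k)))) \<le> ennreal (\<epsilon> / 2)"
      by (simp add: sum_distrib_left)
    moreover have "(\<Sum>k<card J. ennreal \<bar>f (r (h k)) - f (l (h k))\<bar>) \<le> (\<Sum>k<card J. ennreal C * D (\<beta> (l (h k))) (\<beta> (r (h k))))"
      by (intro sum_mono dom N') auto
    ultimately have "ennreal (\<Sum>k<card J. \<bar>f (r (h k)) - f (l (h k))\<bar>) \<le> ennreal (\<epsilon> / 2)"
      by (simp add: sum_ennreal)
    then have "(\<Sum>k<card J. \<bar>f (r (h k)) - f (l (h k))\<bar>) \<le> \<epsilon> / 2"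
      using \<open>0 < \<epsilon>\<close> by simp
    then show "increments f J l r < \<epsilon>"
      using s[of "\<lambda>k. \<bar>f (r k) - f (l k)\<bar>"] \<open>0 < \<epsilon>\<close> by simp
  qed
qed

lemma abs_cont_diff:
  assumes "abs_cont c d f" "abs_cont c d g"
  shows "abs_cont c d (\<lambda>t. f t - g t)"
  unfolding abs_cont_def
proof (intro allI impI)
  fix \<epsilon> :: real assume "0 < \<epsilon>"
  then have e: "0 < \<epsilon> / 2" by simp
  obtain \<delta> where \<delta>: "0 < \<delta>" "\<And>(J::nat set) l r. nonoverlapping J l r c d \<Longrightarrow> total_length J l r < \<delta> \<Longrightarrow>
      increments f J l r < \<epsilon> / 2"
    by (rule abs_cont_obtain[OF assms(1) e]) (rule that)
  obtain \<delta>' where \<delta>': "0 < \<delta>'" "\<And>(J::nat set) l r. nonoverlapping J l r c d \<Longrightarrow> total_length J l r < \<delta>' \<Longrightarrow>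
      increments g J l r < \<epsilon> / 2"
    by (rule abs_cont_obtain[OF assms(2) e]) (rule that)
  show "\<exists>\<delta>>0. \<forall>(J::nat set) l r. nonoverlapping J l r c d \<and> total_length J l r < \<delta> \<longrightarrow>
     (\<Sum>k\<in>J. \<bar>f (r k) - g (r k) - (f (l k) - g (l k))\<bar>) < \<epsilon>"
  proof (intro exI[of _ "min \<delta> \<delta>'"] conjI allI impI)
    fix J :: "nat set" and l r
    assume J: "nonoverlapping J l r c d \<and> total_length J l r < min \<delta> \<delta>'"
    have "(\<Sum>k\<in>J. \<bar>f (r k) - g (r k) - (f (l k) - g (l k))\<bar>)
       \<le> (\<Sum>k\<in>J. \<bar>f (r k) - f (l k)\<bar> + \<bar>g (r k) - g (l k)\<bar>)"
      by (rule sum_mono) linarith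
    also have "\<dots> < \<epsilon>" using J \<delta>(2)[of J l r] \<delta>'(2)[of J l r] by (simp add: sum.distrib)
    finally show "(\<Sum>k\<in>J. \<bar>f (r k) - g (r k) - (f (l k) - g (l k))\<bar>) < \<epsilon>" .
  qed (use \<delta> \<delta>' in auto)
qed

definition total_variation :: "(real \<Rightarrow> real) \<Rightarrow> real \<Rightarrow> real \<Rightarrow> ennreal" where
  "total_variation f s t = (SUP (J, l, r) \<in> {(J::nat set, l, r). nonoverlapping J l r s t}.
     ennreal (increments f J l r))"

lemma total_variation_upper:
  "nonoverlapping (J::nat set) l r s t \<Longrightarrow>
    ennreal (increments f J l r) \<le> total_variation f s t"
  unfolding total_variation_def by (rule SUP_upper2[of "(J, l, r)"]) auto

lemma total_variation_least:
  "(\<And>(J::nat set) l r. nonoverlapping J l r s t \<Longrightarrow> ennreal (increments f J l r) \<le> B) \<Longrightarrow>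
    total_variation f s t \<le> B"
  unfolding total_variation_def by (rule SUP_least) auto

text \<open>Every interval of a family is cut at \<open>m\<close>, by taking minima and maxima of its endpoints with \<open>m\<close>;
  intervals on one side of \<open>m\<close> leave a degenerate interval on the other side.\<close>

lemma total_variation_subadditive:
  assumes "s \<le> m" "m \<le> t"
  shows "total_variation f s t \<le> total_variation f s m + total_variation f m t"
proof (rule total_variation_least)
  fix J :: "nat set" and l r assume J: "nonoverlapping J l r s t"
  have k: "s \<le> l k \<and> l k \<le> r k \<and> r k \<le> t" if "k \<in> J" for k
    using nonoverlappingD(2-4)[OF J that] by blast
  have 1: "nonoverlapping J (\<lambda>k. min (l k) m) (\<lambda>k. min (r k) m) s m"
  proof -
    have "{min x m<..<min y m} \<subseteq> {x<..<y}" for x y by (auto simp: min_def split: if_splits)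
    then show ?thesis
      using assms by (intro nonoverlapping_shrink[OF J]) (auto simp: min_def max_def dest: k)
  qed
  have 2: "nonoverlapping J (\<lambda>k. max (l k) m) (\<lambda>k. max (r k) m) m t"
  proof -
    have "{max x m<..<max y m} \<subseteq> {x<..<y}" for x y by (auto simp: max_def split: if_splits)
    then show ?thesis
      using assms by (intro nonoverlapping_shrink[OF J]) (auto simp: min_def max_def dest: k)
  qed
  have "increments f J l r \<le>
     (\<Sum>k\<in>J. \<bar>f (min (r k) m) - f (min (l k) m)\<bar> + \<bar>f (max (r k) m) - f (max (l k) m)\<bar>)"
  proof (rule sum_mono)
    fix k assume "k \<in> J"
    then have "l k \<le> r k" using J by (auto simp: nonoverlapping_def)
    then show "\<bar>f (r k) - f (l k)\<bar> \<le> \<bar>f (min (r k) m) - f (min (l k) m)\<bar> + \<bar>f (max (r k) m) - f (max (l k) m)\<bar>"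
      by (cases "r k \<le> m"; cases "l k \<le> m") (auto simp: min_def max_def)
  qed
  also have "\<dots> = (\<Sum>k\<in>J. \<bar>f (min (r k) m) - f (min (l k) m)\<bar>) + (\<Sum>k\<in>J. \<bar>f (max (r k) m) - f (max (l k) m)\<bar>)"
    by (rule sum.distrib)
  finally have "ennreal (increments f J l r) \<le>
    ennreal (\<Sum>k\<in>J. \<bar>f (min (r k) m) - f (min (l k) m)\<bar>) + ennreal (\<Sum>k\<in>J. \<bar>f (max (r k) m) - f (max (l k) m)\<bar>)"
    by (simp add: sum_nonneg ennreal_leI flip: ennreal_plus)
  also have "\<dots> \<le> total_variation f s m + total_variation f m t"
    by (intro add_mono total_variation_upper[OF 1] total_variation_upper[OF 2])
  finally show "ennreal (increments f J l r) \<le> total_variation f s m + total_variation f m t" .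
qed

lemma total_variation_extend:
  assumes "s \<le> m" "m \<le> t"
  shows "total_variation f s m + ennreal \<bar>f t - f m\<bar> \<le> total_variation f s t"
proof -
  have "nonoverlapping {} (\<lambda>_::nat. 0) (\<lambda>_. 0) s m" by (simp add: nonoverlapping_def)
  then have ne: "{(J::nat set, l, r). nonoverlapping J l r s m} \<noteq> {}" by blast
  have "total_variation f s m + ennreal \<bar>f t - f m\<bar> =
    (SUP (J, l, r) \<in> {(J::nat set, l, r). nonoverlapping J l r s m}.
       ennreal (increments f J l r) + ennreal \<bar>f t - f m\<bar>)"
    unfolding total_variation_def using ne
    by (subst ennreal_SUP_add_left[symmetric]) (auto simp: case_prod_beta')
  also have "\<dots> \<le> total_variation f s t"
  proof (rule SUP_least, clarify)
    fix J :: "nat set" and l r assume J: "nonoverlapping J l r s m"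
    then have fin: "finite J" by (simp add: nonoverlapping_def)
    then obtain i where i: "i \<notin> J" using ex_new_if_finite infinite_UNIV_nat by blast
    define l' r' where "l' = l(i := m)" and "r' = r(i := t)"
    have s: "(\<Sum>k\<in>J. \<bar>f (r' k) - f (l' k)\<bar>) = increments f J l r"
      using i by (intro sum.cong) (auto simp: l'_def r'_def)
    have "nonoverlapping (insert i J) l' r' s t"
      unfolding nonoverlapping_def
    proof (intro conjI ballI impI)
      fix j k assume "j \<in> insert i J" "k \<in> insert i J" "j \<noteq> k"
      then show "{l' j<..<r' j} \<inter> {l' k<..<r' k} = {}"
        using nonoverlappingD(4)[OF J, of k] nonoverlappingD(4)[OF J, of j] nonoverlappingD(5)[OF J, of j k] i
        by (auto simp: l'_def r'_def)
    next
      fix k assume "k \<in> insert i J"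
      then show "s \<le> l' k" "l' k \<le> r' k" "r' k \<le> t"
        using nonoverlappingD(2-4)[OF J, of k] assms order_trans[of "r k" m t] by (auto simp: l'_def r'_def)
    qed (use fin in auto)
    from total_variation_upper[OF this, of f]
    have "ennreal (\<bar>f t - f m\<bar> + increments f J l r) \<le> total_variation f s t"
      using fin i s by (simp add: l'_def r'_def)
    then show "ennreal (increments f J l r) + ennreal \<bar>f t - f m\<bar> \<le> total_variation f s t"
      by (simp add: sum_nonneg add.commute flip: ennreal_plus)
  qed
  finally show ?thesis .
qed

text \<open>Choosing near-optimal members of several families at once. The summand \<open>Y\<close> strengthens the
  induction: the value chosen for one index moves into \<open>Y\<close> before the next supremum is treated.\<close>

lemma add_sum_SUP_le:
  fixes v :: "'i \<Rightarrow> 'b \<Rightarrow> ennreal"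
  assumes "finite H" and ne: "\<And>k. S k \<noteq> {}"
    and "\<And>F. (\<And>k. k \<in> H \<Longrightarrow> F k \<in> S k) \<Longrightarrow> Y + (\<Sum>k\<in>H. v k (F k)) \<le> B"
  shows "Y + (\<Sum>k\<in>H. SUP x\<in>S k. v k x) \<le> B"
  using assms(1,3)
proof (induction H arbitrary: Y)
  case (insert j H)
  have "(Y + (\<Sum>k\<in>H. SUP x\<in>S k. v k x)) + (SUP x\<in>S j. v j x) =
      (SUP x\<in>S j. (Y + (\<Sum>k\<in>H. SUP x\<in>S k. v k x)) + v j x)"
    using ne by (intro ennreal_SUP_add_right) auto
  also have "\<dots> \<le> B"
  proof (rule SUP_least)
    fix x assume x: "x \<in> S j"
    have "Y + v j x + (\<Sum>k\<in>H. SUP x\<in>S k. v k x) \<le> B"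
    proof (rule insert.IH)
      fix F assume F: "\<And>k. k \<in> H \<Longrightarrow> F k \<in> S k"
      have "(\<Sum>k\<in>H. v k ((F(j := x)) k)) = (\<Sum>k\<in>H. v k (F k))"
        using insert.hyps by (intro sum.cong) auto
      moreover have "Y + (\<Sum>k\<in>insert j H. v k ((F(j := x)) k)) \<le> B"
        by (rule insert.prems) (use F x in auto)
      ultimately show "Y + v j x + (\<Sum>k\<in>H. v k (F k)) \<le> B"
        using insert.hyps by (simp add: add.assoc)
    qed
    then show "(Y + (\<Sum>k\<in>H. SUP x\<in>S k. v k x)) + v j x \<le> B" by (simp add: ac_simps)
  qed
  finally show ?case using insert.hyps by (simp add: ac_simps)
qed simp

text \<open>The total variation inherits the modulus of absolute continuity: families inside each of the
  intervals combine to one family, indexed by pairs, whose total length is not larger.\<close>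

lemma sum_total_variation_le:
  assumes \<delta>: "\<And>(J::(nat \<times> nat) set) l r. nonoverlapping J l r c d \<Longrightarrow> total_length J l r < \<delta> \<Longrightarrow>
      increments f J l r < \<epsilon>"
    and J: "nonoverlapping (J::nat set) l r c d" "total_length J l r < \<delta>"
  shows "(\<Sum>k\<in>J. total_variation f (l k) (r k)) \<le> ennreal \<epsilon>"
proof -
  let ?S = "\<lambda>k. {(H::nat set, p, q). nonoverlapping H p q (l k) (r k)}"
  let ?v = "\<lambda>(H::nat set, p, q). ennreal (\<Sum>i\<in>H. \<bar>f (q i) - f (p i)\<bar>)"
  have fin: "finite J" using J by (simp add: nonoverlapping_def)
  have ne: "({}, \<lambda>_. 0, \<lambda>_. 0) \<in> ?S k" for k by (simp add: nonoverlapping_def)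
  have "0 + (\<Sum>k\<in>J. SUP x\<in>?S k. ?v x) \<le> ennreal \<epsilon>"
  proof (rule add_sum_SUP_le[OF fin])
    show "?S k \<noteq> {}" for k using ne[of k] by blast
    fix F assume F: "\<And>k. k \<in> J \<Longrightarrow> F k \<in> ?S k"
  define H p q where "H = (\<lambda>k. fst (F k))" and "p = (\<lambda>k. fst (snd (F k)))" and "q = (\<lambda>k. snd (snd (F k)))"
  have no: "nonoverlapping (H k) (p k) (q k) (l k) (r k)" if "k \<in> J" for k
    using F[OF that] by (auto simp: H_def p_def q_def)
  have finH: "finite (H k)" if "k \<in> J" for k using no[OF that] by (simp add: nonoverlapping_def)
  let ?I = "SIGMA k:J. H k"
  have big: "nonoverlapping ?I (\<lambda>(k, i). p k i) (\<lambda>(k, i). q k i) c d"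
    unfolding nonoverlapping_def
  proof (intro conjI ballI impI)
    show "finite ?I" using fin finH by auto
  next
    fix x assume x: "x \<in> ?I"
    then show "c \<le> (case x of (k, i) \<Rightarrow> p k i)" "(case x of (k, i) \<Rightarrow> p k i) \<le> (case x of (k, i) \<Rightarrow> q k i)"
      "(case x of (k, i) \<Rightarrow> q k i) \<le> d"
      using nonoverlappingD(2-4)[OF no[of "fst x"], of "snd x"] nonoverlappingD(2-4)[OF J(1), of "fst x"]
      by (auto intro: order_trans)
  next
    fix x y assume xy: "x \<in> ?I" "y \<in> ?I" "x \<noteq> y"
    obtain k i k' i' where [simp]: "x = (k, i)" "y = (k', i')" by fastforce
    show "{(case x of (k, i) \<Rightarrow> p k i)<..<(case x of (k, i) \<Rightarrow> q k i)} \<inter>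
          {(case y of (k, i) \<Rightarrow> p k i)<..<(case y of (k, i) \<Rightarrow> q k i)} = {}"
    proof (cases "k = k'")
      case True
      then show ?thesis using xy nonoverlappingD(5)[OF no[of k], of i i'] by auto
    next
      case False
      have "{p k i<..<q k i} \<subseteq> {l k<..<r k}" "{p k' i'<..<q k' i'} \<subseteq> {l k'<..<r k'}"
        using xy nonoverlappingD(2-4)[OF no[of k], of i] nonoverlappingD(2-4)[OF no[of k'], of i'] by auto
      moreover have "{l k<..<r k} \<inter> {l k'<..<r k'} = {}"
        using xy by (intro nonoverlappingD(5)[OF J(1) _ _ False]) auto
      ultimately have "{p k i<..<q k i} \<inter> {p k' i'<..<q k' i'} = {}" by blast
      then show ?thesis by simp
    qed
  qed
  have len: "(\<Sum>i\<in>H. q i - p i) \<le> t - s" if "nonoverlapping H p q s t" "s \<le> t" for H :: "nat set" and p q s t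
  proof -
    have df: "disjoint_family_on (\<lambda>i. {p i<..<q i}) H"
      using that(1) by (simp add: nonoverlapping_def disjoint_family_on_def)
    have "ennreal (\<Sum>i\<in>H. q i - p i) = (\<Sum>i\<in>H. emeasure lborel {p i<..<q i})"
      using that by (subst sum_ennreal[symmetric]) (auto simp: nonoverlapping_def)
    also have "\<dots> = emeasure lborel (\<Union>i\<in>H. {p i<..<q i})"
      using that df by (intro sum_emeasure) (auto simp: nonoverlapping_def)
    also have "\<dots> \<le> emeasure lborel {s..t}"
      using nonoverlappingD(2,4)[OF that(1)] by (intro emeasure_mono UN_least) (force, simp)
    also have "\<dots> = ennreal (t - s)" using that by simp
    finally show ?thesis using that by simp
  qed
  have "(\<Sum>x\<in>?I. (case x of (k, i) \<Rightarrow> q k i) - (case x of (k, i) \<Rightarrow> p k i)) = (\<Sum>k\<in>J. \<Sum>i\<in>H k. q k i - p k i)"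
    using fin finH by (subst sum.Sigma) (auto intro!: sum.cong)
  also have "\<dots> \<le> total_length J l r"
    using no J(1) by (intro sum_mono len) (auto simp: nonoverlapping_def)
  finally have "(\<Sum>x\<in>?I. (case x of (k, i) \<Rightarrow> q k i) - (case x of (k, i) \<Rightarrow> p k i)) < \<delta>" using J(2) by simp
  from \<delta>[OF big this] have "(\<Sum>k\<in>J. \<Sum>i\<in>H k. \<bar>f (q k i) - f (p k i)\<bar>) < \<epsilon>"
    using fin finH by (subst sum.Sigma) (auto simp: case_prod_beta')
  moreover have "(\<Sum>k\<in>J. ?v (F k)) = ennreal (\<Sum>k\<in>J. \<Sum>i\<in>H k. \<bar>f (q k i) - f (p k i)\<bar>)"
    by (subst sum_ennreal[symmetric]) (auto simp: H_def p_def q_def case_prod_beta' intro: sum_nonneg)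
  ultimately show "0 + (\<Sum>k\<in>J. ?v (F k)) \<le> ennreal \<epsilon>" by (simp add: ennreal_leI)
  qed
  then show ?thesis by (simp add: total_variation_def)
qed

text \<open>On intervals shorter than the \<open>\<delta>\<close> which belongs to \<open>\<epsilon> = 1\<close> the variation is at most 1; finitely many
  of them cover the interval.\<close>

lemma total_variation_finite:
  assumes f: "abs_cont c d f" and "c \<le> t" "t \<le> d"
  shows "total_variation f c t < \<infinity>"
proof -
  obtain \<delta> where \<delta>: "0 < \<delta>" "\<And>(J::(nat \<times> nat) set) l r. nonoverlapping J l r c d \<Longrightarrow> total_length J l r < \<delta> \<Longrightarrow>
      increments f J l r < 1"
    by (rule abs_cont_obtain[OF f zero_less_one]) (rule that)
  have step: "total_variation f s m < \<infinity>" if "c \<le> s" "s \<le> m" "m \<le> d" "m - s < \<delta>" for s m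
  proof -
    have "(\<Sum>k\<in>{0::nat}. total_variation f s m) \<le> ennreal 1"
      using that by (intro sum_total_variation_le[where \<delta>=\<delta> and c=c and d=d, OF \<delta>(2)])
        (auto simp: nonoverlapping_def)
    then show ?thesis by (simp add: order.strict_trans1)
  qed
  have "\<forall>t. c \<le> t \<and> t \<le> d \<and> t - c \<le> real n * (\<delta> / 2) \<longrightarrow> total_variation f c t < \<infinity>" for n
  proof (induction n)
    case 0
    then show ?case using step[of c] \<delta>(1) by auto
  next
    case (Suc n)
    show ?case
    proof (intro allI impI)
      fix t assume t: "c \<le> t \<and> t \<le> d \<and> t - c \<le> real (Suc n) * (\<delta> / 2)"
      define m where "m = max c (t - \<delta> / 2)"
      have m: "c \<le> m" "m \<le> t" "t - m < \<delta>" "m - c \<le> real n * (\<delta> / 2)"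
        using t \<delta>(1) by (auto simp: m_def max_def algebra_simps)
      have "total_variation f c t \<le> total_variation f c m + total_variation f m t"
        using m by (intro total_variation_subadditive)
      also have "\<dots> < \<infinity>" using Suc.IH step[of m t] m t by simp
      finally show "total_variation f c t < \<infinity>" .
    qed
  qed
  moreover obtain n where "(t - c) / (\<delta> / 2) \<le> real n" using real_arch_simple by blast
  then have "t - c \<le> real n * (\<delta> / 2)" using \<delta>(1) by (simp add: field_simps)
  ultimately show ?thesis using assms(2,3) by blast
qed

text \<open>Jordan's decomposition with \<open>V\<close> the total variation from \<open>c\<close>. The point is that \<open>V\<close> is again absolutely
  continuous.\<close>

lemma abs_cont_monotone_decomposition:
  assumes f: "abs_cont c d f"
  obtains V where "abs_cont c d V" "mono_on {c..d} V" "mono_on {c..d} (\<lambda>t. V t - f t)"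
proof -
  define V where "V = (\<lambda>t. enn2real (total_variation f c t))"
  have V: "ennreal (V t) = total_variation f c t" if "c \<le> t" "t \<le> d" for t
    using total_variation_finite[OF f that] by (simp add: V_def less_top)
  have inc: "V s + \<bar>f t - f s\<bar> \<le> V t" if "c \<le> s" "s \<le> t" "t \<le> d" for s t
  proof -
    have "ennreal (V s) + ennreal \<bar>f t - f s\<bar> \<le> ennreal (V t)"
      using total_variation_extend[of c s t f] V that by simp
    then show ?thesis by (simp add: V_def flip: ennreal_plus)
  qed
  have up: "ennreal (V t - V s) \<le> total_variation f s t" if "c \<le> s" "s \<le> t" "t \<le> d" for s t
  proof -
    have "ennreal (V t) \<le> ennreal (V s) + total_variation f s t"
      using total_variation_subadditive[of c s t f] V that by simp
    then show ?thesis
      by (metis V_def enn2real_nonneg ennreal_minus ennreal_minus_le_iff ennreal_neq_top)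
  qed
  have "abs_cont c d V"
    unfolding abs_cont_def
  proof (intro allI impI)
    fix \<epsilon> :: real assume "0 < \<epsilon>"
    then have e: "0 < \<epsilon> / 2" by simp
    obtain \<delta> where \<delta>: "0 < \<delta>" "\<And>(J::(nat \<times> nat) set) l r. nonoverlapping J l r c d \<Longrightarrow> total_length J l r < \<delta> \<Longrightarrow>
      increments f J l r < \<epsilon> / 2"
      by (rule abs_cont_obtain[OF f e]) (rule that)
    show "\<exists>\<delta>>0. \<forall>(J::nat set) l r. nonoverlapping J l r c d \<and> total_length J l r < \<delta> \<longrightarrow>
       increments V J l r < \<epsilon>"
    proof (intro exI[of _ \<delta>] conjI allI impI \<delta>(1))
      fix J :: "nat set" and l r
      assume J: "nonoverlapping J l r c d \<and> total_length J l r < \<delta>"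
      then have k: "c \<le> l k" "l k \<le> r k" "r k \<le> d" if "k \<in> J" for k
        using nonoverlappingD(2-4)[OF conjunct1[OF J] that] by blast+
      have nn: "0 \<le> V (r k) - V (l k)" if "k \<in> J" for k
        using inc[OF k[OF that]] by linarith
      have "ennreal (increments V J l r) = (\<Sum>k\<in>J. ennreal (V (r k) - V (l k)))"
        using nn by (subst sum_ennreal[symmetric]) (auto intro!: sum.cong)
      also have "\<dots> \<le> (\<Sum>k\<in>J. total_variation f (l k) (r k))"
        using k by (intro sum_mono up)
      also have "\<dots> \<le> ennreal (\<epsilon> / 2)"
        by (rule sum_total_variation_le[OF \<delta>(2)]) (use J in auto)
      finally show "increments V J l r < \<epsilon>" using \<open>0 < \<epsilon>\<close> by simp
    qed
  qed
  moreover have "mono_on {c..d} V"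
  proof (rule mono_onI)
    fix s t assume "s \<in> {c..d}" "t \<in> {c..d}" "s \<le> t"
    then show "V s \<le> V t" using inc[of s t] by simp
  qed
  moreover have "mono_on {c..d} (\<lambda>t. V t - f t)"
  proof (rule mono_onI)
    fix s t assume "s \<in> {c..d}" "t \<in> {c..d}" "s \<le> t"
    then show "V s - f s \<le> V t - f t" using inc[of s t] by simp
  qed
  ultimately show thesis by (rule that)
qed

lemma abs_cont_continuous_on:
  assumes f: "abs_cont c d f"
  shows "continuous_on {c..d} f"
  unfolding continuous_on_iff
proof (intro ballI allI impI)
  fix x \<epsilon> :: real assume x: "x \<in> {c..d}" and "0 < \<epsilon>"
  obtain \<delta> where \<delta>: "0 < \<delta>" "\<And>(J::nat set) l r. nonoverlapping J l r c d \<Longrightarrow> total_length J l r < \<delta> \<Longrightarrow>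
      increments f J l r < \<epsilon>"
    by (rule abs_cont_obtain[OF f \<open>0 < \<epsilon>\<close>]) (rule that)
  have *: "\<bar>f t - f s\<bar> < \<epsilon>" if "c \<le> s" "s \<le> t" "t \<le> d" "t - s < \<delta>" for s t
    using \<delta>(2)[of "{0}" "\<lambda>_. s" "\<lambda>_. t"] that by (simp add: nonoverlapping_def)
  show "\<exists>d'>0. \<forall>x'\<in>{c..d}. dist x' x < d' \<longrightarrow> dist (f x') (f x) < \<epsilon>"
  proof (intro exI[of _ \<delta>] conjI ballI impI \<delta>(1))
    fix y assume "y \<in> {c..d}" "dist y x < \<delta>"
    then show "dist (f y) (f x) < \<epsilon>"
      using *[of x y] *[of y x] x by (cases "x \<le> y") (auto simp: dist_real_def abs_minus_commute)
  qed
qed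

text \<open>Absolute continuity of the function \<open>f\<close> makes its Lebesgue--Stieltjes measure \<open>\<mu>\<close> absolutely
  continuous. A null set is covered by countably many nonoverlapping intervals inside an open set of
  measure less than \<open>\<delta>\<close>; on each finite subfamily \<open>\<mu>\<close> is a sum of increments of \<open>f\<close>, hence less than \<open>\<epsilon>\<close>.\<close>

lemma abs_cont_mono_null_sets:
  assumes f: "abs_cont c d f" and mono: "mono_on {c..d} f" and "c < d"
    and \<mu>: "\<And>s t. c \<le> s \<Longrightarrow> s \<le> t \<Longrightarrow> t \<le> d \<Longrightarrow> emeasure \<mu> {s..t} = ennreal (f t - f s)"
    and sets: "sets \<mu> = sets borel"
    and N: "N \<in> null_sets lborel" "N \<subseteq> {c..d}"
  shows "emeasure \<mu> N = 0"
proof -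
  have "emeasure \<mu> N \<le> 0 + ennreal \<epsilon>" if \<epsilon>: "0 < \<epsilon>" for \<epsilon> :: real
  proof -
    obtain \<delta> where \<delta>: "0 < \<delta>" "\<And>(J::real set set) l r. nonoverlapping J l r c d \<Longrightarrow> total_length J l r < \<delta> \<Longrightarrow>
      increments f J l r < \<epsilon>"
      by (rule abs_cont_obtain[OF f \<epsilon>]) (rule that)
    have "N \<in> sets lebesgue" using N(1) by (auto simp: null_sets_def)
    then obtain U where U: "open U" "N \<subseteq> U" "emeasure lebesgue (U - N) < ennreal \<delta>"
      using sets_lebesgue_outer_open[OF _ \<delta>(1)] by metis
    have "emeasure lborel U = emeasure lborel (U - N)"
      using N(1) U(1) by (intro emeasure_Diff_null_set[symmetric]) auto
    moreover have "U - N \<in> sets borel" using U(1) N(1) by (auto simp: null_sets_def)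
    ultimately have lU: "emeasure lborel U < ennreal \<delta>"
      using U(3) by simp
    define G where "G = (\<lambda>x. if x \<in> U then U else UNIV)"
    have G: "gauge G" using U(1) by (auto simp: G_def gauge_def)
    have sub: "N \<subseteq> cbox c d" using N by simp
    have ne: "box c d \<noteq> {}" using \<open>c < d\<close> by simp
    obtain D where D: "countable D" "\<Union>D \<subseteq> cbox c d"
      "\<And>K. K \<in> D \<Longrightarrow> interior K \<noteq> {} \<and> (\<exists>c d. K = cbox c d)"
      "pairwise (\<lambda>A B. interior A \<inter> interior B = {}) D"
      "\<And>K. K \<in> D \<Longrightarrow> \<exists>x \<in> N \<inter> K. K \<subseteq> G x" "N \<subseteq> \<Union>D"
      by (rule covering_lemma[OF sub ne G]) (rule that; assumption)
    define l r where "l = (\<lambda>K::real set. Inf K)" and "r = (\<lambda>K::real set. Sup K)"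
    have K: "K = {l K..r K} \<and> l K < r K \<and> c \<le> l K \<and> r K \<le> d \<and> K \<subseteq> U" if KD: "K \<in> D" for K
    proof -
      obtain u v where uv: "K = {u..v}" using D(3)[OF KD] by auto
      have "u < v" using D(3)[OF KD] uv by (auto simp: interior_atLeastAtMost_real)
      moreover have "{u..v} \<subseteq> {c..d}" using Union_upper[OF KD] D(2) uv by (metis box_real(2) order_trans)
      moreover obtain x where x: "x \<in> N" "K \<subseteq> G x" using D(5)[OF KD] by blast
      then have "G x = U" using U(2) by (auto simp: G_def)
      with x have "K \<subseteq> U" by simp
      ultimately show ?thesis using uv by (simp add: l_def r_def)
    qed
    have fin: "emeasure \<mu> (\<Union>F) \<le> ennreal \<epsilon>" if F: "finite F" "F \<subseteq> D" for F
    proof -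
      have df: "{l A<..<r A} \<inter> {l B<..<r B} = {}" if "A \<in> F" "B \<in> F" "A \<noteq> B" for A B
      proof -
        have "interior A \<inter> interior B = {}" using D(4) that F by (auto simp: pairwise_def)
        moreover have "interior A = {l A<..<r A}" "interior B = {l B<..<r B}"
          using K that F by (metis interior_atLeastAtMost_real subsetD)+
        ultimately show ?thesis by simp
      qed
      have no: "nonoverlapping F l r c d"
        unfolding nonoverlapping_def using F K df by (auto simp del: Int_greaterThanLessThan intro: less_imp_le)
      have "ennreal (total_length F l r) = (\<Sum>K\<in>F. emeasure lborel {l K<..<r K})"
        using nonoverlappingD(3)[OF no] by (subst sum_ennreal[symmetric]) auto
      also have "\<dots> = emeasure lborel (\<Union>K\<in>F. {l K<..<r K})"
        using F df by (intro sum_emeasure) (auto simp: disjoint_family_on_def)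
      also have "\<dots> \<le> emeasure lborel U"
      proof (intro emeasure_mono UN_least)
        fix k assume "k \<in> F"
        then have "{l k..r k} \<subseteq> U" using K[of k] F by auto
        then show "{l k<..<r k} \<subseteq> U" by (auto intro: less_imp_le)
      qed (use U in auto)
      finally have "ennreal (total_length F l r) < ennreal \<delta>" using lU by simp
      moreover have "0 \<le> total_length F l r"
        using nonoverlappingD(3)[OF no] by (intro sum_nonneg) simp
      ultimately have sm: "increments f F l r < \<epsilon>"
        by (intro \<delta>(2)[OF no]) (simp add: ennreal_less_iff)
      have Ks: "K \<in> sets \<mu>" if "K \<in> F" for K
        using K[of K] that F sets by (metis atLeastAtMost_borel subsetD)
      have "emeasure \<mu> (\<Union>F) \<le> (\<Sum>K\<in>F. emeasure \<mu> K)"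
        using emeasure_subadditive_finite[of F "\<lambda>K. K" \<mu>] F Ks by auto
      also have "\<dots> = (\<Sum>K\<in>F. ennreal \<bar>f (r K) - f (l K)\<bar>)"
      proof (rule sum.cong)
        fix k assume "k \<in> F"
        then have k: "k = {l k..r k}" "l k \<le> r k" "c \<le> l k" "r k \<le> d" using K[of k] F by auto
        then have "emeasure \<mu> k = ennreal (f (r k) - f (l k))" using \<mu>[of "l k" "r k"] by simp
        moreover have "f (l k) \<le> f (r k)" using k by (intro mono_onD[OF mono]) auto
        ultimately show "emeasure \<mu> k = ennreal \<bar>f (r k) - f (l k)\<bar>" by simp
      qed simp
      also have "\<dots> = ennreal (increments f F l r)" by simp
      finally show ?thesis using sm by (meson ennreal_leI less_imp_le order_trans)
    qed
    show ?thesis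
    proof (cases "D = {}")
      case True
      then show ?thesis using D by simp
    next
      case False
      let ?S = "\<lambda>n. \<Union>(from_nat_into D ` {..n})"
      have Ks: "K \<in> sets \<mu>" if "K \<in> D" for K
        using K[of K] that sets by (metis atLeastAtMost_borel)
      have fD: "from_nat_into D n \<in> D" for n using from_nat_into[OF False] .
      have "emeasure \<mu> N \<le> emeasure \<mu> (\<Union>n. ?S n)"
      proof (rule emeasure_mono)
        show "N \<subseteq> (\<Union>n. ?S n)"
        proof
          fix x assume "x \<in> N"
          then obtain K where "K \<in> D" "x \<in> K" using D(6) by blast
          moreover then obtain n where "from_nat_into D n = K"
            using from_nat_into_surj[OF D(1)] by blast
          ultimately show "x \<in> (\<Union>n. ?S n)" by auto
        qed
        show "(\<Union>n. ?S n) \<in> sets \<mu>" using Ks fD by (intro sets.countable_UN sets.finite_Union) auto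
      qed
      also have "\<dots> = (SUP n. emeasure \<mu> (?S n))"
      proof (rule SUP_emeasure_incseq[symmetric])
        show "incseq ?S" by (force simp: incseq_def)
        show "range ?S \<subseteq> sets \<mu>" using Ks fD by (auto intro!: sets.finite_UN)
      qed
      also have "\<dots> \<le> ennreal \<epsilon>" using fD by (intro SUP_least fin) auto
      finally show ?thesis by simp
    qed
  qed
  then have "emeasure \<mu> N \<le> 0" by (rule ennreal_le_epsilon)
  then show ?thesis by simp
qed

text \<open>The density is the Radon--Nikodym derivative of the Lebesgue--Stieltjes measure of \<open>f\<close>.\<close>

lemma abs_cont_mono_indefinite_integral:
  assumes f: "abs_cont c d f" and mono: "mono_on {c..d} f" and "c < d"
  obtains \<rho> where "integrable lborel \<rho>"
    "\<And>s t. c \<le> s \<Longrightarrow> s \<le> t \<Longrightarrow> t \<le> d \<Longrightarrow> f t - f s = (LINT u:{s..t}|lborel. \<rho> u)"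
proof -
  \<comment> \<open>Continued by constants, so that it is monotone and continuous on the whole line.\<close>
  define G where "G = (\<lambda>x. f (max c (min d x)))"
  have Gmono: "G x \<le> G y" if "x \<le> y" for x y
    unfolding G_def using that \<open>c < d\<close> by (intro mono_onD[OF mono]) auto
  have "continuous_on UNIV G"
    unfolding G_def using \<open>c < d\<close>
    by (intro continuous_on_compose2[OF abs_cont_continuous_on[OF f]] continuous_intros) auto
  then have Gcont: "continuous_on S G" for S by (rule continuous_on_subset) simp
  let ?\<mu>0 = "interval_measure G"
  have \<mu>0: "emeasure ?\<mu>0 {s..t} = ennreal (f t - f s)" if "c \<le> s" "s \<le> t" "t \<le> d" for s t
    using that by (subst emeasure_interval_measure_Icc) (auto simp: Gmono Gcont, simp add: G_def max_def min_def)
  define \<mu> where "\<mu> = density ?\<mu>0 (indicator {c..d})"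
  have \<mu>: "emeasure \<mu> S = emeasure ?\<mu>0 (S \<inter> {c..d})" if "S \<in> sets borel" for S
    unfolding \<mu>_def using that by (subst emeasure_density) (auto simp: indicator_inter_arith[symmetric] nn_integral_indicator Int_commute)
  have sets\<mu>: "sets \<mu> = sets lborel" by (simp add: \<mu>_def)
  have "absolutely_continuous lborel \<mu>"
    unfolding absolutely_continuous_def
  proof
    fix N :: "real set" assume N: "N \<in> null_sets lborel"
    then have "N \<inter> {c..d} \<in> null_sets lborel" by (intro null_set_Int2) auto
    then have "emeasure ?\<mu>0 (N \<inter> {c..d}) = 0"
      using \<mu>0 by (intro abs_cont_mono_null_sets[OF f mono \<open>c < d\<close>]) auto
    then show "N \<in> null_sets \<mu>" using N \<mu>[of N] sets\<mu> by (auto simp: null_sets_def)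
  qed
  then obtain g where g[measurable]: "g \<in> borel_measurable lborel" and dens: "density lborel g = \<mu>"
    using sigma_finite_measure.Radon_Nikodym[OF lborel.sigma_finite_measure_axioms] sets\<mu> by blast
  have gi: "(\<integral>\<^sup>+u\<in>S. g u \<partial>lborel) = emeasure \<mu> S" if "S \<in> sets borel" for S
    unfolding dens[symmetric] using that by (subst emeasure_density) auto
  have "(\<integral>\<^sup>+u. g u \<partial>lborel) = ennreal (f d - f c)"
    using gi[of UNIV] \<mu>[of UNIV] \<mu>0[of c d] \<open>c < d\<close> by simp
  then have gfin: "(\<integral>\<^sup>+u. g u \<partial>lborel) \<noteq> \<infinity>" by simp
  define \<rho> where "\<rho> = (\<lambda>u. enn2real (g u))"
  have "AE u in lborel. g u \<noteq> \<infinity>" using gfin by (intro nn_integral_PInf_AE) auto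
  then have g\<rho>: "AE u in lborel. ennreal (\<rho> u) = g u"
    by eventually_elim (simp add: \<rho>_def less_top)
  have \<rho>m[measurable]: "\<rho> \<in> borel_measurable lborel" unfolding \<rho>_def by measurable
  have \<rho>int: "(\<integral>\<^sup>+u\<in>S. ennreal (\<rho> u) \<partial>lborel) = (\<integral>\<^sup>+u\<in>S. g u \<partial>lborel)" for S
    using g\<rho> by (intro nn_integral_cong_AE) auto
  show thesis
  proof (rule that)
    show "integrable lborel \<rho>"
      using \<rho>int[of UNIV] gfin by (intro integrableI_nonneg) (auto simp: \<rho>_def less_top)
    fix s t assume st: "c \<le> s" "s \<le> t" "t \<le> d"
    have "(LINT u:{s..t}|lborel. \<rho> u) = enn2real (\<integral>\<^sup>+u. ennreal (indicator {s..t} u *\<^sub>R \<rho> u) \<partial>lborel)"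
      unfolding set_lebesgue_integral_def by (rule integral_eq_nn_integral) (auto simp: \<rho>_def)
    also have "(\<integral>\<^sup>+u. ennreal (indicator {s..t} u *\<^sub>R \<rho> u) \<partial>lborel) = (\<integral>\<^sup>+u\<in>{s..t}. ennreal (\<rho> u) \<partial>lborel)"
      by (intro nn_integral_cong) (auto simp: indicator_def)
    also have "\<dots> = emeasure \<mu> {s..t}" using \<rho>int gi by simp
    also have "\<dots> = ennreal (f t - f s)"
    proof -
      have "{s..t} \<inter> {c..d} = {s..t}" using st by auto
      moreover have "emeasure \<mu> {s..t} = emeasure ?\<mu>0 ({s..t} \<inter> {c..d})" by (rule \<mu>) simp
      ultimately show ?thesis by (simp only: \<mu>0[OF st])
    qed
    also have "enn2real \<dots> = f t - f s"
      using st by (intro enn2real_ennreal) (auto intro: mono_onD[OF mono])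
    finally show "f t - f s = (LINT u:{s..t}|lborel. \<rho> u)" ..
  qed
qed

lemma abs_cont_indefinite_integral:
  assumes f: "abs_cont c d f" and "c < d"
  obtains \<rho> where "integrable lborel \<rho>"
    "\<And>s t. c \<le> s \<Longrightarrow> s \<le> t \<Longrightarrow> t \<le> d \<Longrightarrow> f t - f s = (LINT u:{s..t}|lborel. \<rho> u)"
proof -
  obtain V where V: "abs_cont c d V" "mono_on {c..d} V" "mono_on {c..d} (\<lambda>t. V t - f t)"
    by (rule abs_cont_monotone_decomposition[OF f])
  obtain \<rho>1 where 1: "integrable lborel \<rho>1"
    "\<And>s t. c \<le> s \<Longrightarrow> s \<le> t \<Longrightarrow> t \<le> d \<Longrightarrow> V t - V s = (LINT u:{s..t}|lborel. \<rho>1 u)"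
    by (rule abs_cont_mono_indefinite_integral[OF V(1,2) \<open>c < d\<close>]) (rule that)
  obtain \<rho>2 where 2: "integrable lborel \<rho>2"
    "\<And>s t. c \<le> s \<Longrightarrow> s \<le> t \<Longrightarrow> t \<le> d \<Longrightarrow> (V t - f t) - (V s - f s) = (LINT u:{s..t}|lborel. \<rho>2 u)"
    by (rule abs_cont_mono_indefinite_integral[OF abs_cont_diff[OF V(1) f] V(3) \<open>c < d\<close>]) (rule that)
  show thesis
  proof (rule that)
    show "integrable lborel (\<lambda>u. \<rho>1 u - \<rho>2 u)" using 1 2 by simp
    fix s t assume st: "c \<le> s" "s \<le> t" "t \<le> d"
    have si: "set_integrable lborel {s..t} \<rho>1" "set_integrable lborel {s..t} \<rho>2"
      unfolding set_integrable_def using 1(1) 2(1) by (auto intro!: integrable_mult_indicator simp del: real_scaleR_def)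
    show "f t - f s = (LINT u:{s..t}|lborel. \<rho>1 u - \<rho>2 u)"
      using 1(2)[OF st] 2(2)[OF st] by (subst set_integral_diff(2)[OF si]) simp
  qed
qed

text \<open>The difference quotient minus \<open>\<rho> t\<close> is the mean of \<open>\<rho> - \<rho> t\<close> over the segment.\<close>

theorem abs_cont_derivative_at_lebesgue_point:
  assumes \<rho>: "integrable lborel \<rho>"
    and f: "\<And>s t. c \<le> s \<Longrightarrow> s \<le> t \<Longrightarrow> t \<le> d \<Longrightarrow> f t - f s = (LINT u:{s..t}|lborel. \<rho> u)"
    and t: "c < t" "t < d" "lebesgue_point \<rho> t"
  shows "(f has_real_derivative \<rho> t) (at t)"
proof -
  let ?m = "\<lambda>\<delta>. segment_mean (\<lambda>u. ennreal \<bar>\<rho> u - \<rho> t\<bar>) t \<delta>"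
  have bound: "ennreal \<bar>(f y - f x) - (y - x) * \<rho> t\<bar> \<le> (\<integral>\<^sup>+u\<in>{x..y}. ennreal \<bar>\<rho> u - \<rho> t\<bar> \<partial>lborel)"
    if xy: "c \<le> x" "x \<le> y" "y \<le> d" for x y
  proof -
    have si: "set_integrable lborel {x..y} \<rho>"
      unfolding set_integrable_def using \<rho> by (intro integrable_mult_indicator) auto
    have si': "set_integrable lborel {x..y} (\<lambda>u. \<rho> t)"
      unfolding set_integrable_def using xy by auto
    have "(f y - f x) - (y - x) * \<rho> t = (LINT u:{x..y}|lborel. \<rho> u) - (LINT u:{x..y}|lborel. \<rho> t)"
      using f[OF xy] xy by (simp add: set_integral_const)
    also have "\<dots> = (LINT u:{x..y}|lborel. \<rho> u - \<rho> t)"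
      by (rule set_integral_diff(2)[OF si si', symmetric])
    finally have eq: "(f y - f x) - (y - x) * \<rho> t = (\<integral>u. indicator {x..y} u *\<^sub>R (\<rho> u - \<rho> t) \<partial>lborel)"
      by (simp add: set_lebesgue_integral_def)
    have "ennreal (norm (\<integral>u. indicator {x..y} u *\<^sub>R (\<rho> u - \<rho> t) \<partial>lborel))
       \<le> (\<integral>\<^sup>+u. ennreal (norm (indicator {x..y} u *\<^sub>R (\<rho> u - \<rho> t))) \<partial>lborel)"
      using set_integral_diff(1)[OF si si'] unfolding set_integrable_def by (rule integral_norm_bound_ennreal)
    also have "\<dots> = (\<integral>\<^sup>+u\<in>{x..y}. ennreal \<bar>\<rho> u - \<rho> t\<bar> \<partial>lborel)"
      by (intro nn_integral_cong) (auto simp: indicator_def)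
    finally show ?thesis unfolding eq by simp
  qed
  have lp: "(?m \<longlongrightarrow> 0) (at 0)" using t(3) by (simp add: lebesgue_point_def)
  have "((\<lambda>\<delta>. ennreal \<bar>(f (t + \<delta>) - f t) / \<delta> - \<rho> t\<bar>) \<longlongrightarrow> 0) (at 0)"
  proof (rule tendsto_sandwich[OF _ _ tendsto_const lp])
    have "\<forall>\<^sub>F \<delta> in at 0. \<delta> \<noteq> 0 \<and> \<bar>\<delta>\<bar> < min (t - c) (d - t)"
      unfolding eventually_at using t by (intro exI[of _ "min (t - c) (d - t)"]) (auto simp: dist_real_def)
    then show "\<forall>\<^sub>F \<delta> in at 0. ennreal \<bar>(f (t + \<delta>) - f t) / \<delta> - \<rho> t\<bar> \<le> ?m \<delta>"
    proof eventually_elim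
      case (elim \<delta>)
      have "ennreal \<bar>(f (t + \<delta>) - f t) - \<delta> * \<rho> t\<bar> \<le> (\<integral>\<^sup>+u\<in>closed_segment t (t + \<delta>). ennreal \<bar>\<rho> u - \<rho> t\<bar> \<partial>lborel)"
      proof (cases "0 < \<delta>")
        case True
        then show ?thesis using bound[of t "t + \<delta>"] elim t by (simp add: closed_segment_eq_real_ivl)
      next
        case False
        have "\<bar>(f (t + \<delta>) - f t) - \<delta> * \<rho> t\<bar> = \<bar>(f t - f (t + \<delta>)) - (t - (t + \<delta>)) * \<rho> t\<bar>"
          by (simp add: abs_minus_commute algebra_simps)
        then show ?thesis using False bound[of "t + \<delta>" t] elim t by (simp add: closed_segment_eq_real_ivl)
      qed
      then have "ennreal \<bar>(f (t + \<delta>) - f t) - \<delta> * \<rho> t\<bar> / ennreal \<bar>\<delta>\<bar> \<le> ?m \<delta>"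
        by (rule divide_right_mono_ennreal)
      moreover have "ennreal \<bar>(f (t + \<delta>) - f t) - \<delta> * \<rho> t\<bar> / ennreal \<bar>\<delta>\<bar> = ennreal \<bar>(f (t + \<delta>) - f t) / \<delta> - \<rho> t\<bar>"
        using elim by (subst divide_ennreal) (auto simp: field_simps simp flip: abs_divide)
      ultimately show ?case by simp
    qed
  qed auto
  then have "((\<lambda>\<delta>. \<bar>(f (t + \<delta>) - f t) / \<delta> - \<rho> t\<bar>) \<longlongrightarrow> 0) (at 0)"
    by (subst (asm) ennreal_0[symmetric], subst (asm) tendsto_ennreal_iff) auto
  then show ?thesis
    unfolding DERIV_def by (simp add: tendsto_rabs_zero_iff LIM_zero_iff)
qed

section \<open>Inner products on the model space\<close>

lemma orthonormal_basis_expansion: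
  assumes "orthonormal_basis E"
  shows "(\<Sum>u\<in>E. inner x u *\<^sub>R u) = x"
proof -
  have fin: "finite E" and on: "\<And>u v. u \<in> E \<Longrightarrow> v \<in> E \<Longrightarrow> inner u v = (if u = v then 1 else 0)"
    and z: "\<And>x. (\<forall>u\<in>E. inner x u = 0) \<longleftrightarrow> x = 0"
    using assms by (auto simp: orthonormal_basis_def)
  have "inner ((\<Sum>u\<in>E. inner x u *\<^sub>R u) - x) v = 0" if "v \<in> E" for v
  proof -
    have "inner (\<Sum>u\<in>E. inner x u *\<^sub>R u) v = (\<Sum>u\<in>E. inner x u * (if u = v then 1 else 0))"
      using on that by (simp add: inner_sum_left)
    also have "\<dots> = inner x v" using fin that by (simp add: if_distrib[of "(*) _"] cong: if_cong)
    finally show ?thesis by (simp add: inner_diff_left)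
  qed
  then show ?thesis using z[of "(\<Sum>u\<in>E. inner x u *\<^sub>R u) - x"] by simp
qed

lemma abs_inner_basis_le_norm:
  assumes "orthonormal_basis E" "u \<in> E"
  shows "\<bar>inner x u\<bar> \<le> norm x"
proof -
  have "norm u = 1" using assms by (auto simp: orthonormal_basis_def norm_eq_sqrt_inner)
  then show ?thesis using Cauchy_Schwarz_ineq2[of x u] by simp
qed

text \<open>The model space is not an instance of class \<open>euclidean_space\<close>, so compactness is obtained by hand:
  these cubes are continuous images of products of an interval with lower-dimensional cubes.\<close>

lemma compact_bounded_combinations:
  fixes E :: "'e::real_normed_vector set"
  assumes "finite E"
  shows "compact {\<Sum>u\<in>E. c u *\<^sub>R u | c. \<forall>u\<in>E. \<bar>c u\<bar> \<le> R}"
  using assms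
proof (induction E)
  case (insert e E)
  let ?C = "\<lambda>E. {\<Sum>u\<in>E. c u *\<^sub>R u | c. \<forall>u\<in>E. \<bar>c u\<bar> \<le> R}"
  let ?f = "\<lambda>(a, y). a *\<^sub>R e + y"
  have "?C (insert e E) = ?f ` ({-R..R} \<times> ?C E)"
  proof (intro set_eqI iffI)
    fix x assume "x \<in> ?C (insert e E)"
    then obtain c where c: "x = (\<Sum>u\<in>insert e E. c u *\<^sub>R u)" "\<forall>u\<in>insert e E. \<bar>c u\<bar> \<le> R" by blast
    then have "x = ?f (c e, \<Sum>u\<in>E. c u *\<^sub>R u)" using insert.hyps by simp
    moreover have "(c e, \<Sum>u\<in>E. c u *\<^sub>R u) \<in> {-R..R} \<times> ?C E" using c by (auto simp: abs_le_iff)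
    ultimately show "x \<in> ?f ` ({-R..R} \<times> ?C E)" by blast
  next
    fix x assume "x \<in> ?f ` ({-R..R} \<times> ?C E)"
    then obtain a c where ac: "a \<in> {-R..R}" "\<forall>u\<in>E. \<bar>c u\<bar> \<le> R" "x = a *\<^sub>R e + (\<Sum>u\<in>E. c u *\<^sub>R u)" by auto
    have "(\<Sum>u\<in>E. (c(e := a)) u *\<^sub>R u) = (\<Sum>u\<in>E. c u *\<^sub>R u)"
      using insert.hyps by (intro sum.cong) auto
    then have "x = (\<Sum>u\<in>insert e E. (c(e := a)) u *\<^sub>R u)" using ac insert.hyps by simp
    moreover have "\<forall>u\<in>insert e E. \<bar>(c(e := a)) u\<bar> \<le> R" using ac by auto
    ultimately show "x \<in> ?C (insert e E)" by blast
  qed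
  moreover have "compact (?f ` ({-R..R} \<times> ?C E))"
    using insert.IH by (intro compact_continuous_image compact_Times)
      (auto intro!: continuous_intros simp: case_prod_beta')
  ultimately show ?case by simp
qed simp

lemma compact_closed_bounded:
  fixes S :: "'e::real_inner set"
  assumes E: "orthonormal_basis (E :: 'e set)" and "closed S" and R: "\<And>x. x \<in> S \<Longrightarrow> norm x \<le> R"
  shows "compact S"
proof -
  let ?C = "{\<Sum>u\<in>E. c u *\<^sub>R u | c. \<forall>u\<in>E. \<bar>c u\<bar> \<le> R}"
  have "S \<subseteq> ?C"
  proof
    fix x assume "x \<in> S"
    then have "\<forall>u\<in>E. \<bar>inner x u\<bar> \<le> R" using R abs_inner_basis_le_norm[OF E] order_trans by blast
    then show "x \<in> ?C" using orthonormal_basis_expansion[OF E, of x] by (intro CollectI exI[of _ "inner x"]) auto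
  qed
  then have eq: "?C \<inter> S = S" by blast
  have "compact ?C" using E by (intro compact_bounded_combinations) (simp add: orthonormal_basis_def)
  from compact_Int_closed[OF this \<open>closed S\<close>] show ?thesis unfolding eq .
qed

text \<open>These forms arise as coordinate expressions of a Riemannian metric at a point. A second inner product
  on the type of model vectors cannot be a class instance, hence a predicate.\<close>

definition inner_form :: "('e::real_vector \<Rightarrow> 'e \<Rightarrow> real) \<Rightarrow> bool" where
  "inner_form B \<longleftrightarrow> (\<forall>v w. B v w = B w v) \<and> (\<forall>u v w. B (u + v) w = B u w + B v w) \<and>
     (\<forall>c v w. B (c *\<^sub>R v) w = c * B v w) \<and> (\<forall>v. v \<noteq> 0 \<longrightarrow> B v v > 0)"

definition form_norm :: "('e \<Rightarrow> 'e \<Rightarrow> real) \<Rightarrow> 'e \<Rightarrow> real" where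
  "form_norm B v = sqrt (B v v)"

context
  fixes B :: "'e::real_vector \<Rightarrow> 'e \<Rightarrow> real"
  assumes B: "inner_form B"
begin

lemma form_sym: "B v w = B w v"
  using B unfolding inner_form_def by blast

lemma form_add: "B (u + v) w = B u w + B v w" and form_add_right: "B w (u + v) = B w u + B w v"
  using B unfolding inner_form_def by metis+

lemma form_scale: "B (c *\<^sub>R v) w = c * B v w" and form_scale_right: "B w (c *\<^sub>R v) = c * B w v"
  using B unfolding inner_form_def by metis+

lemma form_zero: "B 0 w = 0"
  using form_scale[of 0 0 w] by simp

lemma form_diff: "B (u - v) w = B u w - B v w"
  using form_add[of u "-1 *\<^sub>R v" w] form_scale[of "-1" v w] by simp

lemma form_nonneg: "0 \<le> B v v"
  using B form_zero unfolding inner_form_def by (cases "v = 0") (auto simp: less_imp_le)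

lemma form_sum: "B (\<Sum>i\<in>I. f i) w = (\<Sum>i\<in>I. B (f i) w)"
  by (induction I rule: infinite_finite_induct) (auto simp: form_add form_zero)

lemma form_sum_right: "B w (\<Sum>i\<in>I. f i) = (\<Sum>i\<in>I. B w (f i))"
  using form_sum[of f I w] by (simp only: form_sym[of w])

lemma form_norm_nonneg: "0 \<le> form_norm B v"
  by (simp add: form_norm_def form_nonneg)

lemma form_norm_square: "(form_norm B v)\<^sup>2 = B v v"
  by (simp add: form_norm_def form_nonneg)

lemma form_norm_zero: "form_norm B 0 = 0"
  by (simp add: form_norm_def form_zero)

lemma form_norm_pos: "v \<noteq> 0 \<Longrightarrow> 0 < form_norm B v"
  using B by (simp add: form_norm_def inner_form_def)

lemma form_norm_scale: "form_norm B (c *\<^sub>R v) = \<bar>c\<bar> * form_norm B v"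
  by (simp add: form_norm_def form_scale form_scale_right real_sqrt_mult mult.assoc[symmetric])

lemma form_Cauchy_Schwarz: "B v w \<le> form_norm B v * form_norm B w"
proof (cases "w = 0")
  case True
  then show ?thesis using form_zero[of v] form_sym[of v 0] form_norm_zero by simp
next
  case False
  then have w: "0 < B w w" using B by (simp add: inner_form_def)
  let ?c = "B v w / B w w"
  have "0 \<le> B (v - ?c *\<^sub>R w) (v - ?c *\<^sub>R w)" by (rule form_nonneg)
  also have "\<dots> = B v v - ?c * B v w"
    using w form_sym[of w "v - ?c *\<^sub>R w"] form_sym[of v "v - ?c *\<^sub>R w"] form_sym[of w v]
    by (simp add: form_diff form_scale)
  finally have "B v w * B v w \<le> B v v * B w w" using w by (simp add: field_simps)
  then have "(B v w)\<^sup>2 \<le> (form_norm B v * form_norm B w)\<^sup>2"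
    by (simp add: power_mult_distrib form_norm_square power2_eq_square[of "B v w"])
  then show ?thesis by (rule power2_le_imp_le) (simp add: form_norm_nonneg)
qed

lemma form_norm_triangle: "form_norm B (v + w) \<le> form_norm B v + form_norm B w"
proof (rule power2_le_imp_le)
  have "(form_norm B (v + w))\<^sup>2 = B v v + 2 * B v w + B w w"
    using form_sym[of v w] by (simp add: form_norm_square form_add form_add_right)
  also have "\<dots> \<le> (form_norm B v + form_norm B w)\<^sup>2"
    using form_Cauchy_Schwarz[of v w] by (simp add: power2_sum form_norm_square)
  finally show "(form_norm B (v + w))\<^sup>2 \<le> (form_norm B v + form_norm B w)\<^sup>2" .
qed (simp add: form_norm_nonneg)

lemma form_norm_minus: "form_norm B (v - w) = form_norm B (w - v)"
  using form_norm_scale[of "-1" "v - w"] by simp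

lemma form_norm_triangle_abs: "\<bar>form_norm B v - form_norm B w\<bar> \<le> form_norm B (v - w)"
  using form_norm_triangle[of "v - w" w] form_norm_triangle[of "w - v" v] form_norm_minus[of v w] by simp

lemma form_norm_sum: "form_norm B (\<Sum>i\<in>I. f i) \<le> (\<Sum>i\<in>I. form_norm B (f i))"
proof (induction I rule: infinite_finite_induct)
  case (insert i I)
  then show ?case using form_norm_triangle[of "f i" "\<Sum>i\<in>I. f i"] by simp
qed (auto simp: form_norm_zero)

end

lemma form_norm_le_norm:
  fixes B :: "'e::real_inner \<Rightarrow> 'e \<Rightarrow> real"
  assumes E: "orthonormal_basis E" and B: "inner_form B"
  obtains C where "0 < C" "\<And>v. form_norm B v \<le> C * norm v" "\<And>v. form_norm B v \<le> C * (\<Sum>u\<in>E. \<bar>inner v u\<bar>)"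
proof
  let ?C = "1 + (\<Sum>u\<in>E. form_norm B u)"
  have fin: "finite E" using E by (simp add: orthonormal_basis_def)
  show C: "0 < ?C" using form_norm_nonneg[OF B] by (simp add: add_pos_nonneg sum_nonneg)
  have le: "form_norm B v \<le> (\<Sum>u\<in>E. \<bar>inner v u\<bar> * form_norm B u)" for v
    using form_norm_sum[OF B, of "\<lambda>u. inner v u *\<^sub>R u" E]
    by (simp add: orthonormal_basis_expansion[OF E] form_norm_scale[OF B])
  fix v
  have "(\<Sum>u\<in>E. \<bar>inner v u\<bar> * form_norm B u) \<le> (\<Sum>u\<in>E. norm v * form_norm B u)"
    by (intro sum_mono mult_right_mono abs_inner_basis_le_norm[OF E] form_norm_nonneg[OF B])
  also have "\<dots> \<le> ?C * norm v" by (simp add: sum_distrib_left[symmetric] algebra_simps)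
  finally show "form_norm B v \<le> ?C * norm v" using le[of v] by simp
  have "(\<Sum>u\<in>E. \<bar>inner v u\<bar> * form_norm B u) \<le> (\<Sum>u\<in>E. \<bar>inner v u\<bar> * ?C)"
  proof (intro sum_mono mult_left_mono)
    fix u assume "u \<in> E"
    then show "form_norm B u \<le> ?C" using member_le_sum[of u E "form_norm B"] fin form_norm_nonneg[OF B] by simp
  qed simp
  then show "form_norm B v \<le> ?C * (\<Sum>u\<in>E. \<bar>inner v u\<bar>)"
    using le[of v] by (simp add: sum_distrib_right[symmetric] mult.commute)
qed

lemma isCont_form_norm:
  fixes B :: "'e::real_inner \<Rightarrow> 'e \<Rightarrow> real"
  assumes E: "orthonormal_basis (E :: 'e set)" and B: "inner_form B"
  shows "isCont (form_norm B) v"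
proof -
  obtain C where C: "0 < C" "\<And>v. form_norm B v \<le> C * norm v" by (rule form_norm_le_norm[OF E B]) (rule that)
  have "((\<lambda>w. C * norm (w - v)) \<longlongrightarrow> C * norm (v - v)) (at v)"
    by (intro tendsto_intros)
  then have "((\<lambda>w. C * norm (w - v)) \<longlongrightarrow> 0) (at v)" by simp
  then have "((\<lambda>w. form_norm B w - form_norm B v) \<longlongrightarrow> 0) (at v)"
  proof (rule Lim_null_comparison[rotated])
    show "\<forall>\<^sub>F w in at v. norm (form_norm B w - form_norm B v) \<le> C * norm (w - v)"
      using form_norm_triangle_abs[OF B] C(2) by (intro always_eventually allI) (auto intro: order_trans)
  qed
  then show ?thesis by (simp add: isCont_def LIM_zero_iff)
qed

lemma continuous_on_form_norm:
  fixes B :: "'e::real_inner \<Rightarrow> 'e \<Rightarrow> real"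
  assumes E: "orthonormal_basis (E :: 'e set)" and B: "inner_form B" and "continuous_on S f"
  shows "continuous_on S (\<lambda>x. form_norm B (f x))"
  by (rule continuous_on_compose2[of UNIV "form_norm B", OF _ assms(3)])
    (auto intro: continuous_at_imp_continuous_on isCont_form_norm[OF E B])

text \<open>By compactness of the unit sphere.\<close>

lemma norm_le_form_norm:
  fixes B :: "'e::real_inner \<Rightarrow> 'e \<Rightarrow> real"
  assumes E: "orthonormal_basis (E :: 'e set)" and B: "inner_form B"
  obtains m where "0 < m" "\<And>v. m * norm v \<le> form_norm B v"
proof -
  have c: "compact (sphere (0::'e) 1)"
  proof (rule compact_closed_bounded[OF E, of _ 1])
    have "sphere (0::'e) 1 = {x. norm x = 1}" by auto
    then show "closed (sphere (0::'e) 1)" by (simp add: closed_Collect_eq continuous_intros)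
  qed auto
  have "continuous_on (sphere 0 1) (form_norm B)"
    by (intro continuous_at_imp_continuous_on ballI isCont_form_norm[OF E B])
  have "\<exists>m>0. \<forall>x\<in>sphere 0 1. m \<le> form_norm B x"
  proof (cases "sphere (0::'e) 1 = {}")
    case True
    then show ?thesis by (intro exI[of _ 1]) auto
  next
    case False
    then obtain x where "x \<in> sphere 0 1" "\<forall>y\<in>sphere 0 1. form_norm B x \<le> form_norm B y"
      using continuous_attains_inf[OF c] \<open>continuous_on _ _\<close> by blast
    moreover have "x \<noteq> 0" using \<open>x \<in> sphere 0 1\<close> by auto
    ultimately show ?thesis using form_norm_pos[OF B] by blast
  qed
  then obtain m where m: "0 < m" "\<And>x. norm x = 1 \<Longrightarrow> m \<le> form_norm B x" by auto
  show thesis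
  proof (rule that[OF m(1)])
    fix v :: 'e
    show "m * norm v \<le> form_norm B v"
    proof (cases "v = 0")
      case False
      have "m \<le> form_norm B ((1 / norm v) *\<^sub>R v)" using False by (intro m) simp
      then show ?thesis using False by (simp add: form_norm_scale[OF B] field_simps)
    qed (simp add: form_norm_nonneg[OF B])
  qed
qed

lemma form_expansion:
  assumes E: "orthonormal_basis E" and B: "inner_form B"
  shows "B v v = (\<Sum>i\<in>E. \<Sum>j\<in>E. inner v i * inner v j * B i j)"
proof -
  have "B v v = B (\<Sum>i\<in>E. inner v i *\<^sub>R i) (\<Sum>j\<in>E. inner v j *\<^sub>R j)"
    by (simp add: orthonormal_basis_expansion[OF E])
  also have "\<dots> = (\<Sum>i\<in>E. \<Sum>j\<in>E. inner v i * inner v j * B i j)"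
    by (subst form_sum[OF B], simp only: form_sum_right[OF B] form_scale[OF B] form_scale_right[OF B] sum_distrib_left mult.assoc mult.left_commute)
  finally show ?thesis .
qed

text \<open>The difference of the quadratic forms is at most \<open>\<epsilon> m\<^sup>2 \<bar>v\<bar>\<^sup>2 \<le> \<epsilon> B v v\<close>, and
  \<open>(1 - \<epsilon>)\<^sup>2 \<le> 1 - \<epsilon>\<close> and \<open>1 + \<epsilon> \<le> (1 + \<epsilon>)\<^sup>2\<close>. The summand 1 next to the number of entries of the matrix
  keeps the factor positive in dimension 0.\<close>

lemma form_norm_perturbation:
  fixes B B' :: "'e::real_inner \<Rightarrow> 'e \<Rightarrow> real"
  assumes E: "orthonormal_basis E" and B: "inner_form B" and B': "inner_form B'"
    and m: "0 < m" "\<And>v. m * norm v \<le> form_norm B v" and \<epsilon>: "0 < \<epsilon>" "\<epsilon> < 1"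
    and close: "\<And>i j. i \<in> E \<Longrightarrow> j \<in> E \<Longrightarrow> \<bar>B' i j - B i j\<bar> * (1 + real (card E) ^ 2) \<le> \<epsilon> * m\<^sup>2"
  shows "(1 - \<epsilon>) * form_norm B v \<le> form_norm B' v" "form_norm B' v \<le> (1 + \<epsilon>) * form_norm B v"
proof -
  let ?\<eta> = "\<epsilon> * m\<^sup>2 / (1 + real (card E) ^ 2)"
  have pos: "0 < 1 + real (card E) ^ 2" by (simp add: add_pos_nonneg)
  have \<eta>: "\<bar>B' i j - B i j\<bar> \<le> ?\<eta>" if "i \<in> E" "j \<in> E" for i j
    using close[OF that] pos by (simp add: pos_le_divide_eq)
  have "\<bar>B' v v - B v v\<bar> = \<bar>\<Sum>i\<in>E. \<Sum>j\<in>E. inner v i * inner v j * (B' i j - B i j)\<bar>"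
    unfolding form_expansion[OF E B, of v] form_expansion[OF E B', of v]
    by (simp add: sum_subtractf right_diff_distrib)
  also have "\<dots> \<le> (\<Sum>i\<in>E. \<Sum>j\<in>E. \<bar>inner v i * inner v j * (B' i j - B i j)\<bar>)"
    by (intro order_trans[OF sum_abs] sum_mono sum_abs)
  also have "\<dots> \<le> (\<Sum>i\<in>E. \<Sum>j\<in>E. norm v * norm v * ?\<eta>)"
    unfolding abs_mult
    by (intro sum_mono mult_mono \<eta> abs_inner_basis_le_norm[OF E]) auto
  also have "\<dots> = (real (card E) ^ 2 * ?\<eta>) * (norm v)\<^sup>2" by (simp add: power2_eq_square)
  also have "\<dots> \<le> (\<epsilon> * m\<^sup>2) * (norm v)\<^sup>2"
    using \<epsilon> m pos by (intro mult_right_mono) (auto simp: divide_le_eq algebra_simps)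
  also have "\<dots> = \<epsilon> * (m * norm v)\<^sup>2" by (simp add: power_mult_distrib)
  also have "\<dots> \<le> \<epsilon> * (form_norm B v)\<^sup>2"
    using \<epsilon> m by (intro mult_left_mono power_mono) auto
  finally have d: "\<bar>B' v v - B v v\<bar> \<le> \<epsilon> * B v v" by (simp add: form_norm_square[OF B])
  have nn: "0 \<le> B v v" by (rule form_nonneg[OF B])
  have e2: "\<epsilon> * \<epsilon> * B v v \<le> \<epsilon> * B v v" using \<epsilon> nn by (intro mult_right_mono) auto
  show "(1 - \<epsilon>) * form_norm B v \<le> form_norm B' v"
  proof (rule power2_le_imp_le)
    have "((1 - \<epsilon>) * form_norm B v)\<^sup>2 = B v v - 2 * (\<epsilon> * B v v) + \<epsilon> * \<epsilon> * B v v"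
      by (simp add: power_mult_distrib form_norm_square[OF B], simp add: power2_eq_square algebra_simps)
    also have "\<dots> \<le> B' v v" using d e2 by linarith
    finally show "((1 - \<epsilon>) * form_norm B v)\<^sup>2 \<le> (form_norm B' v)\<^sup>2" by (simp add: form_norm_square[OF B'])
  qed (rule form_norm_nonneg[OF B'])
  show "form_norm B' v \<le> (1 + \<epsilon>) * form_norm B v"
  proof (rule power2_le_imp_le)
    have "B' v v \<le> B v v + 2 * (\<epsilon> * B v v) + \<epsilon> * \<epsilon> * B v v" using d nn \<epsilon> by (simp add: add_increasing2)
    also have "\<dots> = ((1 + \<epsilon>) * form_norm B v)\<^sup>2"
      by (simp add: power_mult_distrib form_norm_square[OF B], simp add: power2_eq_square algebra_simps)
    finally show "(form_norm B' v)\<^sup>2 \<le> ((1 + \<epsilon>) * form_norm B v)\<^sup>2" by (simp add: form_norm_square[OF B'])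
  qed (use \<epsilon> form_norm_nonneg[OF B] in auto)
qed

section \<open>Charts, tangent vectors and velocities\<close>

lemma Ck_on_differentiable: "Ck_on (Suc k) S f \<Longrightarrow> x \<in> S \<Longrightarrow> f differentiable (at x)"
  by simp

lemma Ck_on_Suc_imp_Ck_on: "Ck_on (Suc k) S f \<Longrightarrow> Ck_on k S f"
proof (induction k arbitrary: f)
  case 0
  then show ?case
    by (auto intro!: continuous_at_imp_continuous_on differentiable_imp_continuous_within)
next
  case (Suc k)
  then show ?case by (metis Ck_on.simps(2))
qed

lemma Ck_on_subset: "Ck_on k S f \<Longrightarrow> T \<subseteq> S \<Longrightarrow> Ck_on k T f"
  by (induction k arbitrary: f) (auto intro: continuous_on_subset)

text \<open>Openness is essential, because \<open>Ck_on\<close> is defined with two-sided derivatives.\<close>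

lemma Ck_on_cong:
  assumes "open S" "\<And>x. x \<in> S \<Longrightarrow> f x = g x" "Ck_on k S f"
  shows "Ck_on k S g"
  using assms(2,3)
proof (induction k arbitrary: f g)
  case 0
  then show ?case using continuous_on_cong[of S S f g] by simp
next
  case (Suc k)
  have D: "(g has_derivative frechet_derivative f (at x)) (at x)" if "x \<in> S" for x
  proof (rule has_derivative_transform_within_open[OF _ \<open>open S\<close> that])
    show "(f has_derivative frechet_derivative f (at x)) (at x)"
      using Suc.prems that by (simp add: frechet_derivative_works)
  qed (use Suc.prems in auto)
  have eq: "frechet_derivative f (at x) = frechet_derivative g (at x)" if "x \<in> S" for x
    by (rule frechet_derivative_at[OF D[OF that]])
  have "Ck_on k S (\<lambda>x. frechet_derivative g (at x) v)" for v
  proof (rule Suc.IH)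
    show "Ck_on k S (\<lambda>x. frechet_derivative f (at x) v)" using Suc.prems(2) by simp
    show "frechet_derivative f (at x) v = frechet_derivative g (at x) v" if "x \<in> S" for x
      by (rule fun_cong[OF eq[OF that]])
  qed
  then show ?case using D by (auto intro: differentiableI)
qed

lemma Ck_on_add:
  assumes "open S" "Ck_on k S f" "Ck_on k S g"
  shows "Ck_on k S (\<lambda>x. f x + g x)"
  using assms(2,3)
proof (induction k arbitrary: f g)
  case 0
  then show ?case by (simp add: continuous_on_add)
next
  case (Suc k)
  let ?D = "\<lambda>f x. frechet_derivative f (at x)"
  have D: "((\<lambda>x. f x + g x) has_derivative (\<lambda>v. ?D f x v + ?D g x v)) (at x)" if "x \<in> S" for x
    using Suc.prems that by (intro has_derivative_add) (auto simp: frechet_derivative_works)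
  have "Ck_on k S (\<lambda>x. ?D (\<lambda>x. f x + g x) x v)" for v
  proof (rule Ck_on_cong[OF \<open>open S\<close>])
    show "Ck_on k S (\<lambda>x. ?D f x v + ?D g x v)" using Suc by simp
    show "?D f x v + ?D g x v = ?D (\<lambda>x. f x + g x) x v" if "x \<in> S" for x
      by (rule fun_cong[OF frechet_derivative_at[OF D[OF that]]])
  qed
  then show ?case using D by (auto intro: differentiableI)
qed

lemma Ck_on_mult:
  fixes f g :: "'e::real_normed_vector \<Rightarrow> real"
  assumes "open S" "Ck_on k S f" "Ck_on k S g"
  shows "Ck_on k S (\<lambda>x. f x * g x)"
  using assms(2,3)
proof (induction k arbitrary: f g)
  case 0
  then show ?case by (simp add: continuous_on_mult)
next
  case (Suc k)
  let ?D = "\<lambda>f x. frechet_derivative f (at x)"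
  have D: "((\<lambda>x. f x * g x) has_derivative (\<lambda>v. f x * ?D g x v + ?D f x v * g x)) (at x)" if "x \<in> S" for x
    using Suc.prems that by (intro has_derivative_mult) (auto simp: frechet_derivative_works)
  have "Ck_on k S (\<lambda>x. ?D (\<lambda>x. f x * g x) x v)" for v
  proof (rule Ck_on_cong[OF \<open>open S\<close>])
    show "Ck_on k S (\<lambda>x. f x * ?D g x v + ?D f x v * g x)"
      using Suc Ck_on_Suc_imp_Ck_on[OF Suc.prems(1)] Ck_on_Suc_imp_Ck_on[OF Suc.prems(2)]
      by (intro Ck_on_add \<open>open S\<close>) auto
    show "f x * ?D g x v + ?D f x v * g x = ?D (\<lambda>x. f x * g x) x v" if "x \<in> S" for x
      by (rule fun_cong[OF frechet_derivative_at[OF D[OF that]]])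
  qed
  then show ?case using D by (auto intro: differentiableI)
qed

lemma Ck_on_const: "Ck_on k S (\<lambda>x. c)"
  by (induction k arbitrary: c) auto

lemma Ck_on_inner_const:
  fixes f :: "'e::real_normed_vector \<Rightarrow> 'f::real_inner"
  assumes "open S" "Ck_on k S f"
  shows "Ck_on k S (\<lambda>x. inner (f x) w)"
  using assms(2)
proof (induction k arbitrary: f)
  case 0
  then show ?case by (simp add: continuous_intros)
next
  case (Suc k)
  let ?D = "\<lambda>f x. frechet_derivative f (at x)"
  have D: "((\<lambda>x. inner (f x) w) has_derivative (\<lambda>v. inner (?D f x v) w)) (at x)" if "x \<in> S" for x
    using Suc.prems that by (intro has_derivative_inner_left) (auto simp: frechet_derivative_works)
  have "Ck_on k S (\<lambda>x. ?D (\<lambda>x. inner (f x) w) x v)" for v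
  proof (rule Ck_on_cong[OF \<open>open S\<close>])
    show "Ck_on k S (\<lambda>x. inner (?D f x v) w)" using Suc by simp
    show "inner (?D f x v) w = ?D (\<lambda>x. inner (f x) w) x v" if "x \<in> S" for x
      by (rule fun_cong[OF frechet_derivative_at[OF D[OF that]]])
  qed
  then show ?case using D by (auto intro: differentiableI)
qed

context
  fixes A :: "('a::{t2_space,second_countable_topology}, 'e::real_inner) chart set"
  assumes A: "smooth_atlas A"
begin

lemma chart_homeomorphism:
  assumes "c \<in> A"
  shows "open (fst c)" "open (snd c ` fst c)"
    "homeomorphism (fst c) (snd c ` fst c) (snd c) (chart_inv c)"
proof -
  have "\<forall>(U, \<phi>)\<in>A. open U \<and> open (\<phi> ` U) \<and> homeomorphism U (\<phi> ` U) \<phi> (chart_inv (U, \<phi>))"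
    using A by (simp add: smooth_atlas_def)
  with assms show "open (fst c)" "open (snd c ` fst c)"
    "homeomorphism (fst c) (snd c ` fst c) (snd c) (chart_inv c)"
    by (auto simp: case_prod_beta')
qed

lemma chart_inv_left: "c \<in> A \<Longrightarrow> q \<in> fst c \<Longrightarrow> chart_inv c (snd c q) = q"
  using chart_homeomorphism(3) by (auto simp: homeomorphism_def)

lemma chart_inv_right:
  "c \<in> A \<Longrightarrow> y \<in> snd c ` fst c \<Longrightarrow> snd c (chart_inv c y) = y"
  "c \<in> A \<Longrightarrow> y \<in> snd c ` fst c \<Longrightarrow> chart_inv c y \<in> fst c"
  by (auto simp: chart_inv_left)

lemma chart_continuous:
  "c \<in> A \<Longrightarrow> continuous_on (fst c) (snd c)" "c \<in> A \<Longrightarrow> continuous_on (snd c ` fst c) (chart_inv c)"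
  using chart_homeomorphism(3) by (auto simp: homeomorphism_def)

lemma open_chart_image:
  assumes c: "c \<in> A" and W: "open W" "W \<subseteq> fst c"
  shows "open (snd c ` W)"
proof -
  have "snd c ` W = chart_inv c -` W \<inter> snd c ` fst c"
    using W chart_inv_left[OF c] chart_inv_right[OF c] by (auto simp: image_iff)
  then show ?thesis
    using continuous_open_preimage[OF chart_continuous(2)[OF c] chart_homeomorphism(2)[OF c] W(1)]
    by (simp add: Int_commute)
qed

lemma chart_exists: "\<exists>c\<in>A. p \<in> fst c"
proof -
  have "p \<in> (\<Union>(U, \<phi>)\<in>A. U)" using A by (simp add: smooth_atlas_def)
  then show ?thesis by (auto simp: case_prod_beta')
qed

lemma smooth_transition:
  assumes "c \<in> A" "c' \<in> A"
  shows "smooth_on (snd c ` (fst c \<inter> fst c')) (snd c' \<circ> chart_inv c)"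
proof -
  have "\<forall>(U, \<phi>)\<in>A. \<forall>(V, \<psi>)\<in>A. smooth_on (\<phi> ` (U \<inter> V)) (\<psi> \<circ> chart_inv (U, \<phi>))"
    using A by (simp add: smooth_atlas_def)
  with assms show ?thesis by (auto simp: case_prod_beta')
qed

lemma transition_differentiable:
  assumes "c \<in> A" "c' \<in> A" "p \<in> fst c" "p \<in> fst c'"
  shows "(snd c' \<circ> chart_inv c) differentiable (at (snd c p))"
  using smooth_transition[OF assms(1,2)] assms(3,4) unfolding smooth_on_def
  by (intro Ck_on_differentiable[of 0 "snd c ` (fst c \<inter> fst c')"]) auto

lemma smooth_nearD:
  assumes "smooth_near A p f" "c \<in> A" "p \<in> fst c"
  obtains W where "open W" "p \<in> W" "W \<subseteq> fst c" "smooth_on (snd c ` W) (f \<circ> chart_inv c)"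
  using assms(1)[unfolded smooth_near_def, THEN bspec, OF assms(2)] assms(3) that by (auto simp: case_prod_beta')

lemma smooth_nearI:
  assumes "\<And>c. c \<in> A \<Longrightarrow> p \<in> fst c \<Longrightarrow>
     \<exists>W. open W \<and> p \<in> W \<and> W \<subseteq> fst c \<and> smooth_on (snd c ` W) (f \<circ> chart_inv c)"
  shows "smooth_near A p f"
  unfolding smooth_near_def
proof (clarify)
  fix U \<phi> assume "(U, \<phi>) \<in> A" "p \<in> U"
  with assms[of "(U, \<phi>)"] show "\<exists>W. open W \<and> p \<in> W \<and> W \<subseteq> U \<and> smooth_on (\<phi> ` W) (f \<circ> chart_inv (U, \<phi>))"
    by simp
qed

lemma smooth_near_differentiable:
  assumes "smooth_near A p f" "c \<in> A" "p \<in> fst c"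
  shows "(f \<circ> chart_inv c) differentiable (at (snd c p))"
proof -
  obtain W where "p \<in> W" "smooth_on (snd c ` W) (f \<circ> chart_inv c)" by (rule smooth_nearD[OF assms])
  then show ?thesis unfolding smooth_on_def by (intro Ck_on_differentiable[of 0 "snd c ` W"]) auto
qed

text \<open>The common part of the proofs for sums and products: both functions are smooth on the image of the
  intersection of their neighbourhoods.\<close>

lemma smooth_near_combine:
  assumes f: "smooth_near A p f" and g: "smooth_near A p g"
    and C: "\<And>k S F G. open S \<Longrightarrow> Ck_on k S F \<Longrightarrow> Ck_on k S G \<Longrightarrow> Ck_on k S (\<lambda>x::'e. op (F x) (G x))"
  shows "smooth_near A p (\<lambda>q. op (f q) (g q) :: real)"
proof (rule smooth_nearI)
  fix c assume c: "c \<in> A" "p \<in> fst c"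
  obtain W where W: "open W" "p \<in> W" "W \<subseteq> fst c" "smooth_on (snd c ` W) (f \<circ> chart_inv c)"
    by (rule smooth_nearD[OF f c])
  obtain V where V: "open V" "p \<in> V" "V \<subseteq> fst c" "smooth_on (snd c ` V) (g \<circ> chart_inv c)"
    by (rule smooth_nearD[OF g c])
  have op: "open (snd c ` (W \<inter> V))" using W V by (intro open_chart_image c) auto
  have "Ck_on k (snd c ` (W \<inter> V)) (f \<circ> chart_inv c)" for k
    by (rule Ck_on_subset[of _ "snd c ` W"]) (use W(4) in \<open>auto simp: smooth_on_def\<close>)
  moreover have "Ck_on k (snd c ` (W \<inter> V)) (g \<circ> chart_inv c)" for k
    by (rule Ck_on_subset[of _ "snd c ` V"]) (use V(4) in \<open>auto simp: smooth_on_def\<close>)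
  ultimately have "smooth_on (snd c ` (W \<inter> V)) (\<lambda>x. op ((f \<circ> chart_inv c) x) ((g \<circ> chart_inv c) x))"
    unfolding smooth_on_def by (intro allI C[OF op])
  then show "\<exists>W. open W \<and> p \<in> W \<and> W \<subseteq> fst c \<and> smooth_on (snd c ` W) ((\<lambda>q. op (f q) (g q)) \<circ> chart_inv c)"
    using W V by (intro exI[of _ "W \<inter> V"]) (auto simp: comp_def)
qed

lemma smooth_near_const: "smooth_near A p (\<lambda>q. c)"
  by (rule smooth_nearI) (auto intro!: exI[of _ "fst _"] chart_homeomorphism(1) simp: smooth_on_def comp_def Ck_on_const)

lemma coord_vector_in_tangent_space:
  assumes c: "c \<in> A" "p \<in> fst c"
  shows "coord_vector A c p v \<in> tangent_space A p"
proof -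
  let ?X = "coord_vector A c p v" and ?D = "\<lambda>f. frechet_derivative (f \<circ> chart_inv c) (at (snd c p))"
  have D: "((f \<circ> chart_inv c) has_derivative ?D f) (at (snd c p))" if "smooth_near A p f" for f
    using smooth_near_differentiable[OF that c] by (simp add: frechet_derivative_works)
  have X: "?X f = ?D f v" if "smooth_near A p f" for f using that by (simp add: coord_vector_def)
  have inv: "chart_inv c (snd c p) = p" by (rule chart_inv_left[OF c])
  have add: "?X (\<lambda>q. f q + g q) = ?X f + ?X g" if f: "smooth_near A p f" and g: "smooth_near A p g" for f g
  proof -
    have s: "smooth_near A p (\<lambda>q. f q + g q)" by (rule smooth_near_combine[OF f g Ck_on_add])
    have "((\<lambda>q. f q + g q) \<circ> chart_inv c has_derivative (\<lambda>v. ?D f v + ?D g v)) (at (snd c p))"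
      using has_derivative_add[OF D[OF f] D[OF g]] by (simp add: comp_def)
    from fun_cong[OF frechet_derivative_at[OF this], of v] show ?thesis
      unfolding X[OF s] X[OF f] X[OF g] by simp
  qed
  have mult: "?X (\<lambda>q. f q * g q) = f p * ?X g + g p * ?X f" if f: "smooth_near A p f" and g: "smooth_near A p g" for f g
  proof -
    have s: "smooth_near A p (\<lambda>q. f q * g q)" by (rule smooth_near_combine[OF f g Ck_on_mult])
    have "((\<lambda>q. f q * g q) \<circ> chart_inv c has_derivative (\<lambda>v. f p * ?D g v + ?D f v * g p)) (at (snd c p))"
      using has_derivative_mult[OF D[OF f] D[OF g]] by (simp add: comp_def inv)
    from fun_cong[OF frechet_derivative_at[OF this], of v] show ?thesis
      unfolding X[OF s] X[OF f] X[OF g] by (simp add: mult.commute)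
  qed
  have cst: "?X (\<lambda>q. r) = 0" for r
  proof -
    have "((\<lambda>q. r) \<circ> chart_inv c has_derivative (\<lambda>v. 0)) (at (snd c p))" by (simp add: comp_def)
    from fun_cong[OF frechet_derivative_at[OF this], of v] show ?thesis unfolding X[OF smooth_near_const] by simp
  qed
  show ?thesis
    unfolding tangent_space_def
  proof (intro CollectI conjI allI impI)
    fix r f assume f: "smooth_near A p f"
    show "?X (\<lambda>q. r * f q) = r * ?X f" using mult[OF smooth_near_const[of p r] f] cst by simp
  qed (use add mult in \<open>auto simp: coord_vector_def\<close>)
qed

lemma coord_vector_linear:
  assumes c: "c \<in> A" "p \<in> fst c"
  shows "coord_vector A c p (v + w) = (\<lambda>f. coord_vector A c p v f + coord_vector A c p w f)"
    "coord_vector A c p (r *\<^sub>R v) = (\<lambda>f. r * coord_vector A c p v f)"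
proof -
  have "linear (frechet_derivative (f \<circ> chart_inv c) (at (snd c p)))" if "smooth_near A p f" for f
    using smooth_near_differentiable[OF that c] by (rule linear_frechet_derivative)
  then show "coord_vector A c p (v + w) = (\<lambda>f. coord_vector A c p v f + coord_vector A c p w f)"
    "coord_vector A c p (r *\<^sub>R v) = (\<lambda>f. r * coord_vector A c p v f)"
    by (auto simp: coord_vector_def linear_add linear_scale)
qed

text \<open>The vector is tested on the coordinate function \<open>q \<mapsto> \<phi> q \<bullet> v\<close>, on which it takes the value \<open>v \<bullet> v\<close>. Off the
  chart domain the values of \<open>\<phi>\<close> are arbitrary, but smoothness near \<open>p\<close> does not depend on them.\<close>

lemma coord_vector_nonzero:
  assumes c: "c \<in> A" "p \<in> fst c" and "v \<noteq> 0"
  shows "coord_vector A c p v \<noteq> (\<lambda>f. 0)"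
proof
  assume *: "coord_vector A c p v = (\<lambda>f. 0)"
  let ?f = "\<lambda>q. inner (snd c q) v"
  have sm: "smooth_near A p ?f"
  proof (rule smooth_nearI)
    fix c' assume c': "c' \<in> A" "p \<in> fst c'"
    have op: "open (snd c' ` (fst c' \<inter> fst c))"
      using c c' chart_homeomorphism(1)[OF c(1)] chart_homeomorphism(1)[OF c'(1)] by (intro open_chart_image) auto
    have "smooth_on (snd c' ` (fst c' \<inter> fst c)) (\<lambda>x. inner ((snd c \<circ> chart_inv c') x) v)"
      using smooth_transition[OF c'(1) c(1)] unfolding smooth_on_def by (intro allI Ck_on_inner_const[OF op]) blast
    then show "\<exists>W. open W \<and> p \<in> W \<and> W \<subseteq> fst c' \<and> smooth_on (snd c' ` W) (?f \<circ> chart_inv c')"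
      using c c' chart_homeomorphism(1)[OF c(1)] chart_homeomorphism(1)[OF c'(1)] by (intro exI[of _ "fst c' \<inter> fst c"]) (auto simp: comp_def)
  qed
  have "((\<lambda>x. inner x v) has_derivative (\<lambda>w. inner w v)) (at (snd c p))"
    by (intro derivative_eq_intros) auto
  then have "(?f \<circ> chart_inv c has_derivative (\<lambda>w. inner w v)) (at (snd c p))"
    by (rule has_derivative_transform_within_open[OF _ chart_homeomorphism(2)[OF c(1)]])
      (use c chart_inv_right[OF c(1)] in auto)
  from fun_cong[OF frechet_derivative_at[OF this], of v] have "coord_vector A c p v ?f = inner v v"
    using sm by (simp add: coord_vector_def)
  with * \<open>v \<noteq> 0\<close> show False by simp
qed

text \<open>The chain rule for \<open>f \<circ> \<sigma> = (f \<circ> \<phi>\<^sup>-\<^sup>1) \<circ> (\<phi> \<circ> \<sigma>)\<close>, which holds near \<open>u\<close> only.\<close>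

lemma velocity_eq_coord_vector:
  assumes c: "c \<in> A" "\<sigma> u \<in> fst c" and cont: "isCont \<sigma> u"
    and D: "((snd c \<circ> \<sigma>) has_vector_derivative x') (at u)"
  shows "velocity A \<sigma> u = coord_vector A c (\<sigma> u) x'"
proof
  fix f
  show "velocity A \<sigma> u f = coord_vector A c (\<sigma> u) x' f"
  proof (cases "smooth_near A (\<sigma> u) f")
    case True
    let ?F = "frechet_derivative (f \<circ> chart_inv c) (at (snd c (\<sigma> u)))"
    have F: "((f \<circ> chart_inv c) has_derivative ?F) (at ((snd c \<circ> \<sigma>) u))"
      using smooth_near_differentiable[OF True c] by (simp add: frechet_derivative_works)
    then have "((f \<circ> chart_inv c) has_derivative ?F) (at ((snd c \<circ> \<sigma>) u) within range (snd c \<circ> \<sigma>))"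
      by (rule has_derivative_at_withinI)
    then have "((f \<circ> chart_inv c) \<circ> (snd c \<circ> \<sigma>) has_vector_derivative ?F x') (at u)"
      using vector_derivative_diff_chain_within[OF D, of "f \<circ> chart_inv c" ?F] by simp
    moreover have "\<forall>\<^sub>F t in at u. ((f \<circ> chart_inv c) \<circ> (snd c \<circ> \<sigma>)) t = (f \<circ> \<sigma>) t"
    proof -
      have "\<forall>\<^sub>F t in at u. \<sigma> t \<in> fst c"
        using cont c chart_homeomorphism(1)[OF c(1)] unfolding isCont_def by (auto dest: topological_tendstoD)
      then show ?thesis by eventually_elim (simp add: chart_inv_left[OF c(1)])
    qed
    ultimately have "(f \<circ> \<sigma> has_vector_derivative ?F x') (at u)"
      unfolding has_vector_derivative_def
      by (rule has_derivative_transform_eventually) (simp_all add: chart_inv_left[OF c])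
    then have "deriv (f \<circ> \<sigma>) u = ?F x'"
      by (intro DERIV_imp_deriv) (simp add: has_real_derivative_iff_has_vector_derivative)
    with True show ?thesis by (simp add: velocity_def coord_vector_def)
  qed (simp add: velocity_def coord_vector_def)
qed

lemma differentiable_change_chart:
  assumes c: "c \<in> A" "\<sigma> u \<in> fst c" and c': "c' \<in> A" "\<sigma> u \<in> fst c'" and cont: "isCont \<sigma> u"
    and D: "(snd c \<circ> \<sigma>) differentiable (at u)"
  shows "(snd c' \<circ> \<sigma>) differentiable (at u)"
proof -
  have "(snd c' \<circ> chart_inv c) \<circ> (snd c \<circ> \<sigma>) differentiable (at u)"
    using D transition_differentiable[OF c(1) c'(1) c(2) c'(2)] by (intro differentiable_chain_at) auto
  moreover have ev: "\<forall>\<^sub>F t in at u. ((snd c' \<circ> chart_inv c) \<circ> (snd c \<circ> \<sigma>)) t = (snd c' \<circ> \<sigma>) t"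
  proof -
    have "\<forall>\<^sub>F t in at u. \<sigma> t \<in> fst c"
      using cont c chart_homeomorphism(1)[OF c(1)] unfolding isCont_def by (auto dest: topological_tendstoD)
    then show ?thesis by eventually_elim (simp add: chart_inv_left[OF c(1)])
  qed
  ultimately obtain D' where "((snd c' \<circ> chart_inv c) \<circ> (snd c \<circ> \<sigma>) has_derivative D') (at u)"
    by (auto simp: differentiable_def)
  then have "(snd c' \<circ> \<sigma> has_derivative D') (at u)"
    by (rule has_derivative_transform_eventually[OF _ ev]) (simp_all add: chart_inv_left[OF c])
  then show ?thesis by (rule differentiableI)
qed

lemma C1_curve_on_differentiable:
  assumes "C1_curve_on A J \<sigma>" "t \<in> J"
  obtains c x' where "c \<in> A" "\<sigma> t \<in> fst c" "((snd c \<circ> \<sigma>) has_vector_derivative x') (at t within J)"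
proof -
  from assms(1)[unfolded C1_curve_on_def, THEN bspec, OF assms(2)]
  obtain c D e where c: "c \<in> A" "0 < e" and D: "\<And>u. u \<in> J \<inter> ball t e \<Longrightarrow>
      \<sigma> u \<in> fst c \<and> ((snd c \<circ> \<sigma>) has_vector_derivative D u) (at u within J)"
    unfolding case_prod_beta' by blast
  have "t \<in> J \<inter> ball t e" using assms(2) c by simp
  from D[OF this] show thesis using that c by blast
qed

text \<open>The charts which witness that a path is piecewise \<open>C\<^sup>1\<close> vary along the path. Away from the breakpoints the path
  is differentiable in every chart, because transition maps are differentiable.\<close>

lemma piecewise_C1_path_differentiable:
  fixes \<sigma> :: "real \<Rightarrow> 'a"
  assumes \<sigma>: "piecewise_C1_path A \<sigma>"
  obtains S where "finite S"
    "\<And>u c. u \<in> {0<..<1} - S \<Longrightarrow> c \<in> A \<Longrightarrow> \<sigma> u \<in> fst c \<Longrightarrow> (snd c \<circ> \<sigma>) differentiable (at u)"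
proof -
  obtain n \<tau> where \<tau>: "\<tau> 0 = 0" "\<tau> n = 1"
    "\<And>k. k < n \<Longrightarrow> \<tau> k < \<tau> (Suc k) \<and> C1_curve_on A {\<tau> k..\<tau> (Suc k)} \<sigma>"
    and cont: "continuous_on {0..1} \<sigma>"
    using \<sigma> unfolding piecewise_C1_path_def by metis
  show thesis
  proof (rule that)
    show "finite (\<tau> ` {..n})" by simp
    fix u c assume u: "u \<in> {0<..<1} - \<tau> ` {..n}" and c: "c \<in> A" "\<sigma> u \<in> fst c"
    define k where "k = (LEAST k. u \<le> \<tau> k)"
    have un: "u \<le> \<tau> n" using u \<tau> by auto
    then have uk: "u \<le> \<tau> k" "k \<le> n" unfolding k_def by (auto intro: LeastI Least_le)
    have "k \<noteq> 0" using uk(1) u \<tau>(1) by (metis DiffD1 greaterThanLessThan_iff not_le)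
    then obtain j where j: "k = Suc j" using not0_implies_Suc by blast
    have "\<not> u \<le> \<tau> j" using not_less_Least[of j "\<lambda>k. u \<le> \<tau> k"] j by (simp add: k_def)
    moreover have "u \<noteq> \<tau> k" using u uk by auto
    ultimately have u': "\<tau> j < u" "u < \<tau> (Suc j)" using uk j by auto
    then have "u \<in> {\<tau> j..\<tau> (Suc j)}" by simp
    moreover have "C1_curve_on A {\<tau> j..\<tau> (Suc j)} \<sigma>" using \<tau>(3)[of j] uk j by simp
    ultimately have J: "C1_curve_on A {\<tau> j..\<tau> (Suc j)} \<sigma>" "u \<in> {\<tau> j..\<tau> (Suc j)}" by simp_all
    obtain c' x' where c': "c' \<in> A" "\<sigma> u \<in> fst c'"
      "((snd c' \<circ> \<sigma>) has_vector_derivative x') (at u within {\<tau> j..\<tau> (Suc j)})"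
      by (rule C1_curve_on_differentiable[OF J]) (rule that)
    moreover from c'(3) have "((snd c' \<circ> \<sigma>) has_vector_derivative x') (at u within {\<tau> j..\<tau> (Suc j)})" .
    moreover have "at u within {\<tau> j..\<tau> (Suc j)} = at u"
      using u' by (intro at_within_interior) (simp add: interior_atLeastAtMost_real)
    ultimately have d: "(snd c' \<circ> \<sigma>) differentiable (at u)"
      by (auto simp: has_vector_derivative_def differentiable_def)
    have "isCont \<sigma> u" using continuous_on_interior[OF cont] u by (simp add: interior_atLeastAtMost_real)
    then show "(snd c \<circ> \<sigma>) differentiable (at u)"
      using differentiable_change_chart[OF c'(1,2) c _ d] by simp
  qed
qed

end

section \<open>The length metric in a chart\<close>

text \<open>The derivative of \<open>\<psi>\<close> is Henstock--Kurzweil integrable, hence measurable; if the right-hand side is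
  finite, its positive part is Lebesgue integrable. This spares all questions of measurability of \<open>F\<close>,
  which will be the speed of a path.\<close>

lemma increment_le_nn_integral:
  fixes \<psi> \<psi>' :: "real \<Rightarrow> real" and F :: "real \<Rightarrow> ennreal"
  assumes "s \<le> t" "continuous_on {s..t} \<psi>" "finite S"
    and D: "\<And>u. u \<in> {s<..<t} - S \<Longrightarrow> (\<psi> has_real_derivative \<psi>' u) (at u)"
    and F: "\<And>u. u \<in> {s<..<t} - S \<Longrightarrow> ennreal (\<psi>' u) \<le> F u"
  shows "ennreal (\<psi> t - \<psi> s) \<le> (\<integral>\<^sup>+u\<in>{s..t}. F u \<partial>lebesgue)"
proof -
  define g where "g = (\<lambda>u. if u \<in> {s<..<t} - S then \<psi>' u else 0)"
  have hi: "(g has_integral (\<psi> t - \<psi> s)) {s..t}"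
    using assms by (intro fundamental_theorem_of_calculus_interior_strong[OF \<open>finite S\<close>])
      (auto simp: g_def has_real_derivative_iff_has_vector_derivative)
  have gm: "g \<in> borel_measurable (lebesgue_on {s..t})"
    using hi by (intro integrable_imp_measurable) auto
  define q where "q = (\<lambda>u. max 0 (g u))"
  have "(\<lambda>u. if u \<in> {s..t} then g u else 0) \<in> borel_measurable lebesgue"
    using gm by (subst borel_measurable_if) auto
  then have Pm: "(\<lambda>u. indicator {s..t} u *\<^sub>R q u) \<in> borel_measurable lebesgue"
  proof (rule measurable_cong[THEN iffD1, rotated, OF borel_measurable_max[OF borel_measurable_const, of _ _ 0]])
  qed (auto simp: q_def indicator_def)
  have le: "(\<integral>\<^sup>+u. ennreal (indicator {s..t} u *\<^sub>R q u) \<partial>lebesgue) \<le> (\<integral>\<^sup>+u\<in>{s..t}. F u \<partial>lebesgue)"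
    using F by (intro nn_integral_mono) (auto simp: indicator_def q_def g_def max_def)
  show ?thesis
  proof (cases "(\<integral>\<^sup>+u\<in>{s..t}. F u \<partial>lebesgue) = \<infinity>")
    case False
    then have "(\<integral>\<^sup>+u. ennreal (indicator {s..t} u *\<^sub>R q u) \<partial>lebesgue) < \<infinity>"
      using le by (simp add: less_top order.strict_trans1)
    then have int: "integrable lebesgue (\<lambda>u. indicator {s..t} u *\<^sub>R q u)"
      using Pm by (intro integrableI_nonneg) (auto simp: q_def indicator_def)
    then have si: "set_integrable lebesgue {s..t} q" by (simp add: set_integrable_def)
    have "\<psi> t - \<psi> s = integral {s..t} g" using hi by (simp add: integral_unique)
    also have "\<dots> \<le> integral {s..t} q"
      using hi set_lebesgue_integral_eq_integral(1)[OF si] by (intro integral_le) (auto simp: q_def)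
    also have "\<dots> = (\<integral>u. indicator {s..t} u *\<^sub>R q u \<partial>lebesgue)"
      using set_lebesgue_integral_eq_integral(2)[OF si] by (simp add: set_lebesgue_integral_def)
    finally have "ennreal (\<psi> t - \<psi> s) \<le> ennreal (\<integral>u. indicator {s..t} u *\<^sub>R q u \<partial>lebesgue)"
      by (rule ennreal_leI)
    also have "\<dots> = (\<integral>\<^sup>+u. ennreal (indicator {s..t} u *\<^sub>R q u) \<partial>lebesgue)"
      by (rule nn_integral_eq_integral[OF int, symmetric]) (auto simp: q_def indicator_def)
    finally show ?thesis using le by simp
  qed simp
qed

text \<open>\<open>T\<close> is the first time at which the path is outside \<open>W\<close>; by continuity it is then still in the closed
  set \<open>K\<close>.\<close>

lemma path_exits_through_boundary:
  fixes \<sigma> :: "real \<Rightarrow> 'a::topological_space"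
  assumes \<sigma>: "continuous_on {0..1} \<sigma>" and W: "open W" "W \<subseteq> K" and K: "closed K"
    and ends: "\<sigma> 0 \<in> W" "\<sigma> 1 \<notin> W"
  obtains T where "T \<in> {0..1}" "\<sigma> ` {0..T} \<subseteq> K" "\<sigma> T \<notin> W"
proof -
  define Z where "Z = {0..1} \<inter> \<sigma> -` (- W)"
  have Z: "closed Z" unfolding Z_def
    using continuous_closed_preimage[OF \<sigma>, of "- W"] W(1) by (simp add: closed_Compl)
  have ne: "1 \<in> Z" using ends by (simp add: Z_def)
  have bdd: "bdd_below Z" by (rule bdd_belowI[of _ 0]) (simp add: Z_def)
  define T where "T = Inf Z"
  have TZ: "T \<in> Z" unfolding T_def using closed_contains_Inf[OF _ bdd Z] ne by blast
  have "0 < T" using TZ ends by (auto simp: Z_def order_le_less)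
  have before: "\<sigma> u \<in> K" if "0 \<le> u" "u < T" for u
    using that cInf_lower[OF _ bdd, of u] TZ W(2) unfolding T_def[symmetric] by (force simp: Z_def)
  have "closed ({0..T} \<inter> \<sigma> -` K)"
    using TZ K by (intro continuous_closed_preimage continuous_on_subset[OF \<sigma>]) (auto simp: Z_def)
  moreover have "{0..<T} \<subseteq> {0..T} \<inter> \<sigma> -` K" using before by auto
  ultimately have "closure {0..<T} \<subseteq> {0..T} \<inter> \<sigma> -` K" by (rule closure_minimal[rotated])
  then have "\<sigma> ` {0..T} \<subseteq> K" using \<open>0 < T\<close> by (auto simp: closure_atLeastLessThan)
  then show thesis using that[of T] TZ by (auto simp: Z_def)
qed

definition chart_form :: "('a::topological_space, 'e::real_inner) chart set \<Rightarrow>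
    ('a \<Rightarrow> 'a tangent \<Rightarrow> 'a tangent \<Rightarrow> real) \<Rightarrow> ('a, 'e) chart \<Rightarrow> 'a \<Rightarrow> 'e \<Rightarrow> 'e \<Rightarrow> real" where
  "chart_form A G c q v w = G q (coord_vector A c q v) (coord_vector A c q w)"

text \<open>The metric is compared with the norm \<open>N\<close> which it defines at \<open>p\<close>, held constant in the chart.
  Measuring the ball with \<open>N\<close> itself, and not with the norm of the model space, makes the radius
  directly comparable to lengths. The inclusion puts the whole ball into the range of the chart.\<close>

definition nearly_constant_on_ball ::
  "('a::topological_space, 'e::real_inner) chart set \<Rightarrow>
    ('a \<Rightarrow> 'a tangent \<Rightarrow> 'a tangent \<Rightarrow> real) \<Rightarrow> ('a, 'e) chart \<Rightarrow> 'a \<Rightarrow> real \<Rightarrow> real \<Rightarrow> bool" where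
  "nearly_constant_on_ball A G c p \<epsilon> r \<longleftrightarrow>
     {y. form_norm (chart_form A G c p) (y - snd c p) \<le> r} \<subseteq> snd c ` fst c \<and>
     (\<forall>q\<in>fst c. form_norm (chart_form A G c p) (snd c q - snd c p) \<le> r \<longrightarrow>
        (\<forall>v. (1 - \<epsilon>) * form_norm (chart_form A G c p) v \<le> form_norm (chart_form A G c q) v \<and>
             form_norm (chart_form A G c q) v \<le> (1 + \<epsilon>) * form_norm (chart_form A G c p) v))"

context
  fixes E :: "'e::real_inner set"
    and A :: "('a::{t2_space,second_countable_topology}, 'e) chart set"
  assumes E: "orthonormal_basis E" and A: "smooth_atlas A"
begin

lemma inner_form_chart_form:
  assumes c: "c \<in> A" "q \<in> fst c" and G: "inner_product_on_tangent A q (G q)"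
  shows "inner_form (chart_form A G c q)"
proof -
  note T = coord_vector_in_tangent_space[OF A c]
  have sym: "G q X Y = G q Y X" and add: "G q (\<lambda>f. X f + Y f) Z = G q X Z + G q Y Z"
    and scale: "G q (\<lambda>f. r * X f) Z = r * G q X Z" and pos: "X \<noteq> (\<lambda>f. 0) \<Longrightarrow> 0 < G q X X"
    if "X \<in> tangent_space A q" "Y \<in> tangent_space A q" "Z \<in> tangent_space A q" for X Y Z r
    using G that unfolding inner_product_on_tangent_def by auto
  show ?thesis
    unfolding inner_form_def chart_form_def coord_vector_linear[OF A c]
    by (intro conjI allI impI sym[OF T T T] add[OF T T T] scale[OF T T T] pos[OF T T T] coord_vector_nonzero[OF A c])
qed

lemma open_form_ball:
  assumes c: "c \<in> A" and B: "inner_form B"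
  shows "open {q \<in> fst c. form_norm B (snd c q - x) < r}"
proof -
  have "continuous_on (fst c) (\<lambda>q. form_norm B (snd c q - x))"
    by (intro continuous_on_form_norm[OF E B] continuous_intros chart_continuous(1)[OF A c])
  moreover have "{q \<in> fst c. form_norm B (snd c q - x) < r} =
      fst c \<inter> (\<lambda>q. form_norm B (snd c q - x)) -` {..<r}" by auto
  ultimately show ?thesis
    using continuous_open_preimage[OF _ chart_homeomorphism(1)[OF A c], of _ "{..<r}"] by simp
qed

text \<open>A path whose speed is at least \<open>m\<close> times its speed in a fixed norm is at least \<open>m\<close> times as long as its
  chord in this norm. It is enough to look at the component of the path in the direction \<open>w\<close> of the
  chord: by Cauchy--Schwarz its derivative is at most the speed.\<close>

lemma chord_le_curve_length:
  assumes \<sigma>: "piecewise_C1_path A \<sigma>" and c: "c \<in> A" and B: "inner_form B" and m: "0 \<le> m"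
    and st: "0 \<le> s" "s \<le> t" "t \<le> 1" and inside: "\<And>u. u \<in> {s..t} \<Longrightarrow> \<sigma> u \<in> fst c"
    and bound: "\<And>u v. u \<in> {s..t} \<Longrightarrow> m * form_norm B v \<le> form_norm (chart_form A G c (\<sigma> u)) v"
  shows "ennreal (m * form_norm B (snd c (\<sigma> t) - snd c (\<sigma> s))) \<le> curve_length A G \<sigma>"
proof (cases "snd c (\<sigma> t) = snd c (\<sigma> s)")
  case True
  then show ?thesis by (simp add: form_norm_zero[OF B])
next
  case False
  define w where "w = snd c (\<sigma> t) - snd c (\<sigma> s)"
  have w: "0 < form_norm B w" using False by (intro form_norm_pos[OF B]) (simp add: w_def)
  obtain S where S: "finite S" and diff:
    "\<And>u c. u \<in> {0<..<1} - S \<Longrightarrow> c \<in> A \<Longrightarrow> \<sigma> u \<in> fst c \<Longrightarrow> (snd c \<circ> \<sigma>) differentiable (at u)"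
    by (rule piecewise_C1_path_differentiable[OF A \<sigma>]) (rule that)
  have cont: "continuous_on {0..1} \<sigma>" using \<sigma> by (simp add: piecewise_C1_path_def)
  define x' where "x' = (\<lambda>u. vector_derivative (snd c \<circ> \<sigma>) (at u))"
  define \<psi> where "\<psi> = (\<lambda>u. m * (B (snd c (\<sigma> u)) w / form_norm B w))"
  define \<psi>' where "\<psi>' = (\<lambda>u. m * (B (x' u) w / form_norm B w))"
  obtain C where C: "\<And>v. form_norm B v \<le> C * norm v" by (rule form_norm_le_norm[OF E B]) (rule that)
  have bl: "bounded_linear (\<lambda>v. B v w)"
  proof (rule bounded_linear_intro[of _ "C * form_norm B w"])
    fix v
    have "B v w \<le> form_norm B v * form_norm B w" "- B v w \<le> form_norm B v * form_norm B w"
      using form_Cauchy_Schwarz[OF B, of v w] form_Cauchy_Schwarz[OF B, of "-1 *\<^sub>R v" w]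
      unfolding form_norm_scale[OF B] form_scale[OF B] by simp_all
    then have "\<bar>B v w\<bar> \<le> form_norm B v * form_norm B w" by simp
    also have "\<dots> \<le> C * norm v * form_norm B w" using C w by (intro mult_right_mono) auto
    finally show "norm (B v w) \<le> norm v * (C * form_norm B w)" by (simp add: ac_simps)
  qed (simp_all add: form_add[OF B] form_scale[OF B])
  have der: "(snd c \<circ> \<sigma> has_vector_derivative x' u) (at u)" "isCont \<sigma> u"
    if u: "u \<in> {s<..<t} - S" for u
  proof -
    have "(snd c \<circ> \<sigma>) differentiable (at u)" using u st inside[of u] by (intro diff c) auto
    then show "(snd c \<circ> \<sigma> has_vector_derivative x' u) (at u)"
      unfolding x'_def by (simp add: vector_derivative_works)
    show "isCont \<sigma> u" using continuous_on_interior[OF cont] u st by (simp add: interior_atLeastAtMost_real)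
  qed
  have "ennreal (\<psi> t - \<psi> s) \<le> (\<integral>\<^sup>+u\<in>{s..t}. ennreal (sqrt (G (\<sigma> u) (velocity A \<sigma> u) (velocity A \<sigma> u))) \<partial>lebesgue)"
  proof (rule increment_le_nn_integral[OF st(2) _ S])
    have "continuous_on {s..t} (\<lambda>u. snd c (\<sigma> u))"
      using inside st by (intro continuous_on_compose2[OF chart_continuous(1)[OF A c]] continuous_on_subset[OF cont]) auto
    then show "continuous_on {s..t} \<psi>"
      unfolding \<psi>_def using bounded_linear.continuous_on[OF bl] w by (intro continuous_intros) auto
    fix u assume u: "u \<in> {s<..<t} - S"
    have "((\<lambda>u. B ((snd c \<circ> \<sigma>) u) w) has_vector_derivative B (x' u) w) (at u)"
      by (rule bounded_linear.has_vector_derivative[OF bl der(1)[OF u]])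
    then have "((\<lambda>u. B (snd c (\<sigma> u)) w) has_real_derivative B (x' u) w) (at u)"
      by (simp add: has_real_derivative_iff_has_vector_derivative comp_def)
    then show "(\<psi> has_real_derivative \<psi>' u) (at u)"
      unfolding \<psi>_def \<psi>'_def by (intro DERIV_cmult DERIV_cdivide)
    have "B (x' u) w / form_norm B w \<le> form_norm B (x' u)"
      using form_Cauchy_Schwarz[OF B, of "x' u" w] w by (simp add: divide_le_eq)
    then have "\<psi>' u \<le> m * form_norm B (x' u)" unfolding \<psi>'_def using m by (rule mult_left_mono)
    also have "\<dots> \<le> form_norm (chart_form A G c (\<sigma> u)) (x' u)" using u by (intro bound) auto
    also have "\<dots> = sqrt (G (\<sigma> u) (velocity A \<sigma> u) (velocity A \<sigma> u))"
      using u inside[of u] velocity_eq_coord_vector[OF A c _ der(2)[OF u] der(1)[OF u]]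
      by (simp add: form_norm_def chart_form_def)
    finally show "ennreal (\<psi>' u) \<le> ennreal (sqrt (G (\<sigma> u) (velocity A \<sigma> u) (velocity A \<sigma> u)))"
      by (rule ennreal_leI)
  qed
  also have "\<dots> \<le> curve_length A G \<sigma>"
    unfolding curve_length_def using st by (intro nn_integral_mono) (auto simp: indicator_def)
  also have "\<psi> t - \<psi> s = m * (B w w / form_norm B w)"
    unfolding \<psi>_def by (simp add: w_def form_diff[OF B] algebra_simps diff_divide_distrib)
  also have "B w w / form_norm B w = form_norm B w"
    using w form_norm_square[OF B, of w] by (simp add: power2_eq_square nonzero_divide_eq_eq)
  finally show ?thesis by (simp add: w_def)
qed

text \<open>A path which joins \<open>p\<close> to a point outside the ball of radius \<open>\<kappa>\<close> first crosses this ball, and there the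
  chord estimate applies. The ball is compact in the chart, hence closed in the Hausdorff space \<open>M\<close>, so
  that the path cannot leave the chart domain without crossing the boundary of the ball. Treating paths in both
  directions replaces a proof that the length metric is symmetric.\<close>

lemma curve_length_lower_bound:
  assumes \<sigma>: "piecewise_C1_path A \<sigma>" and c: "c \<in> A" "p \<in> fst c" and B: "inner_form B" and m: "0 \<le> m"
    and ball: "{y. form_norm B (y - snd c p) \<le> \<kappa>} \<subseteq> snd c ` fst c"
    and bound: "\<And>q v. q \<in> fst c \<Longrightarrow> form_norm B (snd c q - snd c p) \<le> \<kappa> \<Longrightarrow>
      m * form_norm B v \<le> form_norm (chart_form A G c q) v"
    and far: "\<not> (q \<in> fst c \<and> form_norm B (snd c q - snd c p) < \<kappa>)"
    and ends: "\<sigma> 0 = p \<and> \<sigma> 1 = q \<or> \<sigma> 0 = q \<and> \<sigma> 1 = p"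
  shows "ennreal (m * \<kappa>) \<le> curve_length A G \<sigma>"
proof (cases "0 < \<kappa>")
  case False
  then have "m * \<kappa> \<le> 0" using m by (simp add: mult_nonneg_nonpos)
  then show ?thesis by (simp add: ennreal_neg)
next
  case \<kappa>: True
  let ?N = "\<lambda>q. form_norm B (snd c q - snd c p)"
  define W where "W = {q \<in> fst c. ?N q < \<kappa>}"
  define K where "K = {q \<in> fst c. ?N q \<le> \<kappa>}"
  have W: "open W" unfolding W_def by (rule open_form_ball[OF c(1) B])
  have KW: "W \<subseteq> K" by (auto simp: W_def K_def)
  have "compact {y. form_norm B (y - snd c p) \<le> \<kappa>}"
  proof -
    obtain m0 where m0: "0 < m0" "\<And>v. m0 * norm v \<le> form_norm B v"
      by (rule norm_le_form_norm[OF E B]) (rule that)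
    show ?thesis
    proof (rule compact_closed_bounded[OF E])
      show "closed {y. form_norm B (y - snd c p) \<le> \<kappa>}"
        by (intro closed_Collect_le continuous_on_form_norm[OF E B] continuous_intros)
      fix y assume "y \<in> {y. form_norm B (y - snd c p) \<le> \<kappa>}"
      then have "m0 * norm (y - snd c p) \<le> \<kappa>" using m0(2)[of "y - snd c p"] by simp
      then have "norm (y - snd c p) \<le> \<kappa> / m0" using m0(1) by (simp add: pos_le_divide_eq mult.commute)
      then show "norm y \<le> norm (snd c p) + \<kappa> / m0" using norm_triangle_ineq2[of y "snd c p"] by linarith
    qed
  qed
  moreover have "K = chart_inv c ` {y. form_norm B (y - snd c p) \<le> \<kappa>}"
  proof (intro set_eqI iffI)
    fix q assume "q \<in> K"
    then show "q \<in> chart_inv c ` {y. form_norm B (y - snd c p) \<le> \<kappa>}"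
      using chart_inv_left[OF A c(1), of q] by (intro image_eqI[of _ _ "snd c q"]) (auto simp: K_def)
  next
    fix q assume "q \<in> chart_inv c ` {y. form_norm B (y - snd c p) \<le> \<kappa>}"
    then show "q \<in> K" using ball chart_inv_right[OF A c(1)] by (auto simp: K_def)
  qed
  ultimately have K: "closed K"
    using ball by (auto intro!: compact_imp_closed compact_continuous_image continuous_on_subset[OF chart_continuous(2)[OF A c(1)]])
  have pW: "p \<in> W" and qW: "q \<notin> W" using c \<kappa> far by (auto simp: W_def form_norm_zero[OF B])
  have cont: "continuous_on {0..1} \<sigma>" using \<sigma> by (simp add: piecewise_C1_path_def)
  have chord: "ennreal (m * form_norm B (snd c (\<sigma> t) - snd c (\<sigma> s))) \<le> curve_length A G \<sigma>"
    if "0 \<le> s" "s \<le> t" "t \<le> 1" "\<sigma> ` {s..t} \<subseteq> K" for s t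
    using that by (intro chord_le_curve_length[OF \<sigma> c(1) B m]) (auto simp: K_def image_subset_iff intro!: bound)
  have exit: "ennreal (m * \<kappa>) \<le> ennreal (m * form_norm B (snd c q' - snd c p))" if "q' \<in> K" "q' \<notin> W" for q'
    using that m by (intro ennreal_leI mult_left_mono) (auto simp: K_def W_def)
  from ends show ?thesis
  proof
    assume e: "\<sigma> 0 = p \<and> \<sigma> 1 = q"
    obtain T where T: "T \<in> {0..1}" "\<sigma> ` {0..T} \<subseteq> K" "\<sigma> T \<notin> W"
      using path_exits_through_boundary[OF cont W KW K] pW qW e by metis
    have "\<sigma> T \<in> K" using T by auto
    from exit[OF this T(3)] chord[of 0 T] T e show ?thesis by (auto intro: order_trans)
  next
    assume e: "\<sigma> 0 = q \<and> \<sigma> 1 = p"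
    have "continuous_on {0..1} (\<lambda>u. \<sigma> (1 - u))"
      by (intro continuous_on_compose2[OF cont] continuous_intros) auto
    from path_exits_through_boundary[OF this W KW K] pW qW e
    obtain T where T: "T \<in> {0..1}" "(\<lambda>u. \<sigma> (1 - u)) ` {0..T} \<subseteq> K" "\<sigma> (1 - T) \<notin> W"
      by (metis diff_zero diff_self)
    have "\<sigma> ` {1 - T..1} \<subseteq> K"
    proof clarify
      fix u assume "u \<in> {1 - T..1}"
      then have "\<sigma> (1 - (1 - u)) \<in> K" using T(2) by (intro subsetD[OF T(2)] image_eqI[of _ _ "1 - u"]) auto
      then show "\<sigma> u \<in> K" by simp
    qed
    moreover have "\<sigma> (1 - T) \<in> K" using T by auto
    ultimately show ?thesis
      using exit[of "\<sigma> (1 - T)"] T chord[of "1 - T" 1] e form_norm_minus[OF B, of "snd c p" "snd c (\<sigma> (1 - T))"]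
      by (auto intro: order_trans)
  qed
qed

text \<open>The straight segment in the chart is a competitor in the definition of the length metric.\<close>

lemma length_metric_le_segment:
  assumes c: "c \<in> A" "q \<in> fst c" "q' \<in> fst c"
    and segment: "\<And>u. u \<in> {0..1} \<Longrightarrow> snd c q + u *\<^sub>R (snd c q' - snd c q) \<in> snd c ` fst c"
    and bound: "\<And>u. u \<in> {0..1} \<Longrightarrow>
      form_norm (chart_form A G c (chart_inv c (snd c q + u *\<^sub>R (snd c q' - snd c q)))) (snd c q' - snd c q) \<le> L"
  shows "length_metric A G q q' \<le> ennreal L"
proof -
  define w where "w = snd c q' - snd c q"
  define x where "x = (\<lambda>u::real. snd c q + u *\<^sub>R w)"
  define \<sigma> where "\<sigma> = (\<lambda>u. chart_inv c (x u))"
  have xin: "x u \<in> snd c ` fst c" if "u \<in> {0..1}" for u using segment[OF that] by (simp add: x_def w_def)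
  have \<sigma>in: "\<sigma> u \<in> fst c" "snd c (\<sigma> u) = x u" if "u \<in> {0..1}" for u
    using chart_inv_right[OF A c(1) xin[OF that]] by (auto simp: \<sigma>_def)
  have cont: "continuous_on {0..1} \<sigma>"
    unfolding \<sigma>_def using xin
    by (intro continuous_on_compose2[OF chart_continuous(2)[OF A c(1)]]) (auto simp: x_def intro!: continuous_intros)
  have xD: "(x has_vector_derivative w) F" for F
    unfolding x_def has_vector_derivative_def by (auto intro!: derivative_eq_intros)
  have \<sigma>D: "((snd c \<circ> \<sigma>) has_vector_derivative w) (at u within {0..1})" if "u \<in> {0..1}" for u
    by (rule has_vector_derivative_transform[OF that _ xD]) (simp add: \<sigma>in)
  have "C1_curve_on A {0..1} \<sigma>"
    unfolding C1_curve_on_def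
  proof
    fix t :: real assume "t \<in> {0..1}"
    show "\<exists>(U, \<phi>)\<in>A. \<exists>D. \<exists>e>0. (\<forall>u\<in>{0..1} \<inter> ball t e. \<sigma> u \<in> U \<and> (\<phi> \<circ> \<sigma> has_vector_derivative D u) (at u within {0..1})) \<and>
        continuous_on ({0..1} \<inter> ball t e) D"
      using c(1) \<sigma>in \<sigma>D
      by (intro bexI[of _ c]) (auto simp: case_prod_beta' intro!: exI[of _ "\<lambda>_. w"] exI[of _ "1::real"])
  qed
  then have path: "piecewise_C1_path A \<sigma>"
    using cont unfolding piecewise_C1_path_def by (intro conjI exI[of _ 1] exI[of _ real]) auto
  have "\<sigma> 0 = q" "\<sigma> 1 = q'" using chart_inv_left[OF A c(1)] c by (auto simp: \<sigma>_def x_def w_def)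
  then have "length_metric A G q q' \<le> curve_length A G \<sigma>"
    unfolding length_metric_def using path by (intro INF_lower) auto
  also have "\<dots> \<le> (\<integral>\<^sup>+u. ennreal L * indicator {0..1::real} u \<partial>lebesgue)"
    unfolding curve_length_def
  proof (rule nn_integral_mono_AE)
    \<comment> \<open>At the endpoints the two-sided velocity of the segment is meaningless.\<close>
    have "AE u in lebesgue. u \<noteq> 0" "AE u in lebesgue. u \<noteq> (1::real)"
      by (auto intro!: AE_completion AE_lborel_singleton)
    then show "AE u in lebesgue. ennreal (sqrt (G (\<sigma> u) (velocity A \<sigma> u) (velocity A \<sigma> u))) * indicator {0..1} u
       \<le> ennreal L * indicator {0..1} u"
    proof eventually_elim
      case (elim u)
      show ?case
      proof (cases "u \<in> {0..1}")
        case True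
        then have int: "u \<in> interior {0..1}" using elim by (simp add: interior_atLeastAtMost_real)
        have "isCont \<sigma> u" by (rule continuous_on_interior[OF cont int])
        moreover have "((snd c \<circ> \<sigma>) has_vector_derivative w) (at u)"
          using \<sigma>D[OF True] by (simp add: at_within_interior[OF int])
        ultimately have "velocity A \<sigma> u = coord_vector A c (\<sigma> u) w"
          by (intro velocity_eq_coord_vector[of A c \<sigma> u w] A c(1) \<sigma>in(1)[OF True])
        then have "sqrt (G (\<sigma> u) (velocity A \<sigma> u) (velocity A \<sigma> u)) = form_norm (chart_form A G c (\<sigma> u)) w"
          by (simp add: form_norm_def chart_form_def)
        also have "\<dots> \<le> L" using bound[OF True] by (simp add: \<sigma>_def x_def w_def)
        finally show ?thesis by (simp add: ennreal_leI mult_right_mono)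
      qed simp
    qed
  qed
  also have "\<dots> = ennreal L" by (simp add: nn_integral_cmult_indicator)
  finally show ?thesis .
qed

text \<open>The finitely many coefficients of the metric are continuous at \<open>p\<close>, so the perturbation lemma for
  norms applies on a neighbourhood.\<close>

lemma nearly_constant_on_small_ball:
  assumes G: "continuous_riemannian_metric E A G" and c: "c \<in> A" "p \<in> fst c" and \<epsilon>: "0 < \<epsilon>" "\<epsilon> < 1"
  obtains r where "0 < r" "nearly_constant_on_ball A G c p \<epsilon> r"
proof -
  have form: "inner_form (chart_form A G c q)" if "q \<in> fst c" for q
    using G by (intro inner_form_chart_form c that) (simp add: continuous_riemannian_metric_def)
  note B = form[OF c(2)]
  let ?B = "chart_form A G c"
  obtain m where m: "0 < m" "\<And>v. m * norm v \<le> form_norm (?B p) v"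
    by (rule norm_le_form_norm[OF E B]) (rule that)
  have fin: "finite E" using E by (simp add: orthonormal_basis_def)
  define \<eta> where "\<eta> = \<epsilon> * m\<^sup>2 / (1 + real (card E) ^ 2)"
  have pos: "0 < 1 + real (card E) ^ 2" by (simp add: add_pos_nonneg)
  have \<eta>: "0 < \<eta>" using \<epsilon> m pos by (simp add: \<eta>_def)
  have "\<forall>\<^sub>F q in nhds p. \<bar>?B q i j - ?B p i j\<bar> < \<eta>" if "i \<in> E" "j \<in> E" for i j
  proof -
    have "continuous_on (fst c) (\<lambda>q. ?B q i j)"
      using G c that by (simp add: continuous_riemannian_metric_def metric_coeff_def chart_form_def)
    then have "isCont (\<lambda>q. ?B q i j) p"
      using c chart_homeomorphism(1)[OF A c(1)] by (simp add: continuous_on_eq_continuous_at)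
    then have "((\<lambda>q. ?B q i j) \<longlongrightarrow> ?B p i j) (nhds p)"
      using tendsto_at_iff_tendsto_nhds[of "\<lambda>q. ?B q i j" p] by (simp add: isCont_def)
    from tendstoD[OF this \<eta>] show ?thesis by (simp add: dist_real_def)
  qed
  then have "\<forall>\<^sub>F q in nhds p. \<forall>i\<in>E. \<forall>j\<in>E. \<bar>?B q i j - ?B p i j\<bar> < \<eta>"
    using fin by (simp add: eventually_ball_finite_distrib)
  then obtain V where V: "open V" "p \<in> V" "\<And>q i j. q \<in> V \<Longrightarrow> i \<in> E \<Longrightarrow> j \<in> E \<Longrightarrow> \<bar>?B q i j - ?B p i j\<bar> < \<eta>"
    unfolding eventually_nhds by blast
  have "open (snd c ` (V \<inter> fst c))"
    using V chart_homeomorphism(1)[OF A c(1)] by (intro open_chart_image[OF A c(1)]) auto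
  moreover have "snd c p \<in> snd c ` (V \<inter> fst c)" using V c by auto
  ultimately obtain \<rho> where \<rho>: "0 < \<rho>" "ball (snd c p) \<rho> \<subseteq> snd c ` (V \<inter> fst c)"
    by (rule openE)
  define r where "r = m * \<rho> / 2"
  have inV: "y \<in> snd c ` (V \<inter> fst c)" if "form_norm (?B p) (y - snd c p) \<le> r" for y
  proof -
    have "m * norm (y - snd c p) \<le> m * \<rho> / 2" using m(2)[of "y - snd c p"] that by (simp add: r_def)
    then have "norm (y - snd c p) \<le> \<rho> / 2" using m(1) by (simp add: field_simps)
    then show ?thesis using \<rho> by (intro subsetD[OF \<rho>(2)]) (simp add: dist_norm norm_minus_commute)
  qed
  show thesis
  proof (rule that)
    show "0 < r" using m \<rho> by (simp add: r_def)
    show "nearly_constant_on_ball A G c p \<epsilon> r"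
      unfolding nearly_constant_on_ball_def
    proof (intro conjI ballI impI allI)
      show "{y. form_norm (?B p) (y - snd c p) \<le> r} \<subseteq> snd c ` fst c" using inV by auto
      fix q v assume q: "q \<in> fst c" "form_norm (?B p) (snd c q - snd c p) \<le> r"
      obtain q' where "q' \<in> V \<inter> fst c" "snd c q = snd c q'" using inV[OF q(2)] by blast
      then have "q \<in> V" using q(1) chart_inv_left[OF A c(1)] by (metis IntD1 IntD2)
      then have "\<bar>?B q i j - ?B p i j\<bar> * (1 + real (card E) ^ 2) \<le> \<epsilon> * m\<^sup>2" if "i \<in> E" "j \<in> E" for i j
        using V(3)[of q i j] that pos by (simp add: \<eta>_def pos_less_divide_eq less_imp_le)
      from form_norm_perturbation[OF E B form[OF q(1)] m \<epsilon> this, of v]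
      show "(1 - \<epsilon>) * form_norm (?B p) v \<le> form_norm (?B q) v" "form_norm (?B q) v \<le> (1 + \<epsilon>) * form_norm (?B p) v"
        by auto
    qed
  qed
qed

context
  fixes G c p \<epsilon> r
  assumes G: "continuous_riemannian_metric E A G" and c: "c \<in> A" "p \<in> fst c" and \<epsilon>: "0 < \<epsilon>" "\<epsilon> < 1"
    and near: "nearly_constant_on_ball A G c p \<epsilon> r"
begin

private lemma form: "inner_form (chart_form A G c p)"
  using G by (intro inner_form_chart_form c) (simp add: continuous_riemannian_metric_def)

text \<open>The condition on \<open>\<kappa>\<close> says that the ball of radius \<open>\<kappa>\<close> about \<open>q\<close> lies in the ball about \<open>p\<close>. Taking for
  \<open>\<kappa>\<close> the norm distance of \<open>q\<close> and \<open>q'\<close> bounds the length metric from below near \<open>p\<close>; a smaller \<open>\<kappa>\<close>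
  covers points \<open>q'\<close> far away or outside the chart.\<close>

lemma length_metric_lower_bound:
  assumes q: "q \<in> fst c" "form_norm (chart_form A G c p) (snd c q - snd c p) + \<kappa> \<le> r"
    and far: "\<not> (q' \<in> fst c \<and> form_norm (chart_form A G c p) (snd c q' - snd c q) < \<kappa>)"
  shows "ennreal ((1 - \<epsilon>) * \<kappa>) \<le> length_metric A G q q'" "ennreal ((1 - \<epsilon>) * \<kappa>) \<le> length_metric A G q' q"
proof -
  let ?N = "form_norm (chart_form A G c p)"
  have in_ball: "?N (y - snd c p) \<le> r" if "?N (y - snd c q) \<le> \<kappa>" for y
    using form_norm_triangle[OF form, of "y - snd c q" "snd c q - snd c p"] that q(2) by simp
  have "ennreal ((1 - \<epsilon>) * \<kappa>) \<le> curve_length A G \<sigma>"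
    if "piecewise_C1_path A \<sigma>" "\<sigma> 0 = q \<and> \<sigma> 1 = q' \<or> \<sigma> 0 = q' \<and> \<sigma> 1 = q" for \<sigma>
    using near \<epsilon> in_ball
    by (intro curve_length_lower_bound[OF that(1) c(1) q(1) form _ _ _ far that(2)])
      (auto simp: nearly_constant_on_ball_def)
  then show "ennreal ((1 - \<epsilon>) * \<kappa>) \<le> length_metric A G q q'" "ennreal ((1 - \<epsilon>) * \<kappa>) \<le> length_metric A G q' q"
    unfolding length_metric_def by (auto intro!: INF_greatest)
qed

text \<open>Norm balls are convex, so the segment stays where the norms are comparable.\<close>

lemma length_metric_upper_bound:
  assumes q: "q \<in> fst c" "form_norm (chart_form A G c p) (snd c q - snd c p) \<le> r"
    and q': "q' \<in> fst c" "form_norm (chart_form A G c p) (snd c q' - snd c p) \<le> r"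
  shows "length_metric A G q q' \<le> ennreal ((1 + \<epsilon>) * form_norm (chart_form A G c p) (snd c q' - snd c q))"
proof (rule length_metric_le_segment[OF c(1) q(1) q'(1)])
  let ?N = "form_norm (chart_form A G c p)"
  fix u :: real assume u: "u \<in> {0..1}"
  let ?y = "snd c q + u *\<^sub>R (snd c q' - snd c q)"
  have "?y - snd c p = (1 - u) *\<^sub>R (snd c q - snd c p) + u *\<^sub>R (snd c q' - snd c p)"
    by (simp add: algebra_simps)
  then have "?N (?y - snd c p) \<le> (1 - u) * ?N (snd c q - snd c p) + u * ?N (snd c q' - snd c p)"
    using form_norm_triangle[OF form, of "(1 - u) *\<^sub>R (snd c q - snd c p)" "u *\<^sub>R (snd c q' - snd c p)"] u
    by (simp add: form_norm_scale[OF form])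
  also have "\<dots> \<le> (1 - u) * r + u * r" using u q(2) q'(2) by (intro add_mono mult_left_mono) auto
  finally have y: "?N (?y - snd c p) \<le> r" by (simp add: algebra_simps)
  then show *: "?y \<in> snd c ` fst c" using near by (auto simp: nearly_constant_on_ball_def)
  show "form_norm (chart_form A G c (chart_inv c ?y)) (snd c q' - snd c q) \<le> (1 + \<epsilon>) * ?N (snd c q' - snd c q)"
    using near y chart_inv_right[OF A c(1) *] by (simp add: nearly_constant_on_ball_def)
qed

end

end

section \<open>Means over shrinking intervals\<close>

lemma emeasure_closed_segment_real:
  "emeasure lborel (closed_segment t (t + \<delta>)) = ennreal \<bar>\<delta>\<bar>" for t \<delta> :: real
  by (cases "0 \<le> \<delta>") (auto simp: closed_segment_eq_real_ivl)

lemma closed_segment_borel [measurable]: "closed_segment a b \<in> sets borel" for a b :: real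
  by (simp add: closed_segment_eq_real_ivl)

text \<open>A Lipschitz function of finitely many functions inherits their common Lebesgue points. Below,
  \<open>\<phi> u\<close> is the norm of the vector with components \<open>\<rho> i u\<close>.\<close>

lemma lebesgue_point_dominated:
  fixes \<rho> :: "'i \<Rightarrow> real \<Rightarrow> real"
  assumes E: "finite E" and \<rho>: "\<And>i. i \<in> E \<Longrightarrow> \<rho> i \<in> borel_measurable borel" "\<And>i. i \<in> E \<Longrightarrow> lebesgue_point (\<rho> i) t"
    and C: "0 \<le> C" and dom: "\<And>u. \<bar>\<phi> u - \<phi> t\<bar> \<le> C * (\<Sum>i\<in>E. \<bar>\<rho> i u - \<rho> i t\<bar>)"
  shows "lebesgue_point \<phi> t"
proof -
  let ?osc = "\<lambda>f \<delta>. segment_mean (\<lambda>u. ennreal \<bar>f u - f t\<bar>) t \<delta>"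
  have "((\<lambda>\<delta>. \<Sum>i\<in>E. ennreal C * ?osc (\<rho> i) \<delta>) \<longlongrightarrow> (\<Sum>i\<in>E. ennreal C * 0)) (at 0)"
    using \<rho>(2) unfolding lebesgue_point_def by (intro tendsto_sum ennreal_tendsto_cmult) auto
  then have lim: "((\<lambda>\<delta>. \<Sum>i\<in>E. ennreal C * ?osc (\<rho> i) \<delta>) \<longlongrightarrow> 0) (at 0)" by simp
  have le: "?osc \<phi> \<delta> \<le> (\<Sum>i\<in>E. ennreal C * ?osc (\<rho> i) \<delta>)" for \<delta>
  proof -
    let ?S = "closed_segment t (t + \<delta>)"
    have m: "(\<lambda>u. ennreal \<bar>\<rho> i u - \<rho> i t\<bar> * indicator ?S u) \<in> borel_measurable lborel" if "i \<in> E" for i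
      using \<rho>(1)[OF that] closed_segment_borel by measurable
    have "(\<integral>\<^sup>+u\<in>?S. ennreal \<bar>\<phi> u - \<phi> t\<bar> \<partial>lborel)
        \<le> (\<integral>\<^sup>+u. (\<Sum>i\<in>E. ennreal C * (ennreal \<bar>\<rho> i u - \<rho> i t\<bar> * indicator ?S u)) \<partial>lborel)"
    proof (rule nn_integral_mono)
      fix u
      have "ennreal \<bar>\<phi> u - \<phi> t\<bar> \<le> ennreal (\<Sum>i\<in>E. C * \<bar>\<rho> i u - \<rho> i t\<bar>)"
        using dom[of u] by (intro ennreal_leI) (simp add: sum_distrib_left)
      also have "\<dots> = (\<Sum>i\<in>E. ennreal C * ennreal \<bar>\<rho> i u - \<rho> i t\<bar>)"
        using C by (simp add: sum_ennreal[symmetric] ennreal_mult)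
      finally show "ennreal \<bar>\<phi> u - \<phi> t\<bar> * indicator ?S u
        \<le> (\<Sum>i\<in>E. ennreal C * (ennreal \<bar>\<rho> i u - \<rho> i t\<bar> * indicator ?S u))"
        by (auto simp: indicator_def)
    qed
    also have "\<dots> = (\<Sum>i\<in>E. ennreal C * (\<integral>\<^sup>+u\<in>?S. ennreal \<bar>\<rho> i u - \<rho> i t\<bar> \<partial>lborel))"
      using m by (simp add: nn_integral_sum nn_integral_cmult)
    finally have "?osc \<phi> \<delta> \<le> (\<Sum>i\<in>E. ennreal C * (\<integral>\<^sup>+u\<in>?S. ennreal \<bar>\<rho> i u - \<rho> i t\<bar> \<partial>lborel)) / ennreal \<bar>\<delta>\<bar>"
      by (rule divide_right_mono_ennreal)
    then show ?thesis by (simp add: divide_ennreal_def sum_distrib_right mult.assoc)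
  qed
  show ?thesis
    unfolding lebesgue_point_def
    by (rule tendsto_sandwich[OF _ _ tendsto_const lim]) (auto intro!: always_eventually le)
qed

lemma lebesgue_point_mean_tendsto:
  fixes \<phi> :: "real \<Rightarrow> real"
  assumes \<phi>: "\<phi> \<in> borel_measurable borel" "\<And>u. 0 \<le> \<phi> u" and lp: "lebesgue_point \<phi> t"
  shows "((\<lambda>\<delta>. segment_mean (\<lambda>u. ennreal (\<phi> u)) t \<delta>) \<longlongrightarrow> ennreal (\<phi> t)) (at 0)"
proof -
  note [measurable] = \<phi>(1)
  let ?osc = "\<lambda>\<delta>. segment_mean (\<lambda>u. ennreal \<bar>\<phi> u - \<phi> t\<bar>) t \<delta>"
  let ?avg = "\<lambda>\<delta>. segment_mean (\<lambda>u. ennreal (\<phi> u)) t \<delta>"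
  have lim: "(?osc \<longlongrightarrow> 0) (at 0)" using lp by (simp add: lebesgue_point_def)
  have split: "segment_mean f t \<delta> \<le>
      segment_mean g t \<delta> + segment_mean h t \<delta>"
    if [measurable]: "g \<in> borel_measurable borel" "h \<in> borel_measurable borel" and le: "\<And>u. f u \<le> g u + h u" for f g h \<delta>
  proof -
    have "(\<integral>\<^sup>+u\<in>closed_segment t (t + \<delta>). f u \<partial>lborel) \<le>
       (\<integral>\<^sup>+u. g u * indicator (closed_segment t (t + \<delta>)) u + h u * indicator (closed_segment t (t + \<delta>)) u \<partial>lborel)"
      using le by (intro nn_integral_mono) (auto simp: indicator_def)
    also have "\<dots> = (\<integral>\<^sup>+u\<in>closed_segment t (t + \<delta>). g u \<partial>lborel) + (\<integral>\<^sup>+u\<in>closed_segment t (t + \<delta>). h u \<partial>lborel)"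
      by (rule nn_integral_add) measurable
    finally show ?thesis
      using divide_right_mono_ennreal by (simp add: add_divide_distrib_ennreal[symmetric])
  qed
  have const: "segment_mean (\<lambda>u. ennreal K) t \<delta> = ennreal K" if "\<delta> \<noteq> 0" "0 \<le> K" for K \<delta>
  proof -
    have "(\<integral>\<^sup>+u\<in>closed_segment t (t + \<delta>). ennreal K \<partial>lborel) = ennreal (K * \<bar>\<delta>\<bar>)"
      using that by (simp add: nn_integral_cmult_indicator emeasure_closed_segment_real ennreal_mult)
    then show ?thesis using that by (simp add: divide_ennreal)
  qed
  have ev: "\<forall>\<^sub>F \<delta> in at (0::real). \<delta> \<noteq> 0" by (simp add: eventually_at_filter)
  have up: "((\<lambda>\<delta>. ennreal (\<phi> t) + ?osc \<delta>) \<longlongrightarrow> ennreal (\<phi> t)) (at 0)"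
    using tendsto_add[OF tendsto_const lim, of "ennreal (\<phi> t)"] by simp
  have low: "((\<lambda>\<delta>. ennreal (\<phi> t) - ?osc \<delta>) \<longlongrightarrow> ennreal (\<phi> t)) (at 0)"
    using tendsto_diff_ennreal[OF tendsto_const lim, of "ennreal (\<phi> t)"] by simp
  show ?thesis
  proof (rule tendsto_sandwich[OF _ _ low up])
    show "\<forall>\<^sub>F \<delta> in at 0. ennreal (\<phi> t) - ?osc \<delta> \<le> ?avg \<delta>"
      using ev
    proof eventually_elim
      case (elim \<delta>)
      have "segment_mean (\<lambda>u. ennreal (\<phi> t)) t \<delta> \<le> ?osc \<delta> + ?avg \<delta>"
        by (rule split) (auto simp flip: ennreal_plus intro!: ennreal_leI simp: \<phi>(2))
      then have "ennreal (\<phi> t) \<le> ?osc \<delta> + ?avg \<delta>" by (simp only: const[OF elim \<phi>(2)])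
      then show ?case by (simp add: ennreal_minus_le_iff)
    qed
    show "\<forall>\<^sub>F \<delta> in at 0. ?avg \<delta> \<le> ennreal (\<phi> t) + ?osc \<delta>"
      using ev
    proof eventually_elim
      case (elim \<delta>)
      have "?avg \<delta> \<le> segment_mean (\<lambda>u. ennreal (\<phi> t)) t \<delta> + ?osc \<delta>"
        by (rule split) (auto simp flip: ennreal_plus intro!: ennreal_leI simp: \<phi>(2))
      then show ?case by (simp only: const[OF elim \<phi>(2)])
    qed
  qed
qed

text \<open>Both the metric speed and the means of it are known up to factors \<open>1 \<plusminus> \<epsilon>\<close>, with \<open>\<epsilon>\<close> arbitrary but on a
  neighbourhood which depends on \<open>\<epsilon>\<close>.\<close>

lemma tendsto_ennreal_relative_squeeze:
  fixes f y :: "'b \<Rightarrow> ennreal"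
  assumes y: "(y \<longlongrightarrow> ennreal L) F" and L: "0 \<le> L"
    and squeeze: "\<And>\<epsilon>. 0 < \<epsilon> \<Longrightarrow> \<epsilon> < 1 \<Longrightarrow>
      \<forall>\<^sub>F w in F. ennreal (1 - \<epsilon>) * y w \<le> f w \<and> f w \<le> ennreal (1 + \<epsilon>) * y w"
  shows "(f \<longlongrightarrow> ennreal L) F"
proof (rule order_tendstoI)
  fix z assume z: "z < ennreal L"
  then obtain r where r: "z = ennreal r" "0 \<le> r" by (cases z) auto
  have rL: "r < L" using z r by (simp add: ennreal_less_iff)
  define \<epsilon> where "\<epsilon> = (L - r) / (2 * L)"
  have L0: "0 < L" using r rL by simp
  have \<epsilon>: "0 < \<epsilon>" "\<epsilon> < 1" using rL L0 r(2) by (auto simp: \<epsilon>_def field_simps)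
  have eL: "(1 - \<epsilon>) * L = (L + r) / 2" using L0 by (simp add: \<epsilon>_def field_simps)
  have "((\<lambda>w. ennreal (1 - \<epsilon>) * y w) \<longlongrightarrow> ennreal (1 - \<epsilon>) * ennreal L) F"
    by (intro ennreal_tendsto_cmult y) simp
  moreover have "z < ennreal (1 - \<epsilon>) * ennreal L"
    using \<epsilon> r rL L eL by (simp add: ennreal_mult[symmetric] ennreal_less_iff)
  ultimately have "\<forall>\<^sub>F w in F. z < ennreal (1 - \<epsilon>) * y w" by (rule order_tendstoD)
  with squeeze[OF \<epsilon>] show "\<forall>\<^sub>F w in F. z < f w"
    by eventually_elim (auto intro: order.strict_trans2)
next
  fix z assume z: "ennreal L < z"
  obtain r where r: "L < r" "ennreal r \<le> z"
  proof (cases z)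
    case (real r)
    then show ?thesis using z L that[of r] by (simp add: ennreal_less_iff)
  next
    case top
    then show ?thesis using that[of "L + 1"] by simp
  qed
  define \<epsilon> where "\<epsilon> = min (1 / 2) ((r - L) / (2 * (L + 1)))"
  have \<epsilon>: "0 < \<epsilon>" "\<epsilon> < 1" using r L by (auto simp: \<epsilon>_def)
  have "\<epsilon> * L \<le> (r - L) / (2 * (L + 1)) * L" using L by (intro mult_right_mono) (auto simp: \<epsilon>_def)
  also have "\<dots> \<le> (r - L) / (2 * (L + 1)) * (L + 1)" using L r by (intro mult_left_mono) auto
  also have "\<dots> = (r - L) / 2" using L by (simp add: field_simps)
  finally have eL: "(1 + \<epsilon>) * L < r" using r by (simp add: algebra_simps)
  have "((\<lambda>w. ennreal (1 + \<epsilon>) * y w) \<longlongrightarrow> ennreal (1 + \<epsilon>) * ennreal L) F"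
    by (intro ennreal_tendsto_cmult y) simp
  moreover have "ennreal (1 + \<epsilon>) * ennreal L < ennreal r"
    using \<epsilon> L eL by (simp add: ennreal_mult[symmetric] ennreal_less_iff del: ennreal_plus)
  ultimately have "\<forall>\<^sub>F w in F. ennreal (1 + \<epsilon>) * y w < ennreal r" by (rule order_tendstoD)
  with squeeze[OF \<epsilon>] show "\<forall>\<^sub>F w in F. f w < z"
    by eventually_elim (use r(2) in \<open>auto intro: order.strict_trans1 order.strict_trans2\<close>)
qed

text \<open>By compactness, statements in charts suffice. The endpoints form a null set and are excluded, because
  a curve on the interval says nothing about two-sided derivatives there.\<close>

lemma AE_closed_interval_local:
  fixes a b :: real
  assumes local: "\<And>t0. t0 \<in> {a..b} \<Longrightarrow> a < b \<Longrightarrow> \<exists>\<eta>>0. AE t in lebesgue. t \<in> {a<..<b} \<and> \<bar>t - t0\<bar> < \<eta> \<longrightarrow> P t"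
  shows "AE t in lebesgue. t \<in> {a..b} \<longrightarrow> P t"
proof -
  have ends: "AE t in lebesgue. t \<noteq> a" "AE t in lebesgue. t \<noteq> b"
    by (auto intro!: AE_completion AE_lborel_singleton)
  have "AE t in lebesgue. t \<in> {a<..<b} \<longrightarrow> P t"
  proof (cases "a < b")
    case True
    then obtain \<eta> where \<eta>: "\<And>t0. t0 \<in> {a..b} \<Longrightarrow> 0 < \<eta> t0"
      "\<And>t0. t0 \<in> {a..b} \<Longrightarrow> AE t in lebesgue. t \<in> {a<..<b} \<and> \<bar>t - t0\<bar> < \<eta> t0 \<longrightarrow> P t"
      using local by metis
    have "{a..b} \<subseteq> (\<Union>t0\<in>{a..b}. ball t0 (\<eta> t0))" using \<eta>(1) by force
    then obtain T where T: "T \<subseteq> {a..b}" "finite T" "{a..b} \<subseteq> (\<Union>t0\<in>T. ball t0 (\<eta> t0))"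
      using compactE_image[OF compact_Icc, of "{a..b}" "\<lambda>t0. ball t0 (\<eta> t0)"] by (metis open_ball)
    have "AE t in lebesgue. \<forall>t0\<in>T. t \<in> {a<..<b} \<and> \<bar>t - t0\<bar> < \<eta> t0 \<longrightarrow> P t"
      using T \<eta>(2) by (intro AE_finite_allI) auto
    then show ?thesis
    proof eventually_elim
      case (elim t)
      show ?case
      proof
        assume t: "t \<in> {a<..<b}"
        then have "t \<in> {a..b}" by simp
        then obtain t0 where "t0 \<in> T" "t \<in> ball t0 (\<eta> t0)" using T(3) by blast
        then show "P t" using elim t by (auto simp: dist_real_def abs_minus_commute)
      qed
    qed
  qed auto
  with ends show ?thesis by eventually_elim auto
qed

section \<open>Absolutely continuous curves in a chart\<close>

context
  fixes E :: "'e::real_inner set"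
    and A :: "('a::{t2_space,second_countable_topology}, 'e) chart set"
  assumes E: "orthonormal_basis E" and A: "smooth_atlas A"
begin

lemma inner_form_chart_form_metric:
  assumes "continuous_riemannian_metric E A G" "c \<in> A" "p \<in> fst c"
  shows "inner_form (chart_form A G c p)"
  using assms by (intro inner_form_chart_form[OF E A]) (auto simp: continuous_riemannian_metric_def)

lemma form_ball_subset_open:
  assumes c: "c \<in> A" "p \<in> fst c" and B: "inner_form B" and V: "open V" "p \<in> V"
  obtains \<kappa> where "0 < \<kappa>" "\<And>q. q \<in> fst c \<Longrightarrow> form_norm B (snd c q - snd c p) < \<kappa> \<Longrightarrow> q \<in> V"
proof -
  obtain m where m: "0 < m" "\<And>v. m * norm v \<le> form_norm B v"
    by (rule norm_le_form_norm[OF E B]) (rule that)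
  have "open (snd c ` (V \<inter> fst c))"
    using V chart_homeomorphism(1)[OF A c(1)] by (intro open_chart_image[OF A c(1)]) auto
  moreover have "snd c p \<in> snd c ` (V \<inter> fst c)" using V c by auto
  ultimately obtain \<rho> where \<rho>: "0 < \<rho>" "ball (snd c p) \<rho> \<subseteq> snd c ` (V \<inter> fst c)" by (rule openE)
  show thesis
  proof (rule that)
    show "0 < m * \<rho>" using m \<rho> by simp
    fix q assume q: "q \<in> fst c" "form_norm B (snd c q - snd c p) < m * \<rho>"
    have "m * norm (snd c q - snd c p) < m * \<rho>" using m(2)[of "snd c q - snd c p"] q by simp
    then have "norm (snd c q - snd c p) < \<rho>" using m(1) by simp
    then have "snd c q \<in> snd c ` (V \<inter> fst c)" using \<rho>(2) by (auto simp: dist_norm norm_minus_commute)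
    then obtain q' where "q' \<in> V \<inter> fst c" "snd c q = snd c q'" by blast
    then show "q \<in> V" using q(1) chart_inv_left[OF A c(1)] by (metis IntD1 IntD2)
  qed
qed

text \<open>Small \<open>d\<close>-distance implies closeness in the topology of \<open>M\<close>: leaving a small norm ball about \<open>\<beta> t0\<close>
  costs a definite length.\<close>

lemma abs_continuous_curve_continuous:
  assumes G: "continuous_riemannian_metric E A G" and \<beta>: "abs_continuous_on (length_metric A G) a b \<beta>"
    and t0: "t0 \<in> {a..b}" and V: "open V" "\<beta> t0 \<in> V"
  obtains \<eta> where "0 < \<eta>" "\<And>t. t \<in> {a..b} \<Longrightarrow> \<bar>t - t0\<bar> < \<eta> \<Longrightarrow> \<beta> t \<in> V"
proof -
  obtain c where c: "c \<in> A" "\<beta> t0 \<in> fst c" using chart_exists[OF A] by blast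
  let ?N = "form_norm (chart_form A G c (\<beta> t0))"
  note B = inner_form_chart_form_metric[OF G c]
  obtain r where r: "0 < r" "nearly_constant_on_ball A G c (\<beta> t0) (1/2) r"
    by (rule nearly_constant_on_small_ball[OF E A G c, of "1/2"]) (auto intro: that)
  obtain \<kappa>' where \<kappa>': "0 < \<kappa>'" "\<And>q. q \<in> fst c \<Longrightarrow> ?N (snd c q - snd c (\<beta> t0)) < \<kappa>' \<Longrightarrow> q \<in> V"
    by (rule form_ball_subset_open[OF c B V]) (rule that)
  define \<kappa> where "\<kappa> = min r \<kappa>'"
  have \<kappa>: "0 < \<kappa> / 2" "\<kappa> \<le> r" "\<kappa> \<le> \<kappa>'" using r \<kappa>' by (auto simp: \<kappa>_def)
  obtain \<delta> where \<delta>: "0 < \<delta>" "\<forall>(n::nat) (l::nat \<Rightarrow> real) r.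
     (\<forall>k<n. a \<le> l k \<and> l k \<le> r k \<and> r k \<le> b) \<and>
     (\<forall>j<n. \<forall>k<n. j \<noteq> k \<longrightarrow> {l j<..<r j} \<inter> {l k<..<r k} = {}) \<and>
     (\<Sum>k<n. r k - l k) < \<delta> \<longrightarrow> (\<Sum>k<n. length_metric A G (\<beta> (l k)) (\<beta> (r k))) < ennreal (\<kappa> / 2)"
    using \<beta> \<kappa>(1) unfolding abs_continuous_on_def by blast
  have small: "length_metric A G (\<beta> s) (\<beta> t) < ennreal (\<kappa> / 2)" if "a \<le> s" "s \<le> t" "t \<le> b" "t - s < \<delta>" for s t
    using \<delta>(2)[rule_format, of 1 "\<lambda>_. s" "\<lambda>_. t"] that by simp
  show thesis
  proof (rule that[OF \<delta>(1)])
    fix t assume t: "t \<in> {a..b}" "\<bar>t - t0\<bar> < \<delta>"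
    have d: "length_metric A G (\<beta> t0) (\<beta> t) < ennreal (\<kappa> / 2) \<or> length_metric A G (\<beta> t) (\<beta> t0) < ennreal (\<kappa> / 2)"
      using small[of t0 t] small[of t t0] t t0 by (cases "t0 \<le> t") auto
    have "\<beta> t \<in> fst c \<and> ?N (snd c (\<beta> t) - snd c (\<beta> t0)) < \<kappa>"
    proof (rule ccontr)
      assume far: "\<not> ?thesis"
      have "?N (snd c (\<beta> t0) - snd c (\<beta> t0)) + \<kappa> \<le> r" using \<kappa> by (simp add: form_norm_zero[OF B])
      from length_metric_lower_bound[OF E A G c _ _ r(2) c(2) this far] d
      show False by (auto simp: not_le[symmetric])
    qed
    then show "\<beta> t \<in> V" using \<kappa>' \<kappa> by auto
  qed
qed

lemma abs_continuous_curve_isCont: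
  assumes G: "continuous_riemannian_metric E A G" and \<beta>: "abs_continuous_on (length_metric A G) a b \<beta>"
    and t0: "t0 \<in> {a<..<b}"
  shows "isCont \<beta> t0"
  unfolding isCont_def
proof (rule topological_tendstoI)
  fix V assume V: "open V" "\<beta> t0 \<in> V"
  obtain \<eta> where \<eta>: "0 < \<eta>" "\<And>t. t \<in> {a..b} \<Longrightarrow> \<bar>t - t0\<bar> < \<eta> \<Longrightarrow> \<beta> t \<in> V"
    by (rule abs_continuous_curve_continuous[OF G \<beta> _ V]) (use t0 in \<open>auto intro: that\<close>)
  show "\<forall>\<^sub>F t in at t0. \<beta> t \<in> V"
    unfolding eventually_at using \<eta> t0
    by (intro exI[of _ "min \<eta> (min (t0 - a) (b - t0))"]) (auto simp: dist_real_def intro!: \<eta>(2))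
qed

text \<open>On a short interval the curve stays where the coordinate distance is at most a constant times the
  length metric. The interval is cut off at \<open>a\<close> and \<open>b\<close>, so that \<open>t0\<close> may be an endpoint.\<close>

lemma abs_continuous_coordinates:
  assumes G: "continuous_riemannian_metric E A G" and \<beta>: "abs_continuous_on (length_metric A G) a b \<beta>"
    and t0: "t0 \<in> {a..b}" and c: "c \<in> A" "\<beta> t0 \<in> fst c"
  obtains \<eta> where "0 < \<eta>" "\<And>t. t \<in> {max a (t0 - \<eta>)..min b (t0 + \<eta>)} \<Longrightarrow> \<beta> t \<in> fst c"
    "\<And>u. u \<in> E \<Longrightarrow> abs_cont (max a (t0 - \<eta>)) (min b (t0 + \<eta>)) (\<lambda>t. inner (snd c (\<beta> t)) u)"
proof -
  let ?N = "form_norm (chart_form A G c (\<beta> t0))"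
  note B = inner_form_chart_form_metric[OF G c]
  obtain m where m: "0 < m" "\<And>v. m * norm v \<le> ?N v"
    by (rule norm_le_form_norm[OF E B]) (rule that)
  obtain r where r: "0 < r" "nearly_constant_on_ball A G c (\<beta> t0) (1/2) r"
    by (rule nearly_constant_on_small_ball[OF E A G c, of "1/2"]) (auto intro: that)
  \<comment> \<open>Two points of \<open>V\<close> have norm distance \<open>\<kappa> < r / 2\<close>, so the ball of radius \<open>\<kappa>\<close> about each of them
    lies in the ball of radius \<open>r\<close>.\<close>
  define V where "V = {q \<in> fst c. ?N (snd c q - snd c (\<beta> t0)) < r / 4}"
  have V: "open V" unfolding V_def by (rule open_form_ball[OF E A c(1) B])
  have V0: "\<beta> t0 \<in> V" using c r by (simp add: V_def form_norm_zero[OF B])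
  obtain \<eta> where \<eta>: "0 < \<eta>" "\<And>t. t \<in> {a..b} \<Longrightarrow> \<bar>t - t0\<bar> < \<eta> \<Longrightarrow> \<beta> t \<in> V"
    by (rule abs_continuous_curve_continuous[OF G \<beta> t0 V V0]) (rule that)
  let ?lo = "max a (t0 - \<eta> / 2)" and ?hi = "min b (t0 + \<eta> / 2)"
  have inV: "\<beta> t \<in> V" if "t \<in> {?lo..?hi}" for t
    using that \<eta>(1) by (intro \<eta>(2)) (auto simp: abs_less_iff)
  show thesis
  proof (rule that)
    show "0 < \<eta> / 2" using \<eta> by simp
    show "\<beta> t \<in> fst c" if "t \<in> {?lo..?hi}" for t using inV[OF that] by (simp add: V_def)
    fix u assume u: "u \<in> E"
    show "abs_cont ?lo ?hi (\<lambda>t. inner (snd c (\<beta> t)) u)"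
    proof (rule abs_cont_dominated[OF \<beta>])
      show "0 < 2 / m" using m by simp
      fix s t assume st: "?lo \<le> s" "s \<le> t" "t \<le> ?hi"
      have s: "\<beta> s \<in> fst c" "?N (snd c (\<beta> s) - snd c (\<beta> t0)) < r / 4"
        and t: "\<beta> t \<in> fst c" "?N (snd c (\<beta> t) - snd c (\<beta> t0)) < r / 4"
        using inV[of s] inV[of t] st unfolding V_def by auto
      define \<kappa> where "\<kappa> = ?N (snd c (\<beta> t) - snd c (\<beta> s))"
      have "\<kappa> \<le> ?N (snd c (\<beta> t) - snd c (\<beta> t0)) + ?N (snd c (\<beta> t0) - snd c (\<beta> s))"
        using form_norm_triangle[OF B, of "snd c (\<beta> t) - snd c (\<beta> t0)" "snd c (\<beta> t0) - snd c (\<beta> s)"]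
        by (simp add: \<kappa>_def)
      then have k: "?N (snd c (\<beta> s) - snd c (\<beta> t0)) + \<kappa> \<le> r"
        using s t form_norm_minus[OF B, of "snd c (\<beta> t0)" "snd c (\<beta> s)"] r(1) by linarith
      have le: "ennreal ((1 - 1/2) * \<kappa>) \<le> length_metric A G (\<beta> s) (\<beta> t)"
        by (rule length_metric_lower_bound(1)[OF E A G c _ _ r(2) s(1) k]) (auto simp: \<kappa>_def)
      have "\<bar>inner (snd c (\<beta> t)) u - inner (snd c (\<beta> s)) u\<bar> \<le> 2 / m * ((1 - 1/2) * \<kappa>)"
      proof -
        have "\<bar>inner (snd c (\<beta> t)) u - inner (snd c (\<beta> s)) u\<bar> \<le> norm (snd c (\<beta> t) - snd c (\<beta> s))"
          using abs_inner_basis_le_norm[OF E u, of "snd c (\<beta> t) - snd c (\<beta> s)"] by (simp add: inner_diff_left)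
        also have "\<dots> \<le> \<kappa> / m"
          using m(2)[of "snd c (\<beta> t) - snd c (\<beta> s)"] m(1) by (simp add: \<kappa>_def field_simps)
        finally show ?thesis by simp
      qed
      moreover have "0 \<le> \<kappa>" by (simp add: \<kappa>_def form_norm_nonneg[OF B])
      ultimately have "ennreal \<bar>inner (snd c (\<beta> t)) u - inner (snd c (\<beta> s)) u\<bar>
          \<le> ennreal (2 / m) * ennreal ((1 - 1/2) * \<kappa>)"
        using m(1) by (subst ennreal_mult[symmetric]) (auto intro: ennreal_leI)
      also have "\<dots> \<le> ennreal (2 / m) * length_metric A G (\<beta> s) (\<beta> t)"
        using le by (intro mult_left_mono) auto
      finally show "ennreal \<bar>inner (snd c (\<beta> t)) u - inner (snd c (\<beta> s)) u\<bar>
          \<le> ennreal (2 / m) * length_metric A G (\<beta> s) (\<beta> t)" .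
    qed auto
  qed
qed

text \<open>The length metric is asymptotic to the constant norm at \<open>\<beta> u\<close>, and the difference quotient in that
  norm converges to the norm of the derivative. No exceptional set occurs here apart from the points
  at which \<open>\<beta>\<close> is not differentiable.\<close>

lemma metric_speed_eq_form_norm:
  assumes G: "continuous_riemannian_metric E A G" and c: "c \<in> A" "\<beta> u \<in> fst c" and u: "u \<in> {a<..<b}"
    and cont: "isCont \<beta> u" and D: "((snd c \<circ> \<beta>) has_vector_derivative x') (at u)"
  shows "metric_speed (length_metric A G) a b \<beta> u = ennreal (form_norm (chart_form A G c (\<beta> u)) x')"
proof -
  let ?N = "form_norm (chart_form A G c (\<beta> u))"
  note B = inner_form_chart_form_metric[OF G c]
  let ?x = "\<lambda>w. snd c (\<beta> w)"
  have at: "at u within {a..b} = at u"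
    using u by (intro at_within_interior) (simp add: interior_atLeastAtMost_real)
  have "((\<lambda>w. (1 / norm (w - u)) *\<^sub>R (?x w - (?x u + (w - u) *\<^sub>R x'))) \<longlongrightarrow> 0) (at u)"
    using D unfolding has_vector_derivative_def has_derivative_within by (simp add: comp_def)
  from tendsto_norm_zero[OF this]
  have "((\<lambda>w. norm ((?x w - ?x u) /\<^sub>R (w - u) - x')) \<longlongrightarrow> 0) (at u)"
  proof (rule Lim_transform_eventually)
    have "norm ((1 / norm (w - u)) *\<^sub>R (?x w - (?x u + (w - u) *\<^sub>R x'))) = norm ((?x w - ?x u) /\<^sub>R (w - u) - x')"
      if "w \<noteq> u" for w
    proof -
      have "(?x w - ?x u) /\<^sub>R (w - u) - x' = inverse (w - u) *\<^sub>R (?x w - (?x u + (w - u) *\<^sub>R x'))"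
      proof -
        have "inverse (w - u) *\<^sub>R (?x w - (?x u + (w - u) *\<^sub>R x')) =
            inverse (w - u) *\<^sub>R (?x w - ?x u) - (inverse (w - u) * (w - u)) *\<^sub>R x'"
          by (simp only: diff_diff_eq[symmetric] scaleR_right_diff_distrib scaleR_scaleR)
        then show ?thesis using that by simp
      qed
      then show ?thesis by (simp add: divide_inverse abs_inverse)
    qed
    then show "\<forall>\<^sub>F w in at u. norm ((1 / norm (w - u)) *\<^sub>R (?x w - (?x u + (w - u) *\<^sub>R x')))
        = norm ((?x w - ?x u) /\<^sub>R (w - u) - x')"
      by (auto simp: eventually_at_filter)
  qed
  then have "((\<lambda>w. (?x w - ?x u) /\<^sub>R (w - u)) \<longlongrightarrow> x') (at u)"
    by (simp add: tendsto_norm_zero_iff LIM_zero_iff)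
  then have "((\<lambda>w. ?N ((?x w - ?x u) /\<^sub>R (w - u))) \<longlongrightarrow> ?N x') (at u)"
    by (rule isCont_tendsto_compose[OF isCont_form_norm[OF E B]])
  then have y: "((\<lambda>w. ennreal (?N (?x w - ?x u)) / ennreal \<bar>w - u\<bar>) \<longlongrightarrow> ennreal (?N x')) (at u)"
  proof (rule Lim_transform_eventually[OF tendsto_ennrealI])
    show "\<forall>\<^sub>F w in at u. ennreal (?N ((?x w - ?x u) /\<^sub>R (w - u))) = ennreal (?N (?x w - ?x u)) / ennreal \<bar>w - u\<bar>"
      unfolding eventually_at_filter
      by (intro always_eventually) (simp add: form_norm_scale[OF B] divide_ennreal form_norm_nonneg[OF B] divide_inverse mult.commute abs_inverse)
  qed
  have "((\<lambda>w. length_metric A G (\<beta> w) (\<beta> u) / ennreal \<bar>w - u\<bar>) \<longlongrightarrow> ennreal (?N x')) (at u)"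
  proof (rule tendsto_ennreal_relative_squeeze[OF y form_norm_nonneg[OF B]])
    fix \<epsilon> :: real assume \<epsilon>: "0 < \<epsilon>" "\<epsilon> < 1"
    obtain r where r: "0 < r" "nearly_constant_on_ball A G c (\<beta> u) \<epsilon> r"
      by (rule nearly_constant_on_small_ball[OF E A G c \<epsilon>]) (rule that)
    have zero: "?N (?x u - ?x u) = 0" by (simp add: form_norm_zero[OF B])
    define V where "V = {q \<in> fst c. ?N (snd c q - snd c (\<beta> u)) < r}"
    have V: "open V" unfolding V_def by (rule open_form_ball[OF E A c(1) B])
    have "\<beta> u \<in> V" using c r zero by (simp add: V_def)
    then have "\<forall>\<^sub>F w in at u. \<beta> w \<in> V" using cont V unfolding isCont_def by (auto dest: topological_tendstoD)
    then show "\<forall>\<^sub>F w in at u. ennreal (1 - \<epsilon>) * (ennreal (?N (?x w - ?x u)) / ennreal \<bar>w - u\<bar>)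
         \<le> length_metric A G (\<beta> w) (\<beta> u) / ennreal \<bar>w - u\<bar> \<and>
        length_metric A G (\<beta> w) (\<beta> u) / ennreal \<bar>w - u\<bar> \<le> ennreal (1 + \<epsilon>) * (ennreal (?N (?x w - ?x u)) / ennreal \<bar>w - u\<bar>)"
    proof eventually_elim
      case (elim w)
      then have w: "\<beta> w \<in> fst c" "?N (?x w - ?x u) < r" by (auto simp: V_def)
      have "ennreal ((1 - \<epsilon>) * ?N (?x w - ?x u)) \<le> length_metric A G (\<beta> w) (\<beta> u)"
        using w zero by (intro length_metric_lower_bound(2)[OF E A G c \<epsilon> r(2) c(2)]) auto
      moreover have "length_metric A G (\<beta> w) (\<beta> u) \<le> ennreal ((1 + \<epsilon>) * ?N (?x u - ?x w))"
        using w zero r(1) by (intro length_metric_upper_bound[OF E A G c \<epsilon> r(2)] c) auto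
      ultimately have "ennreal (1 - \<epsilon>) * ennreal (?N (?x w - ?x u)) \<le> length_metric A G (\<beta> w) (\<beta> u)"
        "length_metric A G (\<beta> w) (\<beta> u) \<le> ennreal (1 + \<epsilon>) * ennreal (?N (?x w - ?x u))"
        using \<epsilon> form_norm_minus[OF B, of "?x u" "?x w"] by (simp_all add: ennreal_mult form_norm_nonneg[OF B])
      then show ?case
        using divide_right_mono_ennreal by (simp add: divide_ennreal_def mult.assoc[symmetric] mult_right_mono)
    qed
  qed
  then show ?thesis
    unfolding metric_speed_def at by (intro tendsto_Lim) auto
qed

end

section \<open>The generalized metric speed\<close>

context
  fixes E :: "'e::real_inner set"
    and A :: "('a::{t2_space,second_countable_topology}, 'e) chart set"
  assumes E: "orthonormal_basis E" and A: "smooth_atlas A"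
begin

text \<open>The condition on \<open>t\<close> involves only the coordinate densities \<open>\<rho>\<close> of the curve and not the metric
  \<open>g s\<close>. Near \<open>t\<close> the metric speed is, up to factors \<open>1 \<plusminus> \<epsilon>\<close>, the norm at \<open>\<beta> t\<close> of the velocity \<open>x'\<close>; this
  norm has a Lebesgue point at \<open>t\<close>.\<close>

lemma gen_metric_speed_eq_form_norm:
  fixes \<rho> :: "'e \<Rightarrow> real \<Rightarrow> real"
  defines "x' \<equiv> \<lambda>u. \<Sum>i\<in>E. \<rho> i u *\<^sub>R i"
  assumes G: "continuous_riemannian_metric E A (g s)" and c: "c \<in> A"
    and J: "a \<le> lo" "hi \<le> b" "t \<in> {lo<..<hi}"
    and inside: "\<And>u. u \<in> {lo<..<hi} \<Longrightarrow> \<beta> u \<in> fst c" and cont: "\<And>u. u \<in> {lo<..<hi} \<Longrightarrow> isCont \<beta> u"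
    and D: "AE u in lebesgue. u \<in> {lo<..<hi} \<longrightarrow> ((snd c \<circ> \<beta>) has_vector_derivative x' u) (at u)"
    and \<rho>: "\<And>i. i \<in> E \<Longrightarrow> \<rho> i \<in> borel_measurable borel" "\<And>i. i \<in> E \<Longrightarrow> lebesgue_point (\<rho> i) t"
  shows "gen_metric_speed A g a b \<beta> s t = ennreal (form_norm (chart_form A (g s) c (\<beta> t)) (x' t))"
proof -
  let ?N = "form_norm (chart_form A (g s) c (\<beta> t))"
  let ?v = "metric_speed (length_metric A (g s)) a b \<beta>"
  have ct: "\<beta> t \<in> fst c" using inside J by simp
  note B = inner_form_chart_form_metric[OF E A G c]
  have fin: "finite E" using E by (simp add: orthonormal_basis_def)
  have comp: "inner (x' u) i = \<rho> i u" if "i \<in> E" for i u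
  proof -
    have "inner (x' u) i = (\<Sum>j\<in>E. \<rho> j u * (if j = i then 1 else 0))"
      using E that by (simp add: x'_def inner_sum_left orthonormal_basis_def)
    then show ?thesis using fin that by (simp add: if_distrib[of "(*) _"] cong: if_cong)
  qed
  obtain C where C: "0 < C" "\<And>v. ?N v \<le> C * (\<Sum>i\<in>E. \<bar>inner v i\<bar>)"
    by (rule form_norm_le_norm[OF E B[OF ct]]) (rule that)
  have Nm: "(\<lambda>u. ?N (x' u)) \<in> borel_measurable borel"
    using \<rho>(1) unfolding form_norm_def form_expansion[OF E B[OF ct]]
    by (intro measurable_compose[OF _ borel_measurable_sqrt] borel_measurable_sum borel_measurable_times) (simp_all add: comp)
  have lp: "lebesgue_point (\<lambda>u. ?N (x' u)) t"
  proof (rule lebesgue_point_dominated[OF fin \<rho>])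
    show "0 \<le> C" using C by simp
    fix u
    have "\<bar>?N (x' u) - ?N (x' t)\<bar> \<le> ?N (x' u - x' t)" by (rule form_norm_triangle_abs[OF B[OF ct]])
    also have "\<dots> \<le> C * (\<Sum>i\<in>E. \<bar>inner (x' u - x' t) i\<bar>)" by (rule C(2))
    also have "\<dots> = C * (\<Sum>i\<in>E. \<bar>\<rho> i u - \<rho> i t\<bar>)" by (simp add: inner_diff_left comp)
    finally show "\<bar>?N (x' u) - ?N (x' t)\<bar> \<le> C * (\<Sum>i\<in>E. \<bar>\<rho> i u - \<rho> i t\<bar>)" .
  qed
  have speed: "AE u in lebesgue. u \<in> {lo<..<hi} \<longrightarrow> ?v u = ennreal (form_norm (chart_form A (g s) c (\<beta> u)) (x' u))"
    using D
  proof eventually_elim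
    case (elim u)
    show ?case
    proof
      assume u: "u \<in> {lo<..<hi}"
      then show "?v u = ennreal (form_norm (chart_form A (g s) c (\<beta> u)) (x' u))"
        using elim J by (intro metric_speed_eq_form_norm[OF E A G c inside _ cont]) auto
    qed
  qed
  have "((\<lambda>\<delta>. segment_mean ?v t \<delta>) \<longlongrightarrow> ennreal (?N (x' t))) (at 0)"
  proof (rule tendsto_ennreal_relative_squeeze[OF lebesgue_point_mean_tendsto[OF Nm _ lp]])
    show "0 \<le> ?N (x' u)" for u by (rule form_norm_nonneg[OF B[OF ct]])
    then show "0 \<le> ?N (x' t)" .
    fix \<epsilon> :: real assume \<epsilon>: "0 < \<epsilon>" "\<epsilon> < 1"
    obtain r where r: "0 < r" "nearly_constant_on_ball A (g s) c (\<beta> t) \<epsilon> r"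
      by (rule nearly_constant_on_small_ball[OF E A G c ct \<epsilon>]) (rule that)
    let ?V = "{q \<in> fst c. ?N (snd c q - snd c (\<beta> t)) < r}"
    have "open ?V" by (rule open_form_ball[OF E A c B[OF ct]])
    moreover have "\<beta> t \<in> ?V" using ct r by (simp add: form_norm_zero[OF B[OF ct]])
    ultimately have "\<forall>\<^sub>F u in at t. \<beta> u \<in> ?V"
      using cont[of t] J unfolding isCont_def by (auto dest: topological_tendstoD)
    then obtain d where d: "0 < d"
      "\<And>u. u \<noteq> t \<Longrightarrow> \<bar>u - t\<bar> < d \<Longrightarrow> \<beta> u \<in> fst c \<and> ?N (snd c (\<beta> u) - snd c (\<beta> t)) < r"
      unfolding eventually_at dist_real_def by auto
    have near: "\<beta> u \<in> fst c \<and> ?N (snd c (\<beta> u) - snd c (\<beta> t)) \<le> r" if "\<bar>u - t\<bar> < d" for u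
      using d(2)[of u] that ct r by (cases "u = t") (auto simp: form_norm_zero[OF B[OF ct]])
    define d' where "d' = min d (min (t - lo) (hi - t))"
    have d': "0 < d'" using d J by (simp add: d'_def)
    have main: "ennreal (1 - \<epsilon>) * segment_mean (\<lambda>u. ennreal (?N (x' u))) t \<delta> \<le> segment_mean ?v t \<delta>"
      "segment_mean ?v t \<delta> \<le> ennreal (1 + \<epsilon>) * segment_mean (\<lambda>u. ennreal (?N (x' u))) t \<delta>"
      if \<delta>: "\<bar>\<delta>\<bar> < d'" for \<delta>
    proof -
      let ?S = "closed_segment t (t + \<delta>)"
      have S: "\<bar>u - t\<bar> < d \<and> u \<in> {lo<..<hi}" if "u \<in> ?S" for u
        using that \<delta> by (auto simp: closed_segment_eq_real_ivl d'_def split: if_splits)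
      have m: "(\<lambda>u. ennreal (?N (x' u)) * indicator ?S u) \<in> borel_measurable lborel"
        using Nm closed_segment_borel by measurable
      have cmult: "ennreal k * (\<integral>\<^sup>+u\<in>?S. ennreal (?N (x' u)) \<partial>lborel)
          = (\<integral>\<^sup>+u. ennreal k * (ennreal (?N (x' u)) * indicator ?S u) \<partial>lebesgue)" for k
        using m by (simp add: nn_integral_completion nn_integral_cmult)
      have compare: "AE u in lebesgue.
          ennreal (1 - \<epsilon>) * (ennreal (?N (x' u)) * indicator ?S u) \<le> ?v u * indicator ?S u \<and>
          ?v u * indicator ?S u \<le> ennreal (1 + \<epsilon>) * (ennreal (?N (x' u)) * indicator ?S u)"
        using speed
      proof eventually_elim
        case (elim u)
        show ?case
        proof (cases "u \<in> ?S")
          case True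
          from S[OF this] have u: "\<bar>u - t\<bar> < d" "u \<in> {lo<..<hi}" by auto
          have "(1 - \<epsilon>) * ?N (x' u) \<le> form_norm (chart_form A (g s) c (\<beta> u)) (x' u)"
            "form_norm (chart_form A (g s) c (\<beta> u)) (x' u) \<le> (1 + \<epsilon>) * ?N (x' u)"
            using r(2) near[OF u(1)] unfolding nearly_constant_on_ball_def by blast+
          then have "ennreal (1 - \<epsilon>) * ennreal (?N (x' u)) \<le> ?v u" "?v u \<le> ennreal (1 + \<epsilon>) * ennreal (?N (x' u))"
            using elim u(2) \<epsilon> form_norm_nonneg[OF B[OF ct]]
            by (simp_all add: ennreal_mult[symmetric] ennreal_leI del: ennreal_plus)
          then show ?thesis using True by simp
        qed simp
      qed
      have low: "ennreal (1 - \<epsilon>) * (\<integral>\<^sup>+u\<in>?S. ennreal (?N (x' u)) \<partial>lborel) \<le> (\<integral>\<^sup>+u\<in>?S. ?v u \<partial>lebesgue)"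
        unfolding cmult by (rule nn_integral_mono_AE) (use compare in eventually_elim, simp)
      have up: "(\<integral>\<^sup>+u\<in>?S. ?v u \<partial>lebesgue) \<le> ennreal (1 + \<epsilon>) * (\<integral>\<^sup>+u\<in>?S. ennreal (?N (x' u)) \<partial>lborel)"
        unfolding cmult by (rule nn_integral_mono_AE) (use compare in eventually_elim, simp)
      show "ennreal (1 - \<epsilon>) * segment_mean (\<lambda>u. ennreal (?N (x' u))) t \<delta> \<le> segment_mean ?v t \<delta>"
        "segment_mean ?v t \<delta> \<le> ennreal (1 + \<epsilon>) * segment_mean (\<lambda>u. ennreal (?N (x' u))) t \<delta>"
        using divide_right_mono_ennreal[OF low, of "ennreal \<bar>\<delta>\<bar>"] divide_right_mono_ennreal[OF up, of "ennreal \<bar>\<delta>\<bar>"]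
        unfolding nn_integral_completion divide_ennreal_def by (simp_all add: mult.assoc)
    qed
    have "\<forall>\<^sub>F \<delta> in at 0. \<bar>\<delta>\<bar> < d'"
      unfolding eventually_at using d' by (intro exI[of _ d']) (auto simp: dist_real_def)
    then show "\<forall>\<^sub>F \<delta> in at 0.
        ennreal (1 - \<epsilon>) * segment_mean (\<lambda>u. ennreal (?N (x' u))) t \<delta> \<le> segment_mean ?v t \<delta> \<and>
        segment_mean ?v t \<delta> \<le> ennreal (1 + \<epsilon>) * segment_mean (\<lambda>u. ennreal (?N (x' u))) t \<delta>"
      by eventually_elim (use main in blast)
  qed
  moreover have "at 0 within {\<delta>. t + \<delta> \<in> {a..b}} = at 0"
  proof (rule at_within_nhd[of _ "{a - t<..<b - t}"])
    show "0 \<in> {a - t<..<b - t}" using J by simp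
  qed auto
  ultimately show ?thesis
    unfolding gen_metric_speed_def nn_integral_completion by (intro lim_imp_Limsup) simp_all
qed

text \<open>The quantifiers matter: the parameter \<open>s\<close> and the metric are chosen after the exceptional null set,
  which allows \<open>s = \<alpha> t\<close> later. The metric \<open>G0\<close> only serves to express absolute continuity of \<open>\<beta>\<close>.
  Nonnegativity is recorded so that the square root can be removed.\<close>

lemma AE_local_velocity_and_speed:
  assumes \<beta>: "abs_continuous_on (length_metric A G0) a b \<beta>" and G0: "continuous_riemannian_metric E A G0"
    and t0: "t0 \<in> {a..b}" and ab: "a < b"
  shows "\<exists>\<eta>>0. AE t in lebesgue. t \<in> {a<..<b} \<and> \<bar>t - t0\<bar> < \<eta> \<longrightarrow>
    curve_differentiable A \<beta> t \<and>
    (\<forall>g s. continuous_riemannian_metric E A (g s) \<longrightarrow>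
      gen_metric_speed A g a b \<beta> s t = ennreal (sqrt (g s (\<beta> t) (velocity A \<beta> t) (velocity A \<beta> t))) \<and>
      0 \<le> g s (\<beta> t) (velocity A \<beta> t) (velocity A \<beta> t))"
    (is "\<exists>\<eta>>0. AE t in lebesgue. _ t \<eta> \<longrightarrow> ?P t")
proof -
  obtain c where c: "c \<in> A" "\<beta> t0 \<in> fst c" using chart_exists[OF A] by blast
  obtain \<eta> where \<eta>: "0 < \<eta>" "\<And>t. t \<in> {max a (t0 - \<eta>)..min b (t0 + \<eta>)} \<Longrightarrow> \<beta> t \<in> fst c"
    "\<And>u. u \<in> E \<Longrightarrow> abs_cont (max a (t0 - \<eta>)) (min b (t0 + \<eta>)) (\<lambda>t. inner (snd c (\<beta> t)) u)"
    by (rule abs_continuous_coordinates[OF E A G0 \<beta> t0 c]) (rule that)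
  define lo hi where "lo = max a (t0 - \<eta>)" and "hi = min b (t0 + \<eta>)"
  have J: "a \<le> lo" "hi \<le> b" "lo < hi" using \<eta>(1) t0 ab by (auto simp: lo_def hi_def)
  have "\<exists>\<rho>. integrable lborel \<rho> \<and> (\<forall>s t. lo \<le> s \<longrightarrow> s \<le> t \<longrightarrow> t \<le> hi \<longrightarrow>
      inner (snd c (\<beta> t)) i - inner (snd c (\<beta> s)) i = (LINT u:{s..t}|lborel. \<rho> u))" if "i \<in> E" for i
    by (rule abs_cont_indefinite_integral[OF \<eta>(3)[OF that, folded lo_def hi_def] J(3)]) blast
  then obtain \<rho> where \<rho>: "\<And>i. i \<in> E \<Longrightarrow> integrable lborel (\<rho> i)"
    "\<And>i s t. i \<in> E \<Longrightarrow> lo \<le> s \<Longrightarrow> s \<le> t \<Longrightarrow> t \<le> hi \<Longrightarrow>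
      inner (snd c (\<beta> t)) i - inner (snd c (\<beta> s)) i = (LINT u:{s..t}|lborel. \<rho> i u)"
    by metis
  have fin: "finite E" using E by (simp add: orthonormal_basis_def)
  have lp: "AE t in lebesgue. \<forall>i\<in>E. lebesgue_point (\<rho> i) t"
    using \<rho>(1) by (intro AE_finite_allI[OF fin] AE_lebesgue_point)
  let ?x' = "\<lambda>u. \<Sum>i\<in>E. \<rho> i u *\<^sub>R i"
  have D: "((snd c \<circ> \<beta>) has_vector_derivative ?x' t) (at t)"
    if t: "t \<in> {lo<..<hi}" "\<forall>i\<in>E. lebesgue_point (\<rho> i) t" for t
  proof -
    have "((\<lambda>t. inner (snd c (\<beta> t)) i) has_real_derivative \<rho> i t) (at t)" if "i \<in> E" for i
      using t that by (intro abs_cont_derivative_at_lebesgue_point[of "\<rho> i" lo hi] \<rho>) auto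
    then have "((\<lambda>t. inner (snd c (\<beta> t)) i *\<^sub>R i) has_vector_derivative \<rho> i t *\<^sub>R i) (at t)" if "i \<in> E" for i
      using that by (auto intro!: has_vector_derivative_scaleR[THEN has_vector_derivative_eq_rhs] has_vector_derivative_const)
    then have "((\<lambda>t. \<Sum>i\<in>E. inner (snd c (\<beta> t)) i *\<^sub>R i) has_vector_derivative ?x' t) (at t)"
      by (intro has_vector_derivative_sum)
    then show ?thesis by (simp add: orthonormal_basis_expansion[OF E] comp_def)
  qed
  have AE_D: "AE u in lebesgue. u \<in> {lo<..<hi} \<longrightarrow> ((snd c \<circ> \<beta>) has_vector_derivative ?x' u) (at u)"
    using lp by eventually_elim (use D in blast)
  have inside: "\<beta> u \<in> fst c" if "u \<in> {lo<..<hi}" for u using that \<eta>(2)[of u] by (simp add: lo_def hi_def)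
  have cont: "isCont \<beta> u" if "u \<in> {lo<..<hi}" for u
    using that J by (intro abs_continuous_curve_isCont[OF E A G0 \<beta>]) auto
  show ?thesis
  proof (intro exI[of _ \<eta>] conjI \<eta>(1))
    show "AE t in lebesgue. t \<in> {a<..<b} \<and> \<bar>t - t0\<bar> < \<eta> \<longrightarrow> ?P t"
      using lp
    proof eventually_elim
      case (elim t)
      show ?case
      proof (rule impI, intro conjI allI impI)
        assume t': "t \<in> {a<..<b} \<and> \<bar>t - t0\<bar> < \<eta>"
        then have t: "t \<in> {lo<..<hi}" by (auto simp: lo_def hi_def)
        have ct: "\<beta> t \<in> fst c" by (rule inside[OF t])
        note Dt = D[OF t elim]
        show "curve_differentiable A \<beta> t"
          unfolding curve_differentiable_def
        proof (intro conjI cont[OF t] ballI, clarify)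
          fix U \<phi> assume "(U, \<phi>) \<in> A" "\<beta> t \<in> U"
          moreover have "(snd c \<circ> \<beta>) differentiable (at t)"
            using Dt by (auto simp: has_vector_derivative_def differentiable_def)
          ultimately show "(\<phi> \<circ> \<beta>) differentiable (at t)"
            using differentiable_change_chart[of A c \<beta> t "(U, \<phi>)"] A c(1) ct cont[OF t] by simp
        qed
        fix g and s :: real assume G: "continuous_riemannian_metric E A (g s)"
        have v: "velocity A \<beta> t = coord_vector A c (\<beta> t) (?x' t)"
          by (rule velocity_eq_coord_vector[OF A c(1) ct cont[OF t] Dt])
        note B = inner_form_chart_form_metric[OF E A G c(1) ct]
        have eq: "g s (\<beta> t) (velocity A \<beta> t) (velocity A \<beta> t) = chart_form A (g s) c (\<beta> t) (?x' t) (?x' t)"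
          by (simp add: v chart_form_def)
        show "0 \<le> g s (\<beta> t) (velocity A \<beta> t) (velocity A \<beta> t)"
          unfolding eq by (rule form_nonneg[OF B])
        have "gen_metric_speed A g a b \<beta> s t = ennreal (form_norm (chart_form A (g s) c (\<beta> t)) (?x' t))"
          using \<rho>(1) elim
          by (intro gen_metric_speed_eq_form_norm[where lo = lo and hi = hi and \<rho> = \<rho> and \<beta> = \<beta> and g = g and s = s]
                G c(1) J(1,2) t inside cont AE_D)
            (auto dest: borel_measurable_integrable)
        then show "gen_metric_speed A g a b \<beta> s t = ennreal (sqrt (g s (\<beta> t) (velocity A \<beta> t) (velocity A \<beta> t)))"
          by (simp add: eq form_norm_def)
      qed
    qed
  qed
qed

end

lemma AE_differentiable_of_abs_cont:
  assumes f: "abs_cont a b f"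
  shows "AE t in lebesgue. t \<in> {a<..<b} \<longrightarrow> f differentiable (at t)"
proof (cases "a < b")
  case True
  obtain \<rho> where \<rho>: "integrable lborel \<rho>"
    "\<And>s t. a \<le> s \<Longrightarrow> s \<le> t \<Longrightarrow> t \<le> b \<Longrightarrow> f t - f s = (LINT u:{s..t}|lborel. \<rho> u)"
    by (rule abs_cont_indefinite_integral[OF f True]) (rule that)
  show ?thesis
    using AE_lebesgue_point[OF \<rho>(1)]
  proof eventually_elim
    case (elim t)
    show ?case
    proof
      assume "t \<in> {a<..<b}"
      then have "(f has_real_derivative \<rho> t) (at t)"
        using elim by (intro abs_cont_derivative_at_lebesgue_point[OF \<rho>]) auto
      then show "f differentiable (at t)"
        unfolding has_field_derivative_def by (rule differentiableI)
    qed
  qed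
qed auto

theorem corollary4p15:
  fixes E :: "'e::real_inner set"
    and A :: "('a::{t2_space,second_countable_topology}, 'e) chart set"
    and I :: "real set"
    and h :: "real \<times> 'a \<Rightarrow> real"
    and g :: "real \<Rightarrow> 'a \<Rightarrow> 'a tangent \<Rightarrow> 'a tangent \<Rightarrow> real"
    and a b :: real
    and \<alpha> :: "real \<Rightarrow> real"
    and \<beta> :: "real \<Rightarrow> 'a"
  assumes "orthonormal_basis E"
    and "smooth_atlas A"
    and "open I" and "is_interval I"
    and "continuous_on (I \<times> UNIV) h" and "\<forall>z \<in> I \<times> UNIV. h z > 0"
    and "\<forall>s\<in>I. continuous_riemannian_metric E A (g s)"
    and "\<forall>c\<in>A. \<forall>i\<in>E. \<forall>j\<in>E.
           continuous_on (I \<times> fst c) (\<lambda>(s, p). metric_coeff A (g s) c i j p)"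
    and "abs_continuous_curve A I g a b \<alpha> \<beta>"
  shows "AE t\<in>{a..b} in lebesgue.
      \<alpha> differentiable (at t) \<and> curve_differentiable A \<beta> t \<and>
      ereal (spacetime_metric h g (\<alpha> t, \<beta> t)
               (deriv \<alpha> t, velocity A \<beta> t) (deriv \<alpha> t, velocity A \<beta> t))
        = - gen_length_element_sq A h g a b \<alpha> \<beta> t \<and>
      - gen_length_element_sq A h g a b \<alpha> \<beta> t
        = - ereal ((h (\<alpha> t, \<beta> t))\<^sup>2 * (deriv \<alpha> t)\<^sup>2)
            + (enn2ereal (gen_metric_speed A g a b \<beta> (\<alpha> t) t))\<^sup>2"
proof -
  note E = assms(1) and A = assms(2) and metric = assms(7)
  obtain s0 where s0: "s0 \<in> I" "abs_continuous_on (length_metric A (g s0)) a b \<beta>"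
    and \<alpha>I: "\<alpha> ` {a..b} \<subseteq> I" and \<alpha>: "abs_continuous_on (\<lambda>x y. ennreal (dist x y)) a b \<alpha>"
    using assms(9) unfolding abs_continuous_curve_def by blast
  have "abs_cont a b \<alpha>"
    by (rule abs_cont_dominated[OF \<alpha>, of _ _ 1]) (auto simp: dist_real_def abs_minus_commute)
  then have \<alpha>D: "AE t in lebesgue. t \<in> {a<..<b} \<longrightarrow> \<alpha> differentiable (at t)"
    by (rule AE_differentiable_of_abs_cont)
  have \<beta>D: "AE t in lebesgue. t \<in> {a..b} \<longrightarrow> curve_differentiable A \<beta> t \<and>
    (\<forall>g s. continuous_riemannian_metric E A (g s) \<longrightarrow>
      gen_metric_speed A g a b \<beta> s t = ennreal (sqrt (g s (\<beta> t) (velocity A \<beta> t) (velocity A \<beta> t))) \<and>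
      0 \<le> g s (\<beta> t) (velocity A \<beta> t) (velocity A \<beta> t))"
    using metric s0 by (intro AE_closed_interval_local AE_local_velocity_and_speed[OF E A s0(2)]) auto
  have "AE t in lebesgue. t \<noteq> a" "AE t in lebesgue. t \<noteq> b"
    by (auto intro!: AE_completion AE_lborel_singleton)
  with \<alpha>D \<beta>D show ?thesis
  proof eventually_elim
    case (elim t)
    show ?case
    proof
      assume t: "t \<in> {a..b}"
      let ?q = "g (\<alpha> t) (\<beta> t) (velocity A \<beta> t) (velocity A \<beta> t)"
      have \<alpha>t: "\<alpha> differentiable (at t)" using elim t by auto
      have "continuous_riemannian_metric E A (g (\<alpha> t))" using metric \<alpha>I t by blast
      then have v: "gen_metric_speed A g a b \<beta> (\<alpha> t) t = ennreal (sqrt ?q)" and q: "0 \<le> ?q"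
        and \<beta>t: "curve_differentiable A \<beta> t"
        using elim t by blast+
      have v2: "(enn2ereal (gen_metric_speed A g a b \<beta> (\<alpha> t) t))\<^sup>2 = ereal ?q"
        unfolding v using q by (simp add: enn2ereal_ennreal power2_eq_square)
      show "\<alpha> differentiable (at t) \<and> curve_differentiable A \<beta> t \<and>
        ereal (spacetime_metric h g (\<alpha> t, \<beta> t)
               (deriv \<alpha> t, velocity A \<beta> t) (deriv \<alpha> t, velocity A \<beta> t))
        = - gen_length_element_sq A h g a b \<alpha> \<beta> t \<and>
        - gen_length_element_sq A h g a b \<alpha> \<beta> t
        = - ereal ((h (\<alpha> t, \<beta> t))\<^sup>2 * (deriv \<alpha> t)\<^sup>2)
            + (enn2ereal (gen_metric_speed A g a b \<beta> (\<alpha> t) t))\<^sup>2"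
        unfolding gen_length_element_sq_def v2 using \<alpha>t \<beta>t
        by (simp add: spacetime_metric_def power2_eq_square)
    qed
  qed
qed

end
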